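(* Let $F\subseteq\mathbb{R}^2$ be a self-similar set containing at least two points, being the attractor of an IFS $\{S_i\}_{i\in\mathcal{I}}$ with orthogonal parts $\{O_i\}_{i\in\mathcal{I}}\subset O(2)$. (a) Suppose that the group generated by $\{O_i\}_{i\in\mathcal{I}}$ is discrete. Then, for any given $\theta\in[0,\pi)$: 1. if $\mathcal{H}^{\dim_{\mathrm{H}}\pi_\theta F}(\pi_\theta F)>0$, then $\dim_{\mathrm{A}}\pi_\theta F=\dim_{\mathrm{H}}\pi_\theta F$; 2. if $\mathcal{H}^{\dim_{\mathrm{H}}\pi_\theta F}(\pi_\theta F)=0$, then $\dim_{\mathrm{A}}\pi_\theta F=1$. (b) Suppose instead that the group generated by $\{O_i\}_{i\in\mathcal{I}}$ is dense in $O(2)$ or in $SO(2)$. Then $\dim_{\mathrm{A}}\pi_\theta F=1$ for all $\theta\in[0,\pi)$.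
   Context: An IFS here is a finite collection $\{S_i\}_{i\in\mathcal{I}}$ of contracting similarities of $\mathbb{R}^2$ mapping $[0,1]^2$ into itself, each written uniquely as $S_i(x)=c_iO_i(x)+t_i$ with $c_i\in(0,1)$, $O_i\in O(2)$ (the orthogonal part) and $t_i\in\mathbb{R}^2$. Its attractor is the unique non-empty compact set $F$ with $F=\bigcup_{i\in\mathcal{I}}S_i(F)$; such $F$ is called self-similar. No separation condition is assumed. $O(2)$ is the group of orthogonal $2\times2$ matrices and $SO(2)$ its subgroup of orientation-preserving matrices; "discrete" (equivalently finite) and "dense" refer to the usual topology. For $\theta\in[0,\pi)$, $\pi_\theta$ denotes orthogonal projection of $\mathbb{R}^2$ onto the line through the origin forming angle $\theta$ with the positive $x$-axis. $\dim_{\mathrm{H}}$ is Hausdorff dimension and $\mathcal{H}^s$ is $s$-dimensional Hausdorff measure. For a non-empty set $E$ and $r>0$, $N_r(E)$ is the smallest number of open sets of diameter at most $r$ needed to cover $E$. The Assouad dimension of a non-empty set $F\subseteq\mathbb{R}^d$ is $$\dim_{\mathrm{A}}F=\inf\Big\{s\ge 0:\ (\exists C>0)(\forall R>0)(\forall r\in(0,R))(\forall x\in F)\ N_r(B(x,R)\cap F)\le C\Big(\frac{R}{r}\Big)^s\Big\},$$ where $B(x,R)$ is the open Euclidean ball. *)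

theory Defs
  imports "HOL-Analysis.Analysis" "HOL-Algebra.Generated_Groups"
begin

section \<open>Hausdorff measure and Hausdorff dimension\<close>

text \<open>
  The \<open>s\<close>-th power of the diameter of a covering set, with the usual conventions for \<open>s = 0\<close>:
  a nonempty set contributes \<open>1\<close> (even if its diameter is \<open>0\<close>) and the empty set contributes \<open>0\<close>.
  These have to be made explicit because \<open>0 powr 0 = 0\<close>.
\<close>

definition diam_power :: "real \<Rightarrow> 'a::metric_space set \<Rightarrow> ennreal" where
  "diam_power s U =
     (if U = {} then 0 else if s = 0 then 1 else ennreal (diameter U powr s))"

text \<open>
  Boundedness is required separately in covers, since \<^const>\<open>diameter\<close> is a real supremum and
  hence meaningless for unbounded sets.  Finite covers are included by padding with \<open>{}\<close>.
\<close>

definition hausdorff_premeasure :: "real \<Rightarrow> real \<Rightarrow> 'a::metric_space set \<Rightarrow> ennreal" where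
  "hausdorff_premeasure s \<delta> E =
     (INF U \<in> {U :: nat \<Rightarrow> 'a set.
                 E \<subseteq> (\<Union>i. U i) \<and> (\<forall>i. bounded (U i) \<and> diameter (U i) \<le> \<delta>)}.
        \<Sum>i. diam_power s (U i))"

definition hausdorff_measure :: "real \<Rightarrow> 'a::metric_space set \<Rightarrow> ennreal" where
  "hausdorff_measure s E = (SUP \<delta> \<in> {0<..}. hausdorff_premeasure s \<delta> E)"

text \<open>
  The type is restricted to Euclidean spaces, where the set below is never empty (it contains every
  \<open>s > DIM('a)\<close>), so that the real-valued infimum is the true one.  The same applies to
  \<open>assouad_dim\<close> below, whose set contains \<open>DIM('a)\<close>.
\<close>

definition hausdorff_dim :: "'a::euclidean_space set \<Rightarrow> real" where
  "hausdorff_dim E = Inf {s. 0 \<le> s \<and> hausdorff_measure s E = 0}"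


section \<open>Covering numbers and Assouad dimension\<close>

text \<open>The value is \<open>\<infinity>\<close> if there is no finite cover.\<close>

definition covering_number :: "real \<Rightarrow> 'a::metric_space set \<Rightarrow> enat" where
  "covering_number r E =
     (INF \<U> \<in> {\<U>. finite \<U> \<and> (\<forall>U\<in>\<U>. open U \<and> bounded U \<and> diameter U \<le> r) \<and> E \<subseteq> \<Union>\<U>}.
        enat (card \<U>))"

definition assouad_dim :: "'a::euclidean_space set \<Rightarrow> real" where
  "assouad_dim F =
     Inf {s. 0 \<le> s \<and>
            (\<exists>C>0. \<forall>R>0. \<forall>r\<in>{0<..<R}. \<forall>x\<in>F.
               ereal_of_enat (covering_number r (ball x R \<inter> F)) \<le> ereal (C * (R / r) powr s))}"


section \<open>Self-similar sets in the plane\<close>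

definition similarity_ifs ::
  "'i set \<Rightarrow> ('i \<Rightarrow> real^2 \<Rightarrow> real^2) \<Rightarrow> ('i \<Rightarrow> real) \<Rightarrow> ('i \<Rightarrow> real^2^2) \<Rightarrow> ('i \<Rightarrow> real^2) \<Rightarrow> bool" where
  "similarity_ifs I S c Q t \<longleftrightarrow>
     finite I \<and>
     (\<forall>i\<in>I. 0 < c i \<and> c i < 1 \<and> orthogonal_matrix (Q i) \<and>
             (\<forall>x. S i x = c i *\<^sub>R (Q i *v x) + t i) \<and>
             S i ` cbox 0 1 \<subseteq> cbox 0 1)"

definition is_attractor :: "'i set \<Rightarrow> ('i \<Rightarrow> 'a \<Rightarrow> 'a) \<Rightarrow> 'a::metric_space set \<Rightarrow> bool" where
  "is_attractor I S F \<longleftrightarrow> F \<noteq> {} \<and> compact F \<and> F = (\<Union>i\<in>I. S i ` F)"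

lemma unit_square: "cbox 0 (1 :: real^2) = {x. \<forall>i. 0 \<le> x $ i \<and> x $ i \<le> 1}"
  by (auto simp: mem_box_cart)


section \<open>The orthogonal group\<close>

definition orthogonal_group :: "(real^'n^'n) monoid" where
  "orthogonal_group = \<lparr>carrier = {Q. orthogonal_matrix Q}, mult = (**), one = mat 1\<rparr>"

lemma group_orthogonal_group: "group (orthogonal_group :: (real^'n^'n) monoid)"
proof (rule groupI)
  fix Q :: "real^'n^'n"
  assume "Q \<in> carrier orthogonal_group"
  then show "\<exists>P\<in>carrier orthogonal_group. P \<otimes>\<^bsub>orthogonal_group\<^esub> Q = \<one>\<^bsub>orthogonal_group\<^esub>"
    by (intro bexI[of _ "transpose Q"]) (auto simp: orthogonal_group_def orthogonal_matrix_def)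
qed (auto simp: orthogonal_group_def orthogonal_matrix_mul orthogonal_matrix_id matrix_mul_assoc)

definition dense_in :: "'a::topological_space set \<Rightarrow> 'a set \<Rightarrow> bool" where
  "dense_in A X \<longleftrightarrow> A \<subseteq> X \<and> X \<subseteq> closure A"


section \<open>Orthogonal projections onto lines\<close>

definition direction :: "real \<Rightarrow> real^2" where
  "direction \<theta> = vector [cos \<theta>, sin \<theta>]"

definition line_proj :: "real \<Rightarrow> real^2 \<Rightarrow> real^2" where
  "line_proj \<theta> x = (x \<bullet> direction \<theta>) *\<^sub>R direction \<theta>"

lemma line_proj_orthogonal:
  "line_proj \<theta> x \<in> span {direction \<theta>}"
  "y \<in> span {direction \<theta>} \<Longrightarrow> orthogonal (x - line_proj \<theta> x) y"
proof -
  have "direction \<theta> \<bullet> direction \<theta> = 1"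
    by (simp add: direction_def inner_vec_def sum_2 flip: power2_eq_square)
  then show "y \<in> span {direction \<theta>} \<Longrightarrow> orthogonal (x - line_proj \<theta> x) y"
    by (auto simp: line_proj_def orthogonal_def span_singleton inner_diff_left)
qed (simp add: line_proj_def span_mul span_base)

end

theory Submission
  imports Defs
begin

text \<open>
  All work is done for compact \<open>A \<subseteq> \<real>\<close>, the coordinates of the projected set.  In the discrete case every
  ball centred in \<open>A\<close> contains a comparable homothetic copy of \<open>A\<close> inside \<open>A\<close>, because the finitely
  many orthogonal parts can be undone by words of bounded length.  Disjoint copies with ratios
  \<open>k j\<close> satisfy \<open>(\<Sum>j. k j powr s) \<le> 1\<close> for \<open>s = dim\<^sub>H A\<close>.  If some ball contains copies of far too large
  total weight, images of that ball pack \<open>A\<close> so well that their doubles cover \<open>A\<close> at small cost; hence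
  positive Hausdorff measure bounds the local packing numbers by a multiple of \<open>(R / r) powr s\<close>.

  If the measure vanishes, there are distinct homothetic copies of \<open>A\<close> in \<open>A\<close> that nearly coincide:
  otherwise a ball of radius \<open>r\<close> meets boundedly many cylinders of size \<open>r\<close>, so a cheap cover of \<open>A\<close>
  becomes a cheap cylinder cover, and iterating it makes a smaller exponent null.  Near coincidences
  produce, by prepending one point at a time, arbitrarily long chains in \<open>A\<close> with comparable
  increments, which force Assouad dimension \<open>1\<close>.  For a dense group such chains come from rotations
  instead: a strongly contracted chain and a distant point project to adjacent positions after a
  slight change of direction.
\<close>

section \<open>Hausdorff null sets and ball covers\<close>

text \<open>No separation is assumed, so words cannot be counted: different words may give
  overlapping or even equal projected cylinders. In the null case one therefore counts projected
  maps. Such a map is determined by its rotation, its ratio and one coordinate of its translation,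
  and two of them in the same cell of a fine grid can be completed to nearly equal homotheties. In
  the positive case nothing is integrated: for \<open>s > 0\<close> positivity is used only as the
  absence of covers of cost below some fixed \<epsilon>, and near maximality of a disjoint family
  takes the place of a covering theorem. All estimates use finite families of balls, because only
  the alternative "null or not" enters. Exponent 0 belongs to the positive case, since a non-empty
  set is never null for it; this includes projections that are a single point.\<close>

definition ball_covered :: "real \<Rightarrow> real \<Rightarrow> 'a::metric_space set \<Rightarrow> bool" where
  "ball_covered t \<epsilon> A \<longleftrightarrow> (\<exists>B. finite B \<and> (\<forall>b\<in>B. snd b > 0) \<and>
      A \<subseteq> (\<Union>b\<in>B. ball (fst b) (snd b)) \<and> (\<Sum>b\<in>B. snd b powr t) < \<epsilon>)"

text \<open>No bound on the radii is imposed: for \<open>t > 0\<close> a cost below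
  \<open>d powr t\<close> already forces every radius below \<open>d\<close>. Asking for finite
  covers is harmless on compact sets and allows induction on the number of balls.\<close>

definition ball_null :: "real \<Rightarrow> 'a::metric_space set \<Rightarrow> bool" where
  "ball_null t A \<longleftrightarrow> (\<forall>\<epsilon>>0. ball_covered t \<epsilon> A)"

lemma ball_coveredI:
  assumes J: "finite J" "\<And>j. j \<in> J \<Longrightarrow> r j > 0"
      "A \<subseteq> (\<Union>j\<in>J. ball (x j) (r j))" "(\<Sum>j\<in>J. r j powr t) < \<epsilon>"
  shows "ball_covered t \<epsilon> A"
proof -
  have "(\<Sum>b\<in>(\<lambda>j. (x j, r j)) ` J. snd b powr t) \<le> (\<Sum>j\<in>J. r j powr t)"
    using sum_image_le[OF J(1), of "\<lambda>b. snd b powr t" "\<lambda>j. (x j, r j)"] by (simp add: o_def)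
  then show ?thesis
    unfolding ball_covered_def
    using J by (intro exI[of _ "(\<lambda>j. (x j, r j)) ` J"]) auto
qed

lemma ball_coveredE:
  assumes "ball_covered t \<epsilon> A"
  obtains B where "finite B" "\<And>b. b \<in> B \<Longrightarrow> snd b > 0"
      "A \<subseteq> (\<Union>b\<in>B. ball (fst b) (snd b))" "(\<Sum>b\<in>B. snd b powr t) < \<epsilon>"
  using assms unfolding ball_covered_def by auto

lemma ball_nullI: "(\<And>\<epsilon>. \<epsilon> > 0 \<Longrightarrow> ball_covered t \<epsilon> A) \<Longrightarrow> ball_null t A"
  by (simp add: ball_null_def)

lemma ball_nullD:
  assumes "ball_null t A" "\<epsilon> > 0"
  obtains B where "finite B" "\<And>b. b \<in> B \<Longrightarrow> snd b > 0"
      "A \<subseteq> (\<Union>b\<in>B. ball (fst b) (snd b))" "(\<Sum>b\<in>B. snd b powr t) < \<epsilon>"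
proof -
  have "ball_covered t \<epsilon> A" using assms by (simp add: ball_null_def)
  then show thesis by (rule ball_coveredE) (rule that)
qed

lemma ball_covered_Un:
  assumes "ball_covered t \<epsilon> A" "ball_covered t \<epsilon>' A'"
  shows "ball_covered t (\<epsilon> + \<epsilon>') (A \<union> A')"
proof -
  obtain B where B: "finite B" "\<And>b. b \<in> B \<Longrightarrow> snd b > 0"
      "A \<subseteq> (\<Union>b\<in>B. ball (fst b) (snd b))" "(\<Sum>b\<in>B. snd b powr t) < \<epsilon>"
    using assms(1) by (rule ball_coveredE) (rule that)
  obtain B' where B': "finite B'" "\<And>b. b \<in> B' \<Longrightarrow> snd b > 0"
      "A' \<subseteq> (\<Union>b\<in>B'. ball (fst b) (snd b))" "(\<Sum>b\<in>B'. snd b powr t) < \<epsilon>'"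
    using assms(2) by (rule ball_coveredE) (rule that)
  have "(\<Sum>b\<in>B \<union> B'. snd b powr t) \<le> (\<Sum>b\<in>B. snd b powr t) + (\<Sum>b\<in>B'. snd b powr t)"
    using B(1) B'(1) by (simp add: sum_Un sum_nonneg)
  then show ?thesis
    using B B' by (intro ball_coveredI[of "B \<union> B'" snd _ fst]) auto
qed

lemma ball_covered_mono:
  assumes "ball_covered t \<epsilon> A" "A' \<subseteq> A" "\<epsilon> \<le> \<epsilon>'"
  shows "ball_covered t \<epsilon>' A'"
proof -
  obtain B where B: "finite B" "\<And>b. b \<in> B \<Longrightarrow> snd b > 0"
      "A \<subseteq> (\<Union>b\<in>B. ball (fst b) (snd b))" "(\<Sum>b\<in>B. snd b powr t) < \<epsilon>"
    using assms(1) by (rule ball_coveredE) (rule that)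
  then show ?thesis
    using assms by (intro ball_coveredI[of B snd _ fst]) auto
qed

lemma ball_null_singleton:
  assumes "t > 0"
  shows "ball_null t {x}"
proof (rule ball_nullI)
  fix \<epsilon> :: real assume \<epsilon>: "\<epsilon> > 0"
  have "((\<epsilon> / 2) powr (1 / t)) powr t < \<epsilon>" using \<epsilon> assms by (simp add: powr_powr)
  then show "ball_covered t \<epsilon> {x}"
    using \<epsilon> by (intro ball_coveredI[of "{x}" "\<lambda>_. (\<epsilon> / 2) powr (1 / t)" _ "\<lambda>x. x"]) auto
qed

lemma ball_null_lipschitz:
  assumes A: "ball_null t A" and L: "L > 0"
    and f: "\<And>x y. dist (f x) (f y) \<le> L * dist x y"
  shows "ball_null t (f ` A)"
proof (rule ball_nullI)
  fix \<epsilon> :: real assume "\<epsilon> > 0"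
  then have "\<epsilon> / L powr t > 0"
    using L by simp
  from ball_nullD[OF A this] obtain B where B: "finite B" "\<And>b. b \<in> B \<Longrightarrow> snd b > 0"
      "A \<subseteq> (\<Union>b\<in>B. ball (fst b) (snd b))" "(\<Sum>b\<in>B. snd b powr t) < \<epsilon> / L powr t"
    by blast
  have "(\<Sum>b\<in>B. (L * snd b) powr t) = L powr t * (\<Sum>b\<in>B. snd b powr t)"
    using B(2) L by (simp add: powr_mult sum_distrib_left less_imp_le)
  also have "\<dots> < \<epsilon>"
    using B(4) L by (simp add: field_simps)
  finally have sum: "(\<Sum>b\<in>B. (L * snd b) powr t) < \<epsilon>" .
  have "f ` A \<subseteq> (\<Union>b\<in>B. ball (f (fst b)) (L * snd b))"
  proof
    fix y assume "y \<in> f ` A"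
    then obtain x where x: "x \<in> A" "y = f x" by auto
    then obtain b where b: "b \<in> B" "dist (fst b) x < snd b"
      using B(3) by auto
    have "dist (f (fst b)) (f x) \<le> L * dist (fst b) x" by (rule f)
    also have "\<dots> < L * snd b" using b L by simp
    finally show "y \<in> (\<Union>b\<in>B. ball (f (fst b)) (L * snd b))"
      using b x by auto
  qed
  then show "ball_covered t \<epsilon> (f ` A)"
    using B L sum by (intro ball_coveredI[of B "\<lambda>b. L * snd b" _ "\<lambda>b. f (fst b)"]) auto
qed

lemma ball_null_mono_exponent:
  assumes A: "ball_null t A" and le: "t \<le> t'" and t: "t > 0"
  shows "ball_null t' A"
proof (rule ball_nullI)
  fix \<epsilon> :: real assume "\<epsilon> > 0"
  \<comment> \<open>A cost below 1 forces all radii below 1, where a larger exponent does not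
    increase any term.\<close>
  then have "min 1 \<epsilon> > 0" by simp
  from ball_nullD[OF A this] obtain B where B: "finite B" "\<And>b. b \<in> B \<Longrightarrow> snd b > 0"
      "A \<subseteq> (\<Union>b\<in>B. ball (fst b) (snd b))" "(\<Sum>b\<in>B. snd b powr t) < min 1 \<epsilon>"
    by blast
  have "snd b powr t' \<le> snd b powr t" if "b \<in> B" for b
  proof -
    have "snd b powr t \<le> (\<Sum>b\<in>B. snd b powr t)"
      using B(1) that by (intro member_le_sum) auto
    also have "\<dots> < 1" using B(4) by simp
    finally have "snd b < 1"
      using t B(2)[OF that] by (smt (verit) ge_one_powr_ge_zero)
    then show ?thesis
      using B(2)[OF that] le by (intro powr_mono') auto
  qed
  then have "(\<Sum>b\<in>B. snd b powr t') \<le> (\<Sum>b\<in>B. snd b powr t)"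
    by (intro sum_mono)
  then have "(\<Sum>b\<in>B. snd b powr t') < \<epsilon>" using B(4) by simp
  then show "ball_covered t' \<epsilon> A"
    using B by (intro ball_coveredI[of B snd _ fst]) auto
qed

section \<open>Comparison of ball covers with Hausdorff measure\<close>

lemma diameter_ball_le:
  assumes "r > 0"
  shows "diameter (ball (x :: 'a::metric_space) r) \<le> 2 * r"
proof -
  have "dist y z \<le> 2 * r" if "y \<in> ball x r" "z \<in> ball x r" for y z
    using that dist_triangle[of y z x] by (simp add: dist_commute)
  then show ?thesis
    using assms unfolding diameter_def by (auto intro!: cSUP_least)
qed

lemma diam_power_ball_le:
  assumes "r > 0" "t > 0"
  shows "diam_power t (ball x r) \<le> ennreal (2 powr t * r powr t)"
proof -
  have "diameter (ball x r) \<le> 2 * r"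
    using assms by (intro diameter_ball_le)
  moreover have "0 \<le> diameter (ball x r)" by (simp add: diameter_ge_0)
  ultimately have "diameter (ball x r) powr t \<le> (2 * r) powr t"
    using assms by (intro powr_mono2) auto
  then show ?thesis
    using assms unfolding diam_power_def by (auto simp: powr_mult intro!: ennreal_leI)
qed

lemma ball_null_imp_hausdorff_null:
  fixes A :: "'a::metric_space set"
  assumes A: "ball_null t A" and t: "t > 0"
  shows "hausdorff_measure t A = 0"
proof -
  have "hausdorff_premeasure t \<delta> A \<le> ennreal e" if "\<delta> > 0" "e > 0" for \<delta> e :: real
  proof -
    \<comment> \<open>Balls of radius \<open>r\<close> have diameter at most \<open>2 * r\<close>,
      which costs the factor \<open>2 powr t\<close>. The second bound forces each radius below
      \<delta>/2, so the mesh condition comes for free.\<close>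
    define \<epsilon> where "\<epsilon> = min (e / 2 powr t) ((\<delta>/2) powr t)"
    have "\<epsilon> > 0" using that by (simp add: \<epsilon>_def)
    from ball_nullD[OF A this] obtain B where B: "finite B" "\<And>b. b \<in> B \<Longrightarrow> snd b > 0"
      "A \<subseteq> (\<Union>b\<in>B. ball (fst b) (snd b))" "(\<Sum>b\<in>B. snd b powr t) < \<epsilon>"
      by blast
    have small: "snd b < \<delta> / 2" if "b \<in> B" for b
    proof -
      have "snd b powr t \<le> (\<Sum>b\<in>B. snd b powr t)"
        using B(1) that by (intro member_le_sum) auto
      also have "\<dots> < (\<delta>/2) powr t" using B(4) by (simp add: \<epsilon>_def)
      finally show ?thesis
        using t \<open>\<delta> > 0\<close> by (smt (verit) powr_mono2 divide_pos_pos)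
    qed
    obtain h where h: "bij_betw h {..<card B} B"
      using ex_bij_betw_nat_finite[OF B(1)] by (auto simp: lessThan_atLeast0)
    define U where "U i = (if i < card B then ball (fst (h i)) (snd (h i)) else {})" for i
    have hB: "h i \<in> B" if "i < card B" for i
      using h that by (auto simp: bij_betw_def)
    have cover: "A \<subseteq> (\<Union>i. U i)"
    proof
      fix x assume "x \<in> A"
      then obtain b where b: "b \<in> B" "x \<in> ball (fst b) (snd b)" using B(3) by blast
      moreover have "b \<in> h ` {..<card B}" using h b by (simp add: bij_betw_def)
      then obtain i where "i < card B" "h i = b" by auto
      ultimately show "x \<in> (\<Union>i. U i)" using b by (auto simp: U_def intro!: exI[of _ i])
    qed
    have diam: "bounded (U i) \<and> diameter (U i) \<le> \<delta>" for i
    proof (cases "i < card B")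
      case True
      have "diameter (ball (fst (h i)) (snd (h i))) \<le> \<delta>"
        using diameter_ball_le[OF B(2)[OF hB[OF True]], of "fst (h i)"] small[OF hB[OF True]] by linarith
      then show ?thesis using True by (simp add: U_def)
    qed (use \<open>\<delta> > 0\<close> in \<open>simp add: U_def\<close>)
    have "hausdorff_premeasure t \<delta> A \<le> (\<Sum>i. diam_power t (U i))"
      unfolding hausdorff_premeasure_def using cover diam by (intro INF_lower) auto
    also have "\<dots> = (\<Sum>i<card B. diam_power t (U i))"
      by (rule suminf_finite) (auto simp: U_def diam_power_def)
    also have "\<dots> \<le> (\<Sum>i<card B. ennreal (2 powr t * snd (h i) powr t))"
      using diam_power_ball_le[OF B(2)[OF hB] t] by (intro sum_mono) (auto simp: U_def)
    also have "\<dots> = (\<Sum>b\<in>B. ennreal (2 powr t * snd b powr t))"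
      by (rule sum.reindex_bij_betw[OF h])
    also have "\<dots> = ennreal (2 powr t * (\<Sum>b\<in>B. snd b powr t))"
      by (simp add: sum_distrib_left)
    also have "\<dots> \<le> ennreal e"
      using B(4) by (intro ennreal_leI) (auto simp: \<epsilon>_def field_simps)
    finally show ?thesis .
  qed
  then have "hausdorff_premeasure t \<delta> A = 0" if "\<delta> > 0" for \<delta>
    using that ennreal_le_epsilon[of "0" "hausdorff_premeasure t \<delta> A"]
    by (metis add.left_neutral ennreal_le_epsilon le_zero_eq)
  then show ?thesis
    unfolding hausdorff_measure_def by (auto simp: SUP_eq_const intro!: antisym SUP_least)
qed

text \<open>The sets of a Hausdorff cover need not be open and may be single points. Each is
  replaced by a ball whose radius is padded by an amount with summable \<open>t\<close>-th powers;
  compactness then leaves finitely many.\<close>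

lemma hausdorff_null_imp_ball_null:
  fixes A :: "'a::metric_space set"
  assumes A: "hausdorff_measure t A = 0" and t: "t > 0" and "compact A"
  shows "ball_null t A"
proof (rule ball_nullI)
  fix \<epsilon> :: real assume \<epsilon>: "\<epsilon> > 0"
  have pre: "hausdorff_premeasure t 1 A = 0"
    using A unfolding hausdorff_measure_def
    by (metis SUP_upper greaterThan_iff le_zero_eq zero_less_one)
  \<comment> \<open>One \<epsilon>' is spent on the diameters and one on the padding. The factor
    \<open>4 powr t\<close> pays for doubling the radius and for replacing a sum by twice a
    maximum.\<close>
  define \<epsilon>' where "\<epsilon>' = \<epsilon> / (2 * 4 powr t)"
  have \<epsilon>': "\<epsilon>' > 0" using \<epsilon> by (simp add: \<epsilon>'_def)
  obtain U where U: "A \<subseteq> (\<Union>i. U i)" "\<And>i. bounded (U i) \<and> diameter (U i) \<le> 1"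
      "(\<Sum>i. diam_power t (U i)) < ennreal \<epsilon>'"
  proof -
    have "hausdorff_premeasure t 1 A < ennreal \<epsilon>'" using pre \<epsilon>' by simp
    then show thesis
      unfolding hausdorff_premeasure_def INF_less_iff using that by auto
  qed
  define \<eta> where "\<eta> i = (\<epsilon>' * (1/2) ^ Suc i) powr (1/t)" for i
  have \<eta>: "\<eta> i > 0" for i using \<epsilon>' by (simp add: \<eta>_def)
  have \<eta>t: "\<eta> i powr t = \<epsilon>' * (1/2) ^ Suc i" for i
    using \<epsilon>' t by (simp add: \<eta>_def powr_powr)
  define x where "x i = (SOME x. x \<in> U i)" for i
  define r where "r i = 2 * (diameter (U i) + \<eta> i)" for i
  have d0: "diameter (U i) \<ge> 0" for i using U(2) by (simp add: diameter_ge_0)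
  have r: "r i > 0" for i using \<eta>[of i] d0[of i] by (simp add: r_def)
  have sub: "U i \<subseteq> ball (x i) (r i)" for i
  proof
    fix y assume y: "y \<in> U i"
    then have "x i \<in> U i" unfolding x_def by (rule someI)
    then have "dist (x i) y \<le> diameter (U i)"
      using y U(2) by (intro diameter_bounded_bound) auto
    then show "y \<in> ball (x i) (r i)"
      using \<eta>[of i] d0[of i] by (simp add: r_def)
  qed
  have "A \<subseteq> (\<Union>i. ball (x i) (r i))" using U(1) sub by blast
  then obtain J where J: "finite J" "A \<subseteq> (\<Union>i\<in>J. ball (x i) (r i))"
    using compactE_image[OF \<open>compact A\<close>, of UNIV "\<lambda>i. ball (x i) (r i)"] by auto
  define J' where "J' = {i\<in>J. U i \<noteq> {}}"
  have rt: "r i powr t \<le> 4 powr t * (diameter (U i) powr t + \<eta> i powr t)" for i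
  proof -
    have "r i powr t \<le> (4 * max (diameter (U i)) (\<eta> i)) powr t"
      using t r[of i] by (intro powr_mono2) (auto simp: r_def)
    also have "\<dots> = 4 powr t * max (diameter (U i)) (\<eta> i) powr t"
      by (simp add: powr_mult)
    also have "max (diameter (U i)) (\<eta> i) powr t \<le> diameter (U i) powr t + \<eta> i powr t"
      by (simp add: max_def)
    finally show ?thesis by simp
  qed
  have sumU: "(\<Sum>i\<in>J. diameter (U i) powr t) < \<epsilon>'"
  proof -
    have "ennreal (\<Sum>i\<in>J. diameter (U i) powr t) = (\<Sum>i\<in>J. ennreal (diameter (U i) powr t))"
      by simp
    also have "\<dots> = (\<Sum>i\<in>J. diam_power t (U i))"
      using t by (intro sum.cong) (auto simp: diam_power_def)
    also have "\<dots> \<le> (\<Sum>i. diam_power t (U i))"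
      by (rule sum_le_suminf) (auto simp: J)
    also have "\<dots> < ennreal \<epsilon>'" by (rule U)
    finally show ?thesis using \<epsilon>' by (simp add: ennreal_less_iff sum_nonneg)
  qed
  have sum\<eta>: "(\<Sum>i\<in>J. \<eta> i powr t) \<le> \<epsilon>'"
  proof -
    have "(\<lambda>i. \<epsilon>' * (1/2) ^ Suc i) sums (\<epsilon>' * 1)"
      by (rule sums_mult[OF power_half_series])
    then have sm: "summable (\<lambda>i. \<epsilon>' * (1/2) ^ Suc i)" "(\<Sum>i. \<epsilon>' * (1/2) ^ Suc i) = \<epsilon>' * 1"
      unfolding sums_iff by auto
    have "(\<Sum>i\<in>J. \<epsilon>' * (1/2) ^ Suc i) \<le> (\<Sum>i. \<epsilon>' * (1/2) ^ Suc i)"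
      using \<epsilon>' J(1) sm(1) by (intro sum_le_suminf) auto
    then have "(\<Sum>i\<in>J. \<epsilon>' * (1/2) ^ Suc i) \<le> \<epsilon>' * 1" using sm(2) by simp
    then show ?thesis by (simp only: \<eta>t mult_1_right)
  qed
  have "(\<Sum>i\<in>J. r i powr t) \<le> (\<Sum>i\<in>J. 4 powr t * (diameter (U i) powr t + \<eta> i powr t))"
    by (intro sum_mono rt)
  also have "\<dots> = 4 powr t * ((\<Sum>i\<in>J. diameter (U i) powr t) + (\<Sum>i\<in>J. \<eta> i powr t))"
    by (simp add: sum_distrib_left[symmetric] sum.distrib)
  also have "\<dots> < 4 powr t * (\<epsilon>' + \<epsilon>')"
    using sumU sum\<eta> by (intro mult_strict_left_mono) auto
  also have "\<dots> = \<epsilon>" by (simp add: \<epsilon>'_def)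
  finally show "ball_covered t \<epsilon> A"
    using J r by (intro ball_coveredI[of J r _ x]) auto
qed

lemma hausdorff_measure_0_pos:
  assumes "A \<noteq> {}"
  shows "hausdorff_measure 0 A > 0"
proof -
  have "1 \<le> hausdorff_premeasure 0 1 A"
    unfolding hausdorff_premeasure_def
  proof (rule INF_greatest)
    fix U :: "nat \<Rightarrow> 'a set"
    assume "U \<in> {U. A \<subseteq> \<Union> (range U) \<and> (\<forall>i. bounded (U i) \<and> diameter (U i) \<le> 1)}"
    then obtain i where "U i \<noteq> {}" using assms by blast
    then have "1 = (\<Sum>j\<in>{i}. diam_power 0 (U j))" by (simp add: diam_power_def)
    also have "\<dots> \<le> (\<Sum>j. diam_power 0 (U j))"
      by (rule sum_le_suminf) auto
    finally show "1 \<le> (\<Sum>j. diam_power 0 (U j))" .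
  qed
  also have "\<dots> \<le> hausdorff_measure 0 A"
    unfolding hausdorff_measure_def by (rule SUP_upper) simp
  finally show ?thesis using less_le_trans zero_less_one by blast
qed

lemma hausdorff_null_iff:
  assumes "compact A" "A \<noteq> {}" "s \<ge> 0"
  shows "hausdorff_measure s A = 0 \<longleftrightarrow> s > 0 \<and> ball_null s A"
proof (cases "s = 0")
  case True
  then show ?thesis using hausdorff_measure_0_pos[OF assms(2)] by auto
next
  case False
  then show ?thesis
    using assms ball_null_imp_hausdorff_null hausdorff_null_imp_ball_null by fastforce
qed

section \<open>Separated sets and the Assouad dimension\<close>

definition separated :: "real \<Rightarrow> 'a::metric_space set \<Rightarrow> bool" where
  "separated r X \<longleftrightarrow> (\<forall>x\<in>X. \<forall>y\<in>X. x \<noteq> y \<longrightarrow> r \<le> dist x y)"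

lemma separated_isometric_image:
  assumes "\<And>x y. x \<in> X \<Longrightarrow> y \<in> X \<Longrightarrow> dist (f x) (f y) = dist x y" "separated r X"
  shows "separated r (f ` X)"
  using assms unfolding separated_def by (metis (no_types, lifting) imageE)

lemma separated_card_le_cover:
  assumes "finite K" "X \<subseteq> (\<Union>k\<in>K. U k)" "separated r X"
    and "\<And>k x y. k \<in> K \<Longrightarrow> x \<in> U k \<Longrightarrow> y \<in> U k \<Longrightarrow> dist x y < r"
  shows "finite X \<and> card X \<le> card K"
proof -
  have "\<forall>x\<in>X. \<exists>k\<in>K. x \<in> U k" using assms(2) by blast
  then obtain g where g: "\<And>x. x \<in> X \<Longrightarrow> g x \<in> K \<and> x \<in> U (g x)" by metis
  have "inj_on g X"
  proof (rule inj_onI, rule ccontr)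
    fix x y assume xy: "x \<in> X" "y \<in> X" "g x = g y" "x \<noteq> y"
    then have "dist x y < r" using g[of x] g[of y] assms(4)[of "g x" x y] by auto
    then show False using assms(3) xy unfolding separated_def by force
  qed
  moreover have "g ` X \<subseteq> K" using g by blast
  ultimately show ?thesis
    using assms(1) by (meson card_inj_on_le finite_imageD finite_subset)
qed

text \<open>A finite cover by balls of radius \<open>r/2\<close> bounds the cardinality of separated
  sets, so one of greatest cardinality exists; it cannot be enlarged and is therefore an
  \<open>r\<close>-net of \<open>E\<close>.\<close>

lemma maximal_separated_exists:
  fixes A :: "'a::metric_space set"
  assumes "compact A" "r > 0" "E \<subseteq> A"
  obtains X where "finite X" "X \<subseteq> E" "separated r X" "\<And>y. y \<in> E \<Longrightarrow> \<exists>x\<in>X. dist x y < r"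
proof -
  obtain K where K: "K \<subseteq> A" "finite K" "A \<subseteq> (\<Union>k\<in>K. ball k (r/2))"
    using compactE_image[OF \<open>compact A\<close>, of A "\<lambda>k. ball k (r/2)"] assms(2) by force
  have bd: "finite X \<and> card X \<le> card K" if "X \<subseteq> E" "separated r X" for X
  proof (rule separated_card_le_cover[OF K(2) _ that(2)])
    show "X \<subseteq> (\<Union>k\<in>K. ball k (r/2))" using that K assms by blast
    show "dist x y < r" if "x \<in> ball k (r/2)" "y \<in> ball k (r/2)" for k x y
      using that dist_triangle[of x y k] by (simp add: dist_commute)
  qed
  let ?P = "\<lambda>X. X \<subseteq> E \<and> separated r X"
  obtain X where X: "?P X" "\<And>Y. ?P Y \<Longrightarrow> card Y \<le> card X"
  proof -
    have "?P {}" by (simp add: separated_def)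
    moreover have "\<forall>Y. ?P Y \<longrightarrow> card Y < Suc (card K)" using bd by (simp add: less_Suc_eq_le)
    ultimately show thesis using ex_has_greatest_nat[of ?P "{}" card "Suc (card K)"] that by blast
  qed
  have "\<exists>x\<in>X. dist x y < r" if y: "y \<in> E" for y
  proof (rule ccontr)
    assume neg: "\<not> (\<exists>x\<in>X. dist x y < r)"
    then have "y \<notin> X" using assms(2) by auto
    moreover have "?P (insert y X)"
      using X(1) y neg unfolding separated_def by (auto simp: dist_commute not_less)
    ultimately show False using X(2)[of "insert y X"] bd[of X] X(1) by auto
  qed
  then show thesis using that X bd by blast
qed

lemma covering_number_le:
  assumes "compact E'" "E \<subseteq> E'" "r > 0"
    and "\<And>X. finite X \<Longrightarrow> X \<subseteq> E \<Longrightarrow> separated (r/2) X \<Longrightarrow> real (card X) \<le> C"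
  shows "ereal_of_enat (covering_number r E) \<le> ereal C"
proof -
  obtain X where X: "finite X" "X \<subseteq> E" "separated (r/2) X" "\<And>y. y \<in> E \<Longrightarrow> \<exists>x\<in>X. dist x y < r/2"
    using maximal_separated_exists[OF assms(1) _ assms(2), of "r/2"] assms(3) by auto
  let ?U = "(\<lambda>x. ball x (r/2)) ` X"
  have "covering_number r E \<le> enat (card ?U)"
    unfolding covering_number_def
  proof (rule INF_lower)
    have "diameter (ball x (r/2)) \<le> r" for x :: 'a
      using diameter_ball_le[of "r/2" x] assms(3) by simp
    then show "?U \<in> {\<U>. finite \<U> \<and> (\<forall>U\<in>\<U>. open U \<and> bounded U \<and> diameter U \<le> r) \<and> E \<subseteq> \<Union> \<U>}"
      using X by auto
  qed
  also have "\<dots> \<le> enat (card X)" using X(1) by (simp add: card_image_le)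
  finally have "ereal_of_enat (covering_number r E) \<le> ereal_of_enat (enat (card X))"
    by (simp only: ereal_of_enat_le_iff)
  also have "\<dots> \<le> ereal C" using assms(4)[OF X(1-3)] by simp
  finally show ?thesis .
qed

text \<open>A set of diameter at most \<open>r\<close> may contain two points at distance exactly
  \<open>r\<close>. The strict inequality between \<open>r\<close> and \<open>r'\<close> excludes
  this, so each covering set holds at most one point of \<open>X\<close>.\<close>

lemma separated_card_le_covering_number:
  assumes C: "ereal_of_enat (covering_number r E) \<le> ereal C"
    and X: "X \<subseteq> E" "separated r' X" "r < r'"
  shows "real (card X) \<le> C"
proof -
  have "enat (card X) \<le> covering_number r E"
    unfolding covering_number_def
  proof (rule INF_greatest)
    fix \<U> assume \<U>: "\<U> \<in> {\<U>. finite \<U> \<and> (\<forall>U\<in>\<U>. open U \<and> bounded U \<and> diameter U \<le> r) \<and> E \<subseteq> \<Union> \<U>}"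
    have "finite X \<and> card X \<le> card \<U>"
    proof (rule separated_card_le_cover[OF _ _ X(2)])
      show "X \<subseteq> (\<Union>k\<in>\<U>. k)" using \<U> X by auto
      show "dist x y < r'" if "U \<in> \<U>" "x \<in> U" "y \<in> U" for U x y
        using diameter_bounded_bound[of U x y] that \<U> X(3) by force
    qed (use \<U> in auto)
    then show "enat (card X) \<le> enat (card \<U>)" by simp
  qed
  then have "ereal_of_enat (enat (card X)) \<le> ereal_of_enat (covering_number r E)"
    by (simp only: ereal_of_enat_le_iff)
  with C have "ereal (real (card X)) \<le> ereal C" using order_trans by fastforce
  then show ?thesis by simp
qed

lemma covering_bound_if_separated_bound:
  fixes E :: "'a::metric_space set"
  assumes E: "compact E" and C: "C > 0"
    and X: "\<And>R r x X. \<lbrakk>0 < r; r < R; x \<in> E; finite X; X \<subseteq> ball x R \<inter> E; separated r X\<rbrakk>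
        \<Longrightarrow> real (card X) \<le> C * (R / r) powr \<sigma>"
  shows "\<exists>C>0. \<forall>R>0. \<forall>r\<in>{0<..<R}. \<forall>x\<in>E.
      ereal_of_enat (covering_number r (ball x R \<inter> E)) \<le> ereal (C * (R / r) powr \<sigma>)"
proof -
  have "ereal_of_enat (covering_number r (ball x R \<inter> E)) \<le> ereal (C * 2 powr \<sigma> * (R / r) powr \<sigma>)"
    if "R > 0" "r \<in> {0<..<R}" "x \<in> E" for R r x
  proof (rule covering_number_le[OF E])
    fix X assume X': "finite X" "X \<subseteq> ball x R \<inter> E" "separated (r/2) X"
    then have "real (card X) \<le> C * (R / (r/2)) powr \<sigma>"
      using that by (intro X) auto
    also have "(R / (r/2)) powr \<sigma> = 2 powr \<sigma> * (R / r) powr \<sigma>"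
      using that powr_mult[of 2 "R/r" \<sigma>] by (simp add: mult.commute)
    finally show "real (card X) \<le> C * 2 powr \<sigma> * (R / r) powr \<sigma>" by simp
  qed (use that in auto)
  moreover have "C * 2 powr \<sigma> > 0" using C by simp
  ultimately show ?thesis by blast
qed

lemma assouad_dim_le:
  fixes E :: "'a::euclidean_space set"
  assumes E: "compact E" and \<sigma>: "\<sigma> \<ge> 0" "C > 0"
    and X: "\<And>R r x X. \<lbrakk>0 < r; r < R; x \<in> E; finite X; X \<subseteq> ball x R \<inter> E; separated r X\<rbrakk>
        \<Longrightarrow> real (card X) \<le> C * (R / r) powr \<sigma>"
  shows "assouad_dim E \<le> \<sigma>"
  unfolding assouad_dim_def
  using covering_bound_if_separated_bound[OF E \<sigma>(2) X] \<sigma>(1)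
  by (intro cInf_lower) (auto intro!: bdd_belowI[of _ 0])

text \<open>The first premise keeps the set of admissible exponents non-empty; the real infimum of
  an empty set would say nothing.\<close>

lemma assouad_dim_ge:
  fixes E :: "'a::euclidean_space set"
  assumes ne: "\<exists>\<sigma>\<ge>0. \<exists>C>0. \<forall>R>0. \<forall>r\<in>{0<..<R}. \<forall>x\<in>E.
               ereal_of_enat (covering_number r (ball x R \<inter> E)) \<le> ereal (C * (R / r) powr \<sigma>)"
    and X: "\<And>\<sigma> C. \<lbrakk>\<sigma> \<ge> 0; C > 0;
        \<And>R r x X. \<lbrakk>0 < r; r < R; x \<in> E; X \<subseteq> ball x R \<inter> E; separated r X\<rbrakk>
        \<Longrightarrow> real (card X) \<le> C * (R / r) powr \<sigma>\<rbrakk> \<Longrightarrow> d \<le> \<sigma>"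
  shows "d \<le> assouad_dim E"
  unfolding assouad_dim_def
proof (rule cInf_greatest)
  fix \<sigma> assume "\<sigma> \<in> {s. 0 \<le> s \<and> (\<exists>C>0. \<forall>R>0. \<forall>r\<in>{0<..<R}. \<forall>x\<in>E.
      ereal_of_enat (covering_number r (ball x R \<inter> E)) \<le> ereal (C * (R / r) powr s))}"
  then obtain C where C: "\<sigma> \<ge> 0" "C > 0" "\<And>R r x. R > 0 \<Longrightarrow> r \<in> {0<..<R} \<Longrightarrow> x \<in> E \<Longrightarrow>
      ereal_of_enat (covering_number r (ball x R \<inter> E)) \<le> ereal (C * (R / r) powr \<sigma>)"
    by auto
  show "d \<le> \<sigma>"
  proof (rule X[OF C(1), of "C * 2 powr \<sigma>"])
    fix R r :: real and x X
    assume *: "0 < r" "r < R" "x \<in> E" "X \<subseteq> ball x R \<inter> E" "separated r X"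
    have "real (card X) \<le> C * (R / (r/2)) powr \<sigma>"
      by (rule separated_card_le_covering_number[OF C(3)[of R "r/2" x] *(4,5)]) (use * in auto)
    also have "(R / (r/2)) powr \<sigma> = 2 powr \<sigma> * (R / r) powr \<sigma>"
      using * powr_mult[of 2 "R/r" \<sigma>] by (simp add: mult.commute)
    finally show "real (card X) \<le> C * 2 powr \<sigma> * (R / r) powr \<sigma>" by simp
  qed (use C in auto)
qed (use ne in auto)

lemma separated_card_le_real:
  fixes X :: "real set"
  assumes "separated r X" "X \<subseteq> ball x R" "0 < r" "r < R"
  shows "finite X" "real (card X) \<le> 4 * (R / r)"
proof -
  \<comment> \<open>Points in the same cell of length \<open>r\<close> are less than
    \<open>r\<close> apart, so the cell index is injective.\<close>
  let ?f = "\<lambda>y. \<lfloor>y / r\<rfloor>"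
  have inj: "inj_on ?f X"
  proof (rule inj_onI, rule ccontr)
    fix y z assume yz: "y \<in> X" "z \<in> X" "\<lfloor>y / r\<rfloor> = \<lfloor>z / r\<rfloor>" "y \<noteq> z"
    then have "\<bar>y / r - z / r\<bar> < 1" by linarith
    then have "\<bar>y - z\<bar> < r" using assms(3) by (simp add: divide_simps flip: diff_divide_distrib)
    then show False using yz assms(1) unfolding separated_def dist_real_def by force
  qed
  have sub: "?f ` X \<subseteq> {\<lfloor>(x - R) / r\<rfloor>..\<lfloor>(x + R) / r\<rfloor>}"
  proof (clarsimp, intro conjI)
    fix y assume "y \<in> X"
    then have "\<bar>x - y\<bar> < R" using assms(2) by (auto simp: dist_real_def)
    then show "\<lfloor>(x - R) / r\<rfloor> \<le> \<lfloor>y / r\<rfloor>" "\<lfloor>y / r\<rfloor> \<le> \<lfloor>(x + R) / r\<rfloor>"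
      using assms(3) by (auto intro!: floor_mono divide_right_mono)
  qed
  show "finite X" using finite_imageD[OF finite_subset[OF sub] inj] by simp
  have "card X \<le> card {\<lfloor>(x - R) / r\<rfloor>..\<lfloor>(x + R) / r\<rfloor>}"
    using card_inj_on_le[OF inj sub] by simp
  also have "real \<dots> \<le> (x + R) / r - (x - R) / r + 2"
  proof -
    have "(x - R) / r \<le> (x + R) / r" using assms by (intro divide_right_mono) auto
    then show ?thesis by (simp add: of_nat_nat) linarith
  qed
  also have "\<dots> = 2 * (R / r) + 2" by (simp add: diff_divide_distrib add_divide_distrib)
  \<comment> \<open>The additive 2 is absorbed because \<open>r < R\<close>.\<close>
  also have "\<dots> \<le> 4 * (R / r)" using assms by (simp add: field_simps)
  finally show "real (card X) \<le> 4 * (R / r)" by simp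
qed

text \<open>A maximal \<open>r\<close>-separated set gives a cover by balls of radius
  \<open>r\<close> at cost at most \<open>C * R powr \<sigma> * r powr (t - \<sigma>)\<close>, which
  tends to 0 with \<open>r\<close>. This is the source of the inequality between Hausdorff and
  Assouad dimension.\<close>

lemma assouad_covered_imp_ball_null:
  fixes A :: "'a::metric_space set"
  assumes A: "compact A" and t: "\<sigma> < t" and \<sigma>: "\<sigma> \<ge> 0" "C > 0"
    and X: "\<And>R r x X. \<lbrakk>0 < r; r < R; x \<in> A; X \<subseteq> ball x R \<inter> A; separated r X\<rbrakk>
        \<Longrightarrow> real (card X) \<le> C * (R / r) powr \<sigma>"
  shows "ball_null t A"
proof (rule ball_nullI)
  fix \<epsilon> :: real assume \<epsilon>: "\<epsilon> > 0"
  show "ball_covered t \<epsilon> A"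
  proof (cases "A = {}")
    case True
    then show ?thesis using \<epsilon> by (intro ball_coveredI[of "{}"]) auto
  next
    case False
    then obtain a where a: "a \<in> A" by blast
    obtain R0 where R0: "\<And>y. y \<in> A \<Longrightarrow> dist a y \<le> R0"
      using compact_imp_bounded[OF A] bounded_any_center[of A a] by auto
    define R where "R = \<bar>R0\<bar> + 1"
    have sub: "A \<subseteq> ball a R" using R0 by (force simp: R_def)
    have R: "R > 0" by (simp add: R_def)
    \<comment> \<open>Solves \<open>C * R powr \<sigma> * q = \<epsilon> / 2\<close>; the radius is
      then chosen so that \<open>r powr (t - \<sigma>) \<le> q\<close>.\<close>
    define q where "q = \<epsilon> / (2 * (C * R powr \<sigma>))"
    have q: "q > 0" using \<epsilon> \<sigma> R by (simp add: q_def)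
    define r where "r = min (R/2) (q powr (1 / (t - \<sigma>)))"
    have r: "r > 0" "r < R" using R q by (auto simp: r_def)
    obtain X where X': "finite X" "X \<subseteq> A" "separated r X" "\<And>y. y \<in> A \<Longrightarrow> \<exists>x\<in>X. dist x y < r"
      using maximal_separated_exists[OF A r(1), of A] by auto
    have "(\<Sum>x\<in>X. r powr t) = real (card X) * r powr t" by simp
    also have "\<dots> \<le> C * (R / r) powr \<sigma> * r powr t"
      using X[OF r a _ X'(3)] X' sub by (intro mult_right_mono) auto
    also have "\<dots> = C * R powr \<sigma> * r powr (t - \<sigma>)"
      using r R by (simp add: powr_divide powr_diff)
    also have "r powr (t - \<sigma>) \<le> (q powr (1 / (t - \<sigma>))) powr (t - \<sigma>)"
      using t r by (intro powr_mono2) (auto simp: r_def)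
    also have "\<dots> = q" using t q by (simp add: powr_powr)
    also have "C * R powr \<sigma> * q < \<epsilon>" using \<epsilon> \<sigma> R by (simp add: q_def)
    finally have "(\<Sum>x\<in>X. r powr t) < \<epsilon>" using \<sigma> by (simp add: mult_left_mono)
    then show ?thesis
      using X' r by (intro ball_coveredI[of X "\<lambda>_. r" _ "\<lambda>x. x"]) auto
  qed
qed

section \<open>Homothetic copies of a set of reals\<close>

text \<open>Maps are stored as pairs (ratio, translation), so that equality and closeness of maps
  are statements about two numbers.\<close>

definition homothety :: "real \<times> real \<Rightarrow> real \<Rightarrow> real" where
  "homothety \<phi> x = fst \<phi> * x + snd \<phi>"

definition hcomp :: "real \<times> real \<Rightarrow> real \<times> real \<Rightarrow> real \<times> real" where
  "hcomp \<phi> \<psi> = (fst \<phi> * fst \<psi>, fst \<phi> * snd \<psi> + snd \<phi>)"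

text \<open>Nothing ties these maps to words of a system. Mapping \<open>A\<close> into itself makes
  them closed under composition, and positive ratios preserve the order of points, which the chains
  need.\<close>

definition embeddings :: "real set \<Rightarrow> (real \<times> real) set" where
  "embeddings A = {\<phi>. 0 < fst \<phi> \<and> fst \<phi> \<le> 1 \<and> homothety \<phi> ` A \<subseteq> A}"

lemma homothety_hcomp: "homothety (hcomp \<phi> \<psi>) x = homothety \<phi> (homothety \<psi> x)"
  by (simp add: homothety_def hcomp_def algebra_simps)

lemma dist_homothety: "0 < fst \<phi> \<Longrightarrow> dist (homothety \<phi> x) (homothety \<phi> y) = fst \<phi> * dist x y"
  by (simp add: homothety_def dist_real_def abs_mult flip: right_diff_distrib)

lemma embeddingsD:
  assumes "\<phi> \<in> embeddings A"
  shows "0 < fst \<phi>" "fst \<phi> \<le> 1" "x \<in> A \<Longrightarrow> homothety \<phi> x \<in> A"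
  using assms by (auto simp: embeddings_def)

lemma hcomp_embeddings:
  assumes "\<phi> \<in> embeddings A" "\<psi> \<in> embeddings A"
  shows "hcomp \<phi> \<psi> \<in> embeddings A"
  using assms unfolding embeddings_def
  by (auto simp: homothety_hcomp) (auto simp: hcomp_def mult_le_one)

text \<open>Induction on the number of balls. A ball of radius at least \<delta>/2 pays for
  everything. Otherwise no ball meets two copies, so the balls split into disjoint subfamilies; each
  one, rescaled, covers \<open>A\<close> with fewer balls, and weights adding up to at least 1
  reassemble the bound.\<close>

lemma cover_sum_lower_bound:
  fixes \<phi> :: "'j \<Rightarrow> real \<times> real" and x :: "'b \<Rightarrow> real"
  assumes J: "finite J" "\<exists>i\<in>J. \<exists>j\<in>J. i \<noteq> j" "\<And>j. j \<in> J \<Longrightarrow> \<phi> j \<in> embeddings A"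
    and A: "A \<noteq> {}" and \<delta>: "\<delta> > 0"
    and gap: "\<And>i j y z. \<lbrakk>i \<in> J; j \<in> J; i \<noteq> j; y \<in> A; z \<in> A\<rbrakk> \<Longrightarrow>
        \<delta> \<le> dist (homothety (\<phi> i) y) (homothety (\<phi> j) z)"
    and t: "t > 0" "1 \<le> (\<Sum>j\<in>J. fst (\<phi> j) powr t)"
    and B: "finite B" "\<And>b. b \<in> B \<Longrightarrow> r b > 0" "A \<subseteq> (\<Union>b\<in>B. ball (x b) (r b))"
  shows "(\<delta>/2) powr t \<le> (\<Sum>b\<in>B. r b powr t)"
  using B
proof (induction "card B" arbitrary: B x r rule: less_induct)
  case less
  show ?case
  proof (cases "\<exists>b\<in>B. \<delta>/2 \<le> r b")
    case True
    then obtain b where b: "b \<in> B" "\<delta>/2 \<le> r b" by blast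
    have "(\<delta>/2) powr t \<le> r b powr t" using b \<delta> t by (intro powr_mono2) auto
    also have "\<dots> \<le> (\<Sum>b\<in>B. r b powr t)"
      using b less.prems(1) by (intro member_le_sum) auto
    finally show ?thesis .
  next
    case False
    define N where "N j = {b\<in>B. ball (x b) (r b) \<inter> homothety (\<phi> j) ` A \<noteq> {}}" for j
    have finN: "finite (N j)" for j using less.prems(1) by (simp add: N_def)
    have disj: "N i \<inter> N j = {}" if ij: "i \<in> J" "j \<in> J" "i \<noteq> j" for i j
    proof (rule ccontr)
      assume "N i \<inter> N j \<noteq> {}"
      then obtain b y z where b: "b \<in> B" "y \<in> A" "z \<in> A"
          "homothety (\<phi> i) y \<in> ball (x b) (r b)" "homothety (\<phi> j) z \<in> ball (x b) (r b)"
        unfolding N_def by blast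
      have "dist (homothety (\<phi> i) y) (homothety (\<phi> j) z) < 2 * r b"
        using b(4,5) by (simp add: dist_real_def)
      moreover have "r b < \<delta>/2" using False b(1) by force
      ultimately show False using gap[OF ij b(2,3)] by simp
    qed
    have ne: "N j \<noteq> {}" if "j \<in> J" for j
    proof -
      obtain y where y: "y \<in> A" using A by blast
      then have "homothety (\<phi> j) y \<in> A" using J(3)[OF that] by (simp add: embeddingsD)
      then obtain b where "b \<in> B" "homothety (\<phi> j) y \<in> ball (x b) (r b)"
        using less.prems(3) by blast
      then have "b \<in> N j" using y unfolding N_def by blast
      then show ?thesis by blast
    qed
    have piece: "fst (\<phi> j) powr t * (\<delta>/2) powr t \<le> (\<Sum>b\<in>N j. r b powr t)" if j: "j \<in> J" for j
    proof -
      \<comment> \<open>Some ball meets another copy and hence not this one, so the induction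
        hypothesis is applied to strictly fewer balls.\<close>
      obtain i where i: "i \<in> J" "i \<noteq> j" using J(2) by metis
      obtain b where "b \<in> N i" using ne[OF i(1)] by blast
      then have "b \<in> B" "b \<notin> N j" using disj[OF i(1) j i(2)] by (auto simp: N_def)
      then have "N j \<subset> B" by (auto simp: N_def)
      then have less_card: "card (N j) < card B" using less.prems(1) by (rule psubset_card_mono[rotated])
      have k: "fst (\<phi> j) > 0" using J(3)[OF j] by (rule embeddingsD)
      let ?k = "fst (\<phi> j)"
      \<comment> \<open>Pulled back along \<open>homothety (\<phi> j)\<close>, the balls in
        \<open>N j\<close> cover all of \<open>A\<close>, at a cost divided by
        \<open>?k powr t\<close>.\<close>
      have "(\<delta>/2) powr t \<le> (\<Sum>b\<in>N j. (r b / ?k) powr t)"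
      proof (rule less.hyps[OF less_card, where x = "\<lambda>b. (x b - snd (\<phi> j)) / ?k"])
        show "A \<subseteq> (\<Union>b\<in>N j. ball ((x b - snd (\<phi> j)) / ?k) (r b / ?k))"
        proof
          fix y assume y: "y \<in> A"
          then have "homothety (\<phi> j) y \<in> A" using J(3)[OF j] by (simp add: embeddingsD)
          then obtain b where b: "b \<in> B" "homothety (\<phi> j) y \<in> ball (x b) (r b)"
            using less.prems(3) by blast
          then have bN: "b \<in> N j" using y unfolding N_def by blast
          have "\<bar>(x b - snd (\<phi> j)) / ?k - y\<bar> = \<bar>(x b - homothety (\<phi> j) y) / ?k\<bar>"
            using k by (simp add: homothety_def field_simps)
          also have "\<dots> < r b / ?k"
            using b(2) k by (simp add: dist_real_def divide_strict_right_mono)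
          finally show "y \<in> (\<Union>b\<in>N j. ball ((x b - snd (\<phi> j)) / ?k) (r b / ?k))"
            using bN by (auto simp: dist_real_def)
        qed
      qed (use finN k less.prems(2) in \<open>auto simp: N_def\<close>)
      also have "\<dots> = (\<Sum>b\<in>N j. r b powr t) / ?k powr t"
        using less.prems(2) k by (simp add: powr_divide sum_divide_distrib)
      finally show ?thesis using k by (simp add: field_simps)
    qed
    have "(\<delta>/2) powr t \<le> (\<Sum>j\<in>J. fst (\<phi> j) powr t) * (\<delta>/2) powr t"
      using t(2) \<delta> by simp
    also have "\<dots> \<le> (\<Sum>j\<in>J. \<Sum>b\<in>N j. r b powr t)"
      unfolding sum_distrib_right by (intro sum_mono piece)
    also have "\<dots> = (\<Sum>b\<in>(\<Union>j\<in>J. N j). r b powr t)"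
      using J(1) finN disj by (intro sum.UNION_disjoint[symmetric]) auto
    also have "\<dots> \<le> (\<Sum>b\<in>B. r b powr t)"
      using less.prems(1) by (intro sum_mono2) (auto simp: N_def)
    finally show ?thesis .
  qed
qed

lemma disjoint_embeddings_gap:
  fixes \<phi> :: "'j \<Rightarrow> real \<times> real"
  assumes A: "compact A" and J: "finite J"
    and disj: "\<And>i j. \<lbrakk>i \<in> J; j \<in> J; i \<noteq> j\<rbrakk> \<Longrightarrow> homothety (\<phi> i) ` A \<inter> homothety (\<phi> j) ` A = {}"
  obtains \<delta> where "\<delta> > 0" "\<And>i j y z. \<lbrakk>i \<in> J; j \<in> J; i \<noteq> j; y \<in> A; z \<in> A\<rbrakk> \<Longrightarrow>
        \<delta> \<le> dist (homothety (\<phi> i) y) (homothety (\<phi> j) z)"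
proof -
  have comp: "compact (homothety (\<phi> i) ` A)" for i
    unfolding homothety_def by (intro compact_continuous_image A continuous_intros)
  let ?P = "\<lambda>p d. (0::real) < d \<and> (\<forall>y\<in>A. \<forall>z\<in>A. d \<le> dist (homothety (\<phi> (fst p)) y) (homothety (\<phi> (snd p)) z))"
  define T where "T = {p \<in> J \<times> J. fst p \<noteq> snd p}"
  have T: "finite T" using J by (simp add: T_def)
  have "\<exists>d. ?P p d" if "p \<in> T" for p
    using separate_compact_closed[OF comp compact_imp_closed[OF comp], of "fst p" "snd p"]
      disj[of "fst p" "snd p"] that by (auto simp: T_def)
  then obtain d where d: "\<And>p. p \<in> T \<Longrightarrow> ?P p (d p)" by metis
  define \<delta> where "\<delta> = Min (insert 1 (d ` T))"
  show thesis
  proof (rule that[of \<delta>])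
    show "\<delta> > 0" using T d by (auto simp: \<delta>_def)
    fix i j y z assume *: "i \<in> J" "j \<in> J" "i \<noteq> j" "y \<in> A" "z \<in> A"
    then have p: "(i, j) \<in> T" by (simp add: T_def)
    then have "\<delta> \<le> d (i, j)" using T by (auto simp: \<delta>_def)
    also have "\<dots> \<le> dist (homothety (\<phi> i) y) (homothety (\<phi> j) z)"
      using d[OF p] * by auto
    finally show "\<delta> \<le> dist (homothety (\<phi> i) y) (homothety (\<phi> j) z)" .
  qed
qed

text \<open>If the weight at \<open>s\<close> exceeded 1, continuity in the exponent would keep it
  above 1 at some \<open>t > s\<close>. Compactness provides a positive gap between the copies, and
  the resulting lower bound for costs contradicts nullity at \<open>t\<close>.\<close>

lemma disjoint_embeddings_sum_le_1:
  fixes \<phi> :: "'j \<Rightarrow> real \<times> real"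
  assumes A: "compact A" "A \<noteq> {}" and s: "s \<ge> 0" "\<And>t. t > s \<Longrightarrow> ball_null t A"
    and J: "finite J" "\<And>j. j \<in> J \<Longrightarrow> \<phi> j \<in> embeddings A"
    and disj: "\<And>i j. \<lbrakk>i \<in> J; j \<in> J; i \<noteq> j\<rbrakk> \<Longrightarrow> homothety (\<phi> i) ` A \<inter> homothety (\<phi> j) ` A = {}"
  shows "(\<Sum>j\<in>J. fst (\<phi> j) powr s) \<le> 1"
proof (rule ccontr)
  assume gt: "\<not> ?thesis"
  \<comment> \<open>A single copy has ratio at most 1 and cannot have weight above 1.\<close>
  have two: "\<exists>i\<in>J. \<exists>j\<in>J. i \<noteq> j"
  proof (rule ccontr)
    assume "\<not> ?thesis"
    then consider "J = {}" | j where "J = {j}" by blast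
    then show False
    proof cases
      case (2 j)
      then have "\<phi> j \<in> embeddings A" using J(2) by simp
      then have "fst (\<phi> j) powr s \<le> 1" using s(1) by (intro powr_le1) (auto simp: embeddings_def)
      then show False using gt 2 by simp
    qed (use gt in simp)
  qed
  have "((\<lambda>t. \<Sum>j\<in>J. fst (\<phi> j) powr t) \<longlongrightarrow> (\<Sum>j\<in>J. fst (\<phi> j) powr s)) (at_right s)"
  proof (intro tendsto_sum tendsto_powr[OF tendsto_const tendsto_ident_at])
    show "fst (\<phi> j) \<noteq> 0" if "j \<in> J" for j using embeddingsD(1)[OF J(2)[OF that]] by simp
  qed
  then have "eventually (\<lambda>t. 1 < (\<Sum>j\<in>J. fst (\<phi> j) powr t)) (at_right s)"
    using gt by (intro order_tendstoD(1)) auto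
  then obtain t where t: "t > s" "1 < (\<Sum>j\<in>J. fst (\<phi> j) powr t)"
    unfolding eventually_at_right_field by (metis dense)
  obtain \<delta> where \<delta>: "\<delta> > 0" "\<And>i j y z. \<lbrakk>i \<in> J; j \<in> J; i \<noteq> j; y \<in> A; z \<in> A\<rbrakk> \<Longrightarrow>
        \<delta> \<le> dist (homothety (\<phi> i) y) (homothety (\<phi> j) z)"
    using disjoint_embeddings_gap[of A J \<phi>] A(1) J(1) disj by metis
  have "(\<delta>/2) powr t > 0" using \<delta>(1) by simp
  from ball_nullD[OF s(2)[OF t(1)] this] obtain B where B: "finite B" "\<And>b. b \<in> B \<Longrightarrow> snd b > 0"
      "A \<subseteq> (\<Union>b\<in>B. ball (fst b) (snd b))" "(\<Sum>b\<in>B. snd b powr t) < (\<delta>/2) powr t"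
    by blast
  have "(\<delta>/2) powr t \<le> (\<Sum>b\<in>B. snd b powr t)"
    using t s(1) by (intro cover_sum_lower_bound[OF J(1) two J(2) A(2) \<delta>(1) \<delta>(2) _ _ B(1-3)]) auto
  then show False using B(4) by simp
qed

section \<open>Local packing bounds from positive measure\<close>

definition self_embeddable :: "real \<Rightarrow> real set \<Rightarrow> bool" where
  "self_embeddable a A \<longleftrightarrow> a > 0 \<and> (\<forall>x\<in>A. \<forall>\<rho>. 0 < \<rho> \<longrightarrow> \<rho> \<le> 1 \<longrightarrow>
     (\<exists>\<phi>\<in>embeddings A. a * \<rho> \<le> fst \<phi> \<and> fst \<phi> \<le> \<rho> \<and> homothety \<phi> ` A \<subseteq> ball x \<rho>))"

lemma self_embeddableE:
  assumes "self_embeddable a A" "x \<in> A" "0 < \<rho>" "\<rho> \<le> 1"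
  obtains \<phi> where "\<phi> \<in> embeddings A" "a * \<rho> \<le> fst \<phi>" "fst \<phi> \<le> \<rho>" "homothety \<phi> ` A \<subseteq> ball x \<rho>"
  using assms unfolding self_embeddable_def by blast

text \<open>
  The families \<open>\<Phi>\<close> below consist of embeddings whose images of the ball \<open>ball x0 R\<close> are disjoint.
  The total weight of such a family is at most \<open>1 / W\<close>; a family of almost maximal weight leaves,
  after doubling its balls, only a part of \<open>A\<close> that has a cheap cover by balls of equal size.
\<close>

lemma cluster_ball_covered:
  fixes q :: "'q \<Rightarrow> real \<times> real"
  assumes A: "compact A" "A \<noteq> {}" and s: "s \<ge> 0" "\<And>t. t > s \<Longrightarrow> ball_null t A"
    and emb: "self_embeddable a A"
    and Q: "finite Q" "Q \<noteq> {}" "\<And>i. i \<in> Q \<Longrightarrow> q i \<in> embeddings A"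
    and disj: "\<And>i j. \<lbrakk>i \<in> Q; j \<in> Q; i \<noteq> j\<rbrakk> \<Longrightarrow> homothety (q i) ` A \<inter> homothety (q j) ` A = {}"
    and sub: "\<And>i. i \<in> Q \<Longrightarrow> homothety (q i) ` A \<subseteq> ball x0 R"
    and W: "W = (\<Sum>i\<in>Q. fst (q i) powr s)" and \<epsilon>: "\<epsilon> > 0"
  shows "ball_covered s ((2 * R) powr s / W + \<epsilon>) A"
proof -
  have W0: "W > 0"
    unfolding W
  proof (intro sum_pos)
    show "0 < fst (q i) powr s" if "i \<in> Q" for i
      using embeddingsD(1)[OF Q(3)[OF that]] by simp
  qed (use Q in auto)
  have R: "R > 0"
  proof -
    obtain i y where "i \<in> Q" "y \<in> A" using Q(2) A(2) by blast
    then have "homothety (q i) y \<in> ball x0 R" using sub by blast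
    then show ?thesis by (metis ball_eq_empty empty_iff not_le)
  qed
  have a: "a > 0" using emb by (simp add: self_embeddable_def)
  \<comment> \<open>The condition on the centres makes the images of \<open>ball x0 R\<close>
    disjoint. As a statement about distances it is easy to check for newly added members.\<close>
  define adm where "adm \<Phi> \<longleftrightarrow> finite \<Phi> \<and> \<Phi> \<subseteq> embeddings A \<and>
    (\<forall>\<phi>\<in>\<Phi>. \<forall>\<psi>\<in>\<Phi>. \<phi> \<noteq> \<psi> \<longrightarrow> (fst \<phi> + fst \<psi>) * R \<le> dist (homothety \<phi> x0) (homothety \<psi> x0))"
    for \<Phi> :: "(real \<times> real) set"
  define w where "w \<Phi> = (\<Sum>\<phi>\<in>\<Phi>. fst \<phi> powr s)" for \<Phi> :: "(real \<times> real) set"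
  \<comment> \<open>Composing members of \<Phi> with the maps \<open>q i\<close> yields disjoint
    copies of \<open>A\<close>: within one ball by \<open>disj\<close>, across balls because each
    copy stays in its ball. Their total weight is the product \<open>w \<Phi> * W\<close>.\<close>
  have bound: "w \<Phi> \<le> 1 / W" if "adm \<Phi>" for \<Phi>
  proof -
    have \<Phi>: "finite \<Phi>" "\<And>\<phi>. \<phi> \<in> \<Phi> \<Longrightarrow> \<phi> \<in> embeddings A" using that by (auto simp: adm_def)
    have "(\<Sum>p\<in>\<Phi> \<times> Q. fst (hcomp (fst p) (q (snd p))) powr s) \<le> 1"
    proof (rule disjoint_embeddings_sum_le_1[OF A s])
      show "hcomp (fst p) (q (snd p)) \<in> embeddings A" if "p \<in> \<Phi> \<times> Q" for p
        using that \<Phi>(2) Q(3) by (auto intro!: hcomp_embeddings)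
      fix p p' assume p: "p \<in> \<Phi> \<times> Q" "p' \<in> \<Phi> \<times> Q" "p \<noteq> p'"
      obtain \<phi> i where pe: "p = (\<phi>, i)" by (cases p)
      obtain \<psi> j where pe': "p' = (\<psi>, j)" by (cases p')
      have mem: "\<phi> \<in> \<Phi>" "\<psi> \<in> \<Phi>" "i \<in> Q" "j \<in> Q" using p pe pe' by auto
      have k: "fst \<phi> > 0" "fst \<psi> > 0" using embeddingsD(1)[OF \<Phi>(2)] mem by auto
      have "homothety \<phi> (homothety (q i) y) \<noteq> homothety \<psi> (homothety (q j) z)"
        if yz: "y \<in> A" "z \<in> A" for y z
      proof
        assume eq: "homothety \<phi> (homothety (q i) y) = homothety \<psi> (homothety (q j) z)"
        show False
        proof (cases "\<phi> = \<psi>")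
          case True
          then have "i \<noteq> j" using p pe pe' by auto
          moreover have "homothety (q i) y = homothety (q j) z"
            using eq True k by (simp add: homothety_def)
          ultimately show False using disj[OF mem(3,4)] yz by blast
        next
          case False
          have "dist x0 (homothety (q i) y) < R" "dist x0 (homothety (q j) z) < R"
            using sub[OF mem(3)] sub[OF mem(4)] yz by auto
          then have "dist (homothety \<phi> x0) (homothety \<phi> (homothety (q i) y)) < fst \<phi> * R"
            "dist (homothety \<psi> x0) (homothety \<psi> (homothety (q j) z)) < fst \<psi> * R"
            using k by (simp_all add: dist_homothety)
          then have "dist (homothety \<phi> x0) (homothety \<psi> x0) < fst \<phi> * R + fst \<psi> * R"
            using eq dist_triangle2[of "homothety \<phi> x0" "homothety \<psi> x0" "homothety \<phi> (homothety (q i) y)"]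
            by simp
          then show False
            using False mem \<open>adm \<Phi>\<close> unfolding adm_def by (fastforce simp: distrib_right)
        qed
      qed
      then show "homothety (hcomp (fst p) (q (snd p))) ` A \<inter> homothety (hcomp (fst p') (q (snd p'))) ` A = {}"
        by (auto simp: pe pe' homothety_hcomp)
    qed (use \<Phi> Q in auto)
    also have "(\<Sum>p\<in>\<Phi> \<times> Q. fst (hcomp (fst p) (q (snd p))) powr s)
        = (\<Sum>\<phi>\<in>\<Phi>. \<Sum>i\<in>Q. fst \<phi> powr s * fst (q i) powr s)"
      by (subst sum.cartesian_product[symmetric, of "\<lambda>\<phi> i. fst (hcomp \<phi> (q i)) powr s", unfolded case_prod_unfold])
        (simp add: hcomp_def powr_mult)
    also have "\<dots> = w \<Phi> * W"
      by (simp add: w_def W sum_product)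
    finally show ?thesis using W0 by (simp add: field_simps)
  qed
  define S where "S = Sup (w ` Collect adm)"
  have bdd: "bdd_above (w ` Collect adm)" using bound by (auto intro!: bdd_aboveI[of _ "1 / W"])
  have ne: "w ` Collect adm \<noteq> {}" by (auto simp: adm_def)
  \<comment> \<open>Covering the leftover part costs at most \<open>(4 * (1 + R) / a) powr s\<close>
    times the weight of the maps placed there; this choice makes it less than \<epsilon>/2.\<close>
  define \<epsilon>' where "\<epsilon>' = \<epsilon> / (2 * (4 * (1 + R) / a) powr s)"
  have \<epsilon>': "\<epsilon>' > 0" using \<epsilon> a R by (simp add: \<epsilon>'_def)
  obtain \<Phi> where \<Phi>: "adm \<Phi>" "S - \<epsilon>' < w \<Phi>"
    using less_cSupD[OF ne, of "S - \<epsilon>'"] \<epsilon>' unfolding S_def by auto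
  have \<Phi>': "finite \<Phi>" "\<And>\<phi>. \<phi> \<in> \<Phi> \<Longrightarrow> \<phi> \<in> embeddings A" using \<Phi> by (auto simp: adm_def)
  \<comment> \<open>Small enough that maps of ratio at most \<rho>, placed at points outside the
    doubled balls, keep the required distance from every old member.\<close>
  define \<rho> where "\<rho> = Min (insert 1 ((\<lambda>\<phi>. fst \<phi> * R / (2 * (1 + R))) ` \<Phi>))"
  have \<rho>: "\<rho> > 0" "\<rho> \<le> 1" using \<Phi>' embeddingsD(1)[OF \<Phi>'(2)] R by (auto simp: \<rho>_def)
  have \<rho>\<Phi>: "2 * \<rho> * (1 + R) \<le> fst \<phi> * R" if "\<phi> \<in> \<Phi>" for \<phi>
  proof -
    have "\<rho> \<le> fst \<phi> * R / (2 * (1 + R))" unfolding \<rho>_def using that \<Phi>'(1) by (intro Min_le) auto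
    then show ?thesis using R by (simp add: field_simps)
  qed
  define G where "G = (\<Union>\<phi>\<in>\<Phi>. ball (homothety \<phi> x0) (2 * (fst \<phi> * R)))"
  obtain X where X: "finite X" "X \<subseteq> A - G" "separated (4 * \<rho> * (1 + R)) X"
      "\<And>y. y \<in> A - G \<Longrightarrow> \<exists>x\<in>X. dist x y < 4 * \<rho> * (1 + R)"
    using maximal_separated_exists[OF A(1), of "4 * \<rho> * (1 + R)" "A - G"] \<rho> R by auto
  \<comment> \<open>The centre \<open>x0\<close> need not lie in \<open>A\<close>, so the position
    of its image is estimated through the point \<open>?z\<close> of \<open>A\<close>, which is
    within \<open>R\<close> of \<open>x0\<close>.\<close>
  have "\<exists>\<phi>. \<phi> \<in> embeddings A \<and> a * \<rho> \<le> fst \<phi> \<and> fst \<phi> \<le> \<rho> \<and> dist p (homothety \<phi> x0) < \<rho> * (1 + R)"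
    if p: "p \<in> X" for p
  proof -
    have "p \<in> A" using p X by blast
    then obtain \<phi> where \<phi>: "\<phi> \<in> embeddings A" "a * \<rho> \<le> fst \<phi>" "fst \<phi> \<le> \<rho>" "homothety \<phi> ` A \<subseteq> ball p \<rho>"
      using self_embeddableE[OF emb _ \<rho>] by metis
    obtain i y where iy: "i \<in> Q" "y \<in> A" using Q(2) A(2) by blast
    let ?z = "homothety (q i) y"
    have z: "?z \<in> A" "dist ?z x0 < R"
      using iy sub[OF iy(1)] embeddingsD(3)[OF Q(3)] by (auto simp: dist_commute)
    have "dist p (homothety \<phi> x0) \<le> dist p (homothety \<phi> ?z) + dist (homothety \<phi> ?z) (homothety \<phi> x0)"
      by (rule dist_triangle)
    also have "dist p (homothety \<phi> ?z) < \<rho>" using \<phi>(4) z by auto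
    also have "dist (homothety \<phi> ?z) (homothety \<phi> x0) \<le> \<rho> * R"
      using embeddingsD(1)[OF \<phi>(1)] \<phi>(3) z(2) \<rho> R by (simp add: dist_homothety mult_mono)
    finally show ?thesis using \<phi> by (intro exI[of _ \<phi>]) (simp add: distrib_left)
  qed
  then obtain f where f: "\<And>p. p \<in> X \<Longrightarrow> f p \<in> embeddings A \<and> a * \<rho> \<le> fst (f p) \<and> fst (f p) \<le> \<rho> \<and>
      dist p (homothety (f p) x0) < \<rho> * (1 + R)"
    by metis
  have f0: "fst (f p) > 0" if "p \<in> X" for p using f[OF that] embeddingsD(1) by blast
  have old: "(fst \<phi> + fst (f p)) * R \<le> dist (homothety \<phi> x0) (homothety (f p) x0)"
    if "\<phi> \<in> \<Phi>" "p \<in> X" for \<phi> p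
  proof -
    have "p \<notin> G" using X that by blast
    then have "2 * (fst \<phi> * R) \<le> dist (homothety \<phi> x0) p" using that by (auto simp: G_def not_less)
    also have "\<dots> \<le> dist (homothety \<phi> x0) (homothety (f p) x0) + dist p (homothety (f p) x0)"
      by (rule dist_triangle2)
    finally have "2 * (fst \<phi> * R) - \<rho> * (1 + R) \<le> dist (homothety \<phi> x0) (homothety (f p) x0)"
      using f[OF that(2)] by linarith
    moreover have "fst (f p) * R \<le> \<rho> * R" using f[OF that(2)] R by (intro mult_right_mono) auto
    moreover have "2 * (\<rho> * (1 + R)) \<le> fst \<phi> * R" using \<rho>\<Phi>[OF that(1)] by simp
    moreover have "\<rho> * R \<le> \<rho> * (1 + R)" using \<rho> by simp
    ultimately show ?thesis unfolding distrib_right by linarith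
  qed
  have new: "(fst (f p) + fst (f p')) * R \<le> dist (homothety (f p) x0) (homothety (f p') x0)"
    if "p \<in> X" "p' \<in> X" "p \<noteq> p'" for p p'
  proof -
    have "4 * (\<rho> * (1 + R)) \<le> dist p p'" using X(3) that unfolding separated_def by force
    also have "\<dots> \<le> dist p (homothety (f p) x0) + dist (homothety (f p) x0) (homothety (f p') x0)
        + dist p' (homothety (f p') x0)"
      using dist_triangle[of p p' "homothety (f p) x0"]
        dist_triangle[of "homothety (f p) x0" p' "homothety (f p') x0"] by (simp add: dist_commute)
    finally have "2 * (\<rho> * (1 + R)) \<le> dist (homothety (f p) x0) (homothety (f p') x0)"
      using f[OF that(1)] f[OF that(2)] by linarith
    moreover have "fst (f p) * R \<le> \<rho> * R" "fst (f p') * R \<le> \<rho> * R"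
      using f[OF that(1)] f[OF that(2)] R by (auto intro!: mult_right_mono)
    moreover have "\<rho> * R \<le> \<rho> * (1 + R)" using \<rho> by simp
    ultimately show ?thesis unfolding distrib_right by linarith
  qed
  have inj: "inj_on f X"
  proof (rule inj_onI, rule ccontr)
    fix p p' assume "p \<in> X" "p' \<in> X" "f p = f p'" "p \<noteq> p'"
    then have "(fst (f p) + fst (f p)) * R \<le> 0" using new[of p p'] by simp
    then show False using f0[OF \<open>p \<in> X\<close>] R by (simp add: mult_le_0_iff)
  qed
  have fresh: "\<Phi> \<inter> f ` X = {}"
  proof (rule ccontr)
    assume "\<Phi> \<inter> f ` X \<noteq> {}"
    then obtain p where p: "p \<in> X" "f p \<in> \<Phi>" by blast
    then have "(fst (f p) + fst (f p)) * R \<le> 0" using old[of "f p" p] by simp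
    then show False using f0[OF p(1)] R by (simp add: mult_le_0_iff)
  qed
  \<comment> \<open>The enlarged family is still admissible, so by near maximality of \<Phi> the new
    maps weigh less than \<epsilon>'.\<close>
  have "adm (\<Phi> \<union> f ` X)"
    unfolding adm_def
  proof (intro conjI ballI impI)
    fix \<phi> \<psi> assume *: "\<phi> \<in> \<Phi> \<union> f ` X" "\<psi> \<in> \<Phi> \<union> f ` X" "\<phi> \<noteq> \<psi>"
    then consider "\<phi> \<in> \<Phi>" "\<psi> \<in> \<Phi>" | p where "\<phi> \<in> \<Phi>" "\<psi> = f p" "p \<in> X"
      | p where "\<psi> \<in> \<Phi>" "\<phi> = f p" "p \<in> X"
      | p p' where "\<phi> = f p" "\<psi> = f p'" "p \<in> X" "p' \<in> X" "p \<noteq> p'" by auto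
    then show "(fst \<phi> + fst \<psi>) * R \<le> dist (homothety \<phi> x0) (homothety \<psi> x0)"
    proof cases
      case 1
      then show ?thesis using \<Phi>(1) * by (auto simp: adm_def)
    next
      case 3
      then show ?thesis using old by (metis add.commute dist_commute)
    qed (use old new in auto)
  qed (use \<Phi>' X f in auto)
  then have "w (\<Phi> \<union> f ` X) \<le> S"
    unfolding S_def using bdd by (intro cSup_upper) auto
  moreover have "w (\<Phi> \<union> f ` X) = w \<Phi> + (\<Sum>p\<in>X. fst (f p) powr s)"
    unfolding w_def using \<Phi>'(1) X(1) fresh inj
    by (subst sum.union_disjoint) (auto simp: sum.reindex)
  ultimately have small: "(\<Sum>p\<in>X. fst (f p) powr s) < \<epsilon>'" using \<Phi>(2) by linarith
  have "(\<Sum>\<phi>\<in>\<Phi>. (2 * (fst \<phi> * R)) powr s) = (2 * R) powr s * w \<Phi>"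
    using R by (simp add: w_def sum_distrib_left powr_mult mult_ac)
  also have "\<dots> \<le> (2 * R) powr s * (1 / W)"
    using bound[OF \<Phi>(1)] by (intro mult_left_mono) auto
  also have "\<dots> < (2 * R) powr s / W + \<epsilon> / 2" using \<epsilon> by simp
  finally have "ball_covered s ((2 * R) powr s / W + \<epsilon> / 2) G"
    using \<Phi>' embeddingsD(1)[OF \<Phi>'(2)] R
    by (intro ball_coveredI[of \<Phi> "\<lambda>\<phi>. 2 * (fst \<phi> * R)" _ "\<lambda>\<phi>. homothety \<phi> x0"]) (auto simp: G_def)
  moreover have "ball_covered s (\<epsilon> / 2) (A - G)"
  proof (rule ball_coveredI[of X "\<lambda>_. 4 * \<rho> * (1 + R)" _ "\<lambda>x. x"])
    have "(4 * \<rho> * (1 + R)) powr s \<le> (4 * (1 + R) / a) powr s * fst (f p) powr s" if "p \<in> X" for p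
    proof -
      have "\<rho> \<le> fst (f p) / a" using f[OF that] a by (simp add: field_simps)
      then have le: "4 * (1 + R) * \<rho> \<le> 4 * (1 + R) * (fst (f p) / a)"
        using R by (intro mult_left_mono) auto
      have "(4 * \<rho> * (1 + R)) powr s \<le> ((4 * (1 + R) / a) * fst (f p)) powr s"
        using le \<rho> R s by (intro powr_mono2) (simp_all add: mult_ac)
      also have "\<dots> = (4 * (1 + R) / a) powr s * fst (f p) powr s" by (rule powr_mult)
      finally show ?thesis .
    qed
    then have "(\<Sum>p\<in>X. (4 * \<rho> * (1 + R)) powr s) \<le> (\<Sum>p\<in>X. (4 * (1 + R) / a) powr s * fst (f p) powr s)"
      by (rule sum_mono)
    also have "\<dots> < (4 * (1 + R) / a) powr s * \<epsilon>'"
      unfolding sum_distrib_left[symmetric] using small a R by (intro mult_strict_left_mono) auto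
    also have "\<dots> = \<epsilon> / 2" using a R by (simp add: \<epsilon>'_def)
    finally show "(\<Sum>p\<in>X. (4 * \<rho> * (1 + R)) powr s) < \<epsilon> / 2" .
    show "A - G \<subseteq> (\<Union>p\<in>X. ball p (4 * \<rho> * (1 + R)))"
      using X(4) by auto
  qed (use X \<rho> R in auto)
  ultimately have "ball_covered s ((2 * R) powr s / W + \<epsilon> / 2 + \<epsilon> / 2) (G \<union> (A - G))"
    by (rule ball_covered_Un)
  then show ?thesis by (rule ball_covered_mono) auto
qed

text \<open>Copies of \<open>A\<close> of size about \<open>r\<close> at the points of
  \<open>X\<close> are disjoint and lie in \<open>ball x (2 * R)\<close>. Their weight
  \<open>W\<close> is at least \<open>card X\<close> times \<open>(k * r) powr s\<close>. For
  \<open>s > 0\<close> the cluster produces covers of \<open>A\<close> of cost close to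
  \<open>(4 * R) powr s / W\<close>; as the cost cannot drop below a fixed bound, \<open>W\<close>
  cannot be large.\<close>

lemma self_embeddable_separated_card_le:
  assumes A: "compact A" "A \<noteq> {}" and s: "s \<ge> 0" "\<And>t. t > s \<Longrightarrow> ball_null t A"
    and nn: "s = 0 \<or> \<not> ball_null s A"
    and emb: "self_embeddable a A"
  shows "\<exists>C>0. \<forall>R r x X. 0 < r \<longrightarrow> r < R \<longrightarrow> finite X \<longrightarrow> X \<subseteq> ball x R \<inter> A \<longrightarrow> separated r X
      \<longrightarrow> real (card X) \<le> C * (R / r) powr s"
proof -
  have a: "a > 0" using emb by (simp add: self_embeddable_def)
  obtain D where D: "D \<ge> 0" "\<And>x y. x \<in> A \<Longrightarrow> y \<in> A \<Longrightarrow> dist x y \<le> D"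
    using diameter_bounded_bound[OF compact_imp_bounded[OF A(1)]] diameter_ge_0[OF compact_imp_bounded[OF A(1)]]
    by blast
  define k where "k = a / (2 * (1 + D))"
  have k: "k > 0" using a D by (simp add: k_def)
  obtain \<epsilon> where \<epsilon>: "\<epsilon> > 0" "s = 0 \<or> \<not> ball_covered s \<epsilon> A"
    using nn unfolding ball_null_def by (metis zero_less_one)
  \<comment> \<open>The summand 1 serves sets of at most one point and the exponent 0. The other one
    is the bound on \<open>W / (k * r) powr s\<close> with \<open>(R / r) powr s\<close> split
    off.\<close>
  define C where "C = 1 + 2 * (4 / k) powr s / \<epsilon>"
  have C: "C \<ge> 1" using \<epsilon> k by (simp add: C_def)
  show ?thesis
  proof (intro exI[of _ C] conjI allI impI)
    fix R r x X assume r: "0 < r" "r < R" and X: "finite X" "X \<subseteq> ball x R \<inter> A" "separated r X"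
    have "1 \<le> (R / r) powr s" using r s by (intro ge_one_powr_ge_zero) auto
    then have C1: "1 \<le> C * (R / r) powr s" using mult_mono[of 1 C 1 "(R/r) powr s"] C by simp
    show "real (card X) \<le> C * (R / r) powr s"
    proof (cases "card X \<le> 1")
      case True
      then show ?thesis using C1 by linarith
    next
      case False
      then obtain y z where "y \<in> X" "z \<in> X" "y \<noteq> z"
        using X(1) card_le_Suc0_iff_eq[OF X(1)] by auto
      then have "r \<le> D" using X D(2)[of y z] unfolding separated_def by force
      \<comment> \<open>Two points of \<open>X\<close> give \<open>r \<le> D\<close> and hence
        \<open>\<rho> \<le> 1\<close>, as self-embeddability requires;
        \<open>\<rho> \<le> r / 2\<close> keeps the copies apart.\<close>
      define \<rho> where "\<rho> = r / (2 * (1 + D))"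
      have \<rho>: "\<rho> > 0" "\<rho> \<le> 1" "\<rho> \<le> r / 2"
        using r D \<open>r \<le> D\<close> by (auto simp: \<rho>_def field_simps)
      have "\<exists>\<phi>. \<phi> \<in> embeddings A \<and> a * \<rho> \<le> fst \<phi> \<and> homothety \<phi> ` A \<subseteq> ball p \<rho>" if "p \<in> X" for p
        using self_embeddableE[OF emb _ \<rho>(1,2), of p] that X(2) by blast
      then obtain q where q: "\<And>p. p \<in> X \<Longrightarrow> q p \<in> embeddings A \<and> a * \<rho> \<le> fst (q p) \<and> homothety (q p) ` A \<subseteq> ball p \<rho>"
        by metis
      have disj: "homothety (q i) ` A \<inter> homothety (q j) ` A = {}" if ij: "i \<in> X" "j \<in> X" "i \<noteq> j" for i j
      proof (rule ccontr)
        assume "\<not> ?thesis"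
        then obtain u where "u \<in> ball i \<rho>" "u \<in> ball j \<rho>" using q[OF ij(1)] q[OF ij(2)] by blast
        then have "dist i j < r" using \<rho>(3) by (auto simp: dist_real_def)
        then show False using X(3) ij unfolding separated_def by force
      qed
      have sub: "homothety (q i) ` A \<subseteq> ball x (2 * R)" if "i \<in> X" for i
      proof -
        have "ball i \<rho> \<subseteq> ball x (2 * R)"
          using that X(2) \<rho>(3) r by (auto simp: dist_real_def)
        then show ?thesis using q[OF that] by blast
      qed
      define W where "W = (\<Sum>i\<in>X. fst (q i) powr s)"
      have kr: "k * r = a * \<rho>" by (simp add: k_def \<rho>_def)
      have "(k * r) powr s \<le> fst (q i) powr s" if "i \<in> X" for i
        using q[OF that] \<rho>(1) a s unfolding kr by (intro powr_mono2) auto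
      then have "real (card X) * (k * r) powr s \<le> W"
        unfolding W_def by (intro sum_bounded_below) auto
      then have cW: "real (card X) \<le> W / (k * r) powr s" using k r by (simp add: field_simps)
      show ?thesis
      proof (cases "s = 0")
        \<comment> \<open>At exponent 0 every copy weighs 1, so the weight bound for disjoint copies
          already limits \<open>card X\<close>.\<close>
        case True
        have "W \<le> 1"
          unfolding W_def using q X(1) disj by (intro disjoint_embeddings_sum_le_1[OF A s]) auto
        then show ?thesis using cW C1 True k r by simp
      next
        case False
        have "X \<noteq> {}" using \<open>y \<in> X\<close> by blast
        then have cov: "ball_covered s ((2 * (2 * R)) powr s / W + \<epsilon> / 2) A"
          using X(1) q disj sub \<epsilon>(1) by (intro cluster_ball_covered[OF A s emb _ _ _ _ sub W_def]) auto
        have "\<epsilon> < (4 * R) powr s / W + \<epsilon> / 2"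
        proof (rule ccontr)
          assume "\<not> ?thesis"
          then have "ball_covered s \<epsilon> A" using ball_covered_mono[OF cov] by simp
          then show False using \<epsilon> False by simp
        qed
        then have "\<epsilon> / 2 < (4 * R) powr s / W" by linarith
        moreover have "W > 0"
        proof (rule ccontr)
          assume "\<not> W > 0"
          then have "(4 * R) powr s / W \<le> 0" by (simp add: divide_nonneg_nonpos)
          then show False using \<open>\<epsilon> / 2 < _\<close> \<epsilon>(1) by simp
        qed
        ultimately have "W \<le> 2 * (4 * R) powr s / \<epsilon>" using \<epsilon> by (simp add: field_simps)
        then have "W / (k * r) powr s \<le> 2 * (4 * R) powr s / \<epsilon> / (k * r) powr s"
          by (intro divide_right_mono) auto
        also have "\<dots> = 2 * (4 / k) powr s / \<epsilon> * (R / r) powr s"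
          using k r by (simp add: powr_mult powr_divide mult_ac)
        also have "\<dots> \<le> C * (R / r) powr s"
          by (intro mult_right_mono) (auto simp: C_def)
        finally show ?thesis using cW by simp
      qed
    qed
  qed (use C in simp)
qed

section \<open>Long chains\<close>

text \<open>A distorted arithmetic progression of \<open>N + 1\<close> points: \<open>K\<close>
  stays fixed as \<open>N\<close> grows, while the scale \<open>d\<close> is free.\<close>

definition chain :: "real \<Rightarrow> real set \<Rightarrow> nat \<Rightarrow> real \<Rightarrow> (nat \<Rightarrow> real) \<Rightarrow> bool" where
  "chain K A N d y \<longleftrightarrow> d > 0 \<and> (\<forall>i\<le>N. y i \<in> A) \<and>
     (\<forall>i<N. d / K \<le> y (Suc i) - y i \<and> y (Suc i) - y i \<le> d)"

text \<open>A chain is \<open>d / K\<close>-separated inside a ball of radius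
  \<open>(N + 1) * d\<close>. A bound with exponent \<sigma> therefore gives
  \<open>N + 1 \<le> C * (K * (N + 1)) powr \<sigma>\<close>, which fails for large \<open>N\<close>
  if \<open>\<sigma> < 1\<close>.\<close>

lemma long_chains_exponent_ge_1:
  assumes ch: "\<And>N. \<exists>d y. chain K A N d y" and K: "K \<ge> 1" and C: "C > 0"
    and X: "\<And>R r x X. \<lbrakk>0 < r; r < R; x \<in> A; finite X; X \<subseteq> ball x R \<inter> A; separated r X\<rbrakk>
        \<Longrightarrow> real (card X) \<le> C * (R / r) powr \<sigma>"
  shows "1 \<le> \<sigma>"
proof (rule ccontr)
  assume "\<not> 1 \<le> \<sigma>"
  then have \<sigma>: "\<sigma> < 1" by simp
  \<comment> \<open>From this size on, \<open>?n powr (1 - \<sigma>)\<close> exceeds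
    \<open>C * K powr \<sigma>\<close>.\<close>
  define M where "M = (C * K powr \<sigma> + 1) powr (1 / (1 - \<sigma>))"
  obtain N where N: "M \<le> real N" using real_arch_simple by blast
  let ?n = "real N + 1"
  obtain d y where "chain K A N d y" using ch by blast
  then have d: "d > 0" and yA: "\<And>i. i \<le> N \<Longrightarrow> y i \<in> A"
    and lo: "\<And>i. i < N \<Longrightarrow> d / K \<le> y (Suc i) - y i" and hi: "\<And>i. i < N \<Longrightarrow> y (Suc i) - y i \<le> d"
    by (auto simp: chain_def)
  define r where "r = d / K"
  have r: "r > 0" "r \<le> d" using d K by (auto simp: r_def field_simps)
  have inc: "real (j - i) * r \<le> y j - y i" if "i \<le> j" "j \<le> N" for i j
    using that
  proof (induction j rule: dec_induct)
    case (step n)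
    then have "real (n - i) * r \<le> y n - y i" "r \<le> y (Suc n) - y n"
      using lo by (auto simp: r_def)
    then show ?case using step.hyps by (simp add: Suc_diff_le algebra_simps)
  qed simp
  have gap: "r \<le> y j - y i" if "i < j" "j \<le> N" for i j
  proof -
    have "1 * r \<le> real (j - i) * r" using that r by (intro mult_right_mono) auto
    then show ?thesis using inc[of i j] that by simp
  qed
  have up: "y j - y 0 \<le> real j * d" if "j \<le> N" for j
    using that
  proof (induction j)
    case (Suc j)
    then show ?case using hi[of j] by (simp add: algebra_simps)
  qed simp
  have inj: "inj_on y {..N}"
  proof (rule inj_onI, rule ccontr)
    fix i j assume "i \<in> {..N}" "j \<in> {..N}" "y i = y j" "i \<noteq> j"
    then show False using gap[of i j] gap[of j i] r by (cases "i < j") auto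
  qed
  have "real (card (y ` {..N})) \<le> C * ((?n * d) / r) powr \<sigma>"
  proof (rule X[OF r(1)])
    show "r < ?n * d"
    proof -
      have "N \<ge> 1"
      proof (rule ccontr)
        assume "\<not> N \<ge> 1"
        then have "M \<le> 0" using N by simp
        moreover have "C * K powr \<sigma> + 1 > 0" using C by (simp add: add_nonneg_pos)
        then have "M > 0" by (simp add: M_def)
        ultimately show False by simp
      qed
      then have "1 * d < ?n * d" using d by (intro mult_strict_right_mono) auto
      then show ?thesis using r by linarith
    qed
    show "y ` {..N} \<subseteq> ball (y 0) (?n * d) \<inter> A"
    proof (rule image_subsetI)
      fix j assume j: "j \<in> {..N}"
      have "y 0 \<le> y j" using gap[of 0 j] j r by (cases "j = 0") auto
      moreover have "y j - y 0 < ?n * d"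
      proof -
        have "real j * d < ?n * d" using j d by (intro mult_strict_right_mono) auto
        then show ?thesis using up[of j] j by simp
      qed
      ultimately show "y j \<in> ball (y 0) (?n * d) \<inter> A" using yA j by (auto simp: dist_real_def)
    qed
    show "separated r (y ` {..N})"
      unfolding separated_def
    proof (intro ballI impI)
      fix u v assume "u \<in> y ` {..N}" "v \<in> y ` {..N}" "u \<noteq> v"
      then obtain i j where ij: "u = y i" "v = y j" "i \<le> N" "j \<le> N" "i \<noteq> j" by auto
      then consider "i < j" | "j < i" by linarith
      then show "r \<le> dist u v"
      proof cases
        case 1
        then show ?thesis using gap[of i j] ij by (simp add: dist_real_def)
      next
        case 2
        then show ?thesis using gap[of j i] ij by (simp add: dist_real_def)
      qed
    qed
  qed (use yA in auto)
  moreover have "card (y ` {..N}) = Suc N" using inj by (simp add: card_image)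
  moreover have "(?n * d) / r = K * ?n" using d by (simp add: r_def)
  ultimately have "?n \<le> C * (K * ?n) powr \<sigma>" by (simp add: add.commute)
  then have "?n \<le> C * K powr \<sigma> * ?n powr \<sigma>" by (simp add: powr_mult mult.assoc)
  moreover have "?n = ?n powr (1 - \<sigma>) * ?n powr \<sigma>" by (simp flip: powr_add)
  ultimately have "?n powr (1 - \<sigma>) * ?n powr \<sigma> \<le> C * K powr \<sigma> * ?n powr \<sigma>" by simp
  then have "?n powr (1 - \<sigma>) \<le> C * K powr \<sigma>" by simp
  moreover have "C * K powr \<sigma> + 1 \<le> ?n powr (1 - \<sigma>)"
  proof -
    have pos: "C * K powr \<sigma> + 1 > 0" using C by (simp add: add_nonneg_pos)
    then have "C * K powr \<sigma> + 1 = M powr (1 - \<sigma>)" using \<sigma> by (simp add: M_def powr_powr)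
    also have "\<dots> \<le> ?n powr (1 - \<sigma>)" using N \<sigma> by (intro powr_mono2) (auto simp: M_def)
    finally show ?thesis .
  qed
  ultimately show False by simp
qed

text \<open>Dividing by \<open>fst \<phi>\<close> measures how far \<psi> followed by the inverse of
  \<phi> is from the identity: it comes arbitrarily close without being equal, in the manner of a
  failing weak separation property.\<close>

definition nearly_coincident :: "real set \<Rightarrow> bool" where
  "nearly_coincident A \<longleftrightarrow> (\<forall>\<epsilon>>0. \<exists>\<phi>\<in>embeddings A. \<exists>\<psi>\<in>embeddings A. \<phi> \<noteq> \<psi> \<and>
      \<bar>fst \<psi> - fst \<phi>\<bar> \<le> \<epsilon> * fst \<phi> \<and> \<bar>snd \<psi> - snd \<phi>\<bar> \<le> \<epsilon> * fst \<phi>)"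

text \<open>Write \<psi> as \<phi> after the map sending \<open>x\<close> to \<open>x + D x\<close>.
  The affine function \<open>D\<close> is tiny but not zero, so near one end of \<open>A\<close> it
  is comparable to its largest absolute value \<open>e\<close> at the two ends. An embedding
  \<open>u\<close> of ratio comparable to \<open>e / d\<close> moves \<open>y\<close> there, and the
  displacement becomes comparable to \<open>d\<close> times the ratio of the composed map.\<close>

lemma nearly_coincident_displacement:
  assumes A: "compact A" "p \<in> A" "p' \<in> A" "p \<noteq> p'" and emb: "self_embeddable a A"
    and nc: "nearly_coincident A" and d: "d > 0" and y: "y \<in> A"
  obtains \<phi> \<psi> where "\<phi> \<in> embeddings A" "\<psi> \<in> embeddings A"
      "fst \<psi> \<le> 3/2 * fst \<phi>" "fst \<phi> \<le> 2 * fst \<psi>"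
      "a / 3 * d * fst \<phi> \<le> \<bar>homothety \<psi> y - homothety \<phi> y\<bar>"
      "\<bar>homothety \<psi> y - homothety \<phi> y\<bar> \<le> d * fst \<phi>"
proof -
  have a: "a > 0" using emb by (simp add: self_embeddable_def)
  have ne: "A \<noteq> {}" using A by blast
  obtain m where m: "m \<in> A" "\<And>x. x \<in> A \<Longrightarrow> m \<le> x" using compact_attains_inf[OF A(1) ne] by blast
  obtain M where M: "M \<in> A" "\<And>x. x \<in> A \<Longrightarrow> x \<le> M" using compact_attains_sup[OF A(1) ne] by blast
  define \<Delta> where "\<Delta> = M - m"
  have \<Delta>: "\<Delta> > 0" using A(2-4) m(2)[of p] m(2)[of p'] M(2)[of p] M(2)[of p'] unfolding \<Delta>_def by linarith
  define L where "L = \<bar>m\<bar> + \<bar>M\<bar>"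
  \<comment> \<open>The bound 1/2 gives the comparison of ratios. The other one yields
    \<open>\<rho> \<le> min 1 (\<Delta>/4)\<close> below, because
    \<open>e \<le> \<epsilon> * (1 + L)\<close>.\<close>
  define \<epsilon> where "\<epsilon> = min (1/2) (min 1 (\<Delta>/4) * (2 * a * d) / (3 * (1 + L)))"
  have L: "L \<ge> 0" by (simp add: L_def)
  have \<epsilon>: "\<epsilon> > 0" using \<Delta> a d L by (simp add: \<epsilon>_def)
  obtain \<phi> \<psi> where \<phi>: "\<phi> \<in> embeddings A" "\<psi> \<in> embeddings A" "\<phi> \<noteq> \<psi>"
      "\<bar>fst \<psi> - fst \<phi>\<bar> \<le> \<epsilon> * fst \<phi>" "\<bar>snd \<psi> - snd \<phi>\<bar> \<le> \<epsilon> * fst \<phi>"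
    using nc \<epsilon> unfolding nearly_coincident_def by blast
  have k: "fst \<phi> > 0" "fst \<psi> > 0" using \<phi> by (auto dest: embeddingsD)
  define \<mu> where "\<mu> = (fst \<psi> - fst \<phi>) / fst \<phi>"
  define \<tau> where "\<tau> = (snd \<psi> - snd \<phi>) / fst \<phi>"
  define D where "D x = \<mu> * x + \<tau>" for x
  have \<mu>\<tau>: "\<bar>\<mu>\<bar> \<le> \<epsilon>" "\<bar>\<tau>\<bar> \<le> \<epsilon>" using \<phi> k by (auto simp: \<mu>_def \<tau>_def field_simps)
  have D: "homothety \<psi> x - homothety \<phi> x = fst \<phi> * D x" for x
    using k by (simp add: homothety_def D_def \<mu>_def \<tau>_def field_simps)
  \<comment> \<open>An affine function with two zeros vanishes identically, which would make the two
    maps equal.\<close>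
  have Dnz: "D m \<noteq> 0 \<or> D M \<noteq> 0"
  proof (rule ccontr)
    assume "\<not> ?thesis"
    then have z: "D m = 0" "D M = 0" by auto
    have "\<mu> * (M - m) = D M - D m" by (simp add: D_def algebra_simps)
    then have "\<mu> * (M - m) = 0" using z by simp
    then have "\<mu> = 0" using \<Delta> by (simp add: \<Delta>_def)
    then have "\<tau> = 0" using z by (simp add: D_def)
    then show False using \<open>\<mu> = 0\<close> \<phi>(3) k by (simp add: \<mu>_def \<tau>_def prod_eq_iff)
  qed
  obtain x0 where x0: "x0 \<in> A" "\<bar>D m\<bar> \<le> \<bar>D x0\<bar>" "\<bar>D M\<bar> \<le> \<bar>D x0\<bar>" "\<bar>x0\<bar> \<le> L"
  proof (cases "\<bar>D m\<bar> \<le> \<bar>D M\<bar>")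
    case True
    then show ?thesis using that[of M] M by (simp add: L_def)
  next
    case False
    then show ?thesis using that[of m] m by (simp add: L_def)
  qed
  define e where "e = \<bar>D x0\<bar>"
  have e0: "e > 0" using Dnz x0 by (auto simp: e_def)
  have e\<epsilon>: "e \<le> \<epsilon> * (1 + L)"
  proof -
    have "e \<le> \<bar>\<mu>\<bar> * \<bar>x0\<bar> + \<bar>\<tau>\<bar>" unfolding e_def D_def abs_mult[symmetric] by linarith
    also have "\<dots> \<le> \<epsilon> * L + \<epsilon>" using \<mu>\<tau> x0(4) \<epsilon> by (intro add_mono mult_mono) auto
    finally show ?thesis by (simp add: algebra_simps)
  qed
  have \<mu>e: "\<bar>\<mu>\<bar> * \<Delta> \<le> 2 * e"
  proof -
    have "\<mu> * \<Delta> = D M - D m" by (simp add: D_def \<Delta>_def algebra_simps)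
    then have "\<bar>\<mu> * \<Delta>\<bar> \<le> 2 * e" using x0 unfolding e_def by linarith
    then show ?thesis using \<Delta> by (simp add: abs_mult)
  qed
  \<comment> \<open>The slope is at most \<open>2 * e / \<Delta>\<close> in absolute value, so over
    a distance of \<Delta>/4 the value changes by at most \<open>e / 2\<close>.\<close>
  have near: "e / 2 \<le> \<bar>D x\<bar> \<and> \<bar>D x\<bar> \<le> 3/2 * e" if "\<bar>x - x0\<bar> \<le> \<Delta>/4" for x
  proof -
    have "\<bar>D x - D x0\<bar> = \<bar>\<mu>\<bar> * \<bar>x - x0\<bar>" by (simp add: D_def abs_mult flip: right_diff_distrib)
    also have "\<dots> \<le> \<bar>\<mu>\<bar> * (\<Delta>/4)" using that by (intro mult_left_mono) auto
    also have "\<dots> \<le> e / 2" using \<mu>e by linarith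
    finally show ?thesis unfolding e_def by linarith
  qed
  \<comment> \<open>As \<open>fst u\<close> lies between \<open>a * \<rho>\<close> and \<rho>, this
    choice bounds \<open>3/2 * e\<close> above by \<open>d * fst u\<close> and \<open>e / 2\<close>
    below by \<open>a / 3 * d * fst u\<close>.\<close>
  define \<rho> where "\<rho> = 3 * e / (2 * a * d)"
  have \<rho>0: "\<rho> > 0" using e0 a d by (simp add: \<rho>_def)
  have \<rho>1: "\<rho> \<le> min 1 (\<Delta>/4)"
  proof -
    have "\<epsilon> \<le> min 1 (\<Delta>/4) * (2 * a * d) / (3 * (1 + L))" unfolding \<epsilon>_def by (rule min.cobounded2)
    then have "\<epsilon> * (1 + L) \<le> min 1 (\<Delta>/4) * (2 * a * d) / (3 * (1 + L)) * (1 + L)"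
      using L by (intro mult_right_mono) auto
    also have "\<dots> = min 1 (\<Delta>/4) * (2 * a * d) / 3" using L by (simp add: field_simps)
    finally have "e \<le> min 1 (\<Delta>/4) * (2 * a * d) / 3" using e\<epsilon> by linarith
    then have "e * 3 / (2 * a * d) \<le> min 1 (\<Delta>/4)"
      using a d by (subst pos_divide_le_eq) auto
    then show ?thesis by (simp add: \<rho>_def mult.commute)
  qed
  then have "\<rho> \<le> 1" by simp
  then obtain u where u: "u \<in> embeddings A" "a * \<rho> \<le> fst u" "fst u \<le> \<rho>" "homothety u ` A \<subseteq> ball x0 \<rho>"
    using self_embeddableE[OF emb x0(1) \<rho>0] by blast
  have u0: "fst u > 0" using u(1) by (rule embeddingsD)
  have "\<bar>homothety u y - x0\<bar> \<le> \<Delta>/4" 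
  proof -
    have "homothety u y \<in> ball x0 \<rho>" using u(4) y by blast
    then have "\<bar>x0 - homothety u y\<bar> < \<rho>" by (simp add: dist_real_def)
    moreover have "\<rho> \<le> \<Delta>/4" using \<rho>1 by simp
    ultimately show ?thesis by linarith
  qed
  note nr = near[OF this]
  have ub: "\<bar>D (homothety u y)\<bar> \<le> d * fst u"
  proof -
    have "3/2 * e = d * (a * \<rho>)" using a d by (simp add: \<rho>_def)
    also have "\<dots> \<le> d * fst u" using u d by (intro mult_left_mono) auto
    finally show ?thesis using nr by linarith
  qed
  have lb: "a / 3 * d * fst u \<le> \<bar>D (homothety u y)\<bar>"
  proof -
    have "a / 3 * d * fst u \<le> a / 3 * d * \<rho>" using u a d by (intro mult_left_mono) auto
    also have "\<dots> = e / 2" using a d by (simp add: \<rho>_def)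
    finally show ?thesis using nr by linarith
  qed
  have diff: "\<bar>homothety (hcomp \<psi> u) y - homothety (hcomp \<phi> u) y\<bar> = fst \<phi> * \<bar>D (homothety u y)\<bar>"
    using k by (simp add: homothety_hcomp D abs_mult)
  have \<epsilon>2: "\<epsilon> \<le> 1/2" by (simp add: \<epsilon>_def)
  have "\<epsilon> * fst \<phi> \<le> 1/2 * fst \<phi>" using \<epsilon>2 k by (intro mult_right_mono) auto
  then have rat: "fst \<psi> \<le> 3/2 * fst \<phi>" "fst \<phi> \<le> 2 * fst \<psi>" using \<phi>(4) by linarith+
  show thesis
  proof (rule that[of "hcomp \<phi> u" "hcomp \<psi> u"])
    show "fst (hcomp \<psi> u) \<le> 3/2 * fst (hcomp \<phi> u)" "fst (hcomp \<phi> u) \<le> 2 * fst (hcomp \<psi> u)"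
      using mult_right_mono[OF rat(1), of "fst u"] mult_right_mono[OF rat(2), of "fst u"] u0
      by (simp_all add: hcomp_def mult.assoc)
    show "a / 3 * d * fst (hcomp \<phi> u) \<le> \<bar>homothety (hcomp \<psi> u) y - homothety (hcomp \<phi> u) y\<bar>"
      unfolding diff using mult_left_mono[OF lb, of "fst \<phi>"] k by (simp add: hcomp_def mult_ac)
    show "\<bar>homothety (hcomp \<psi> u) y - homothety (hcomp \<phi> u) y\<bar> \<le> d * fst (hcomp \<phi> u)"
      unfolding diff using mult_left_mono[OF ub, of "fst \<phi>"] k by (simp add: hcomp_def mult_ac)
  qed (use \<phi> u in \<open>auto intro!: hcomp_embeddings\<close>)
qed

text \<open>The old chain is mapped by whichever of the two maps puts its first point further right,
  and the other image of that point is prepended. The order of the two images cannot be prescribed,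
  hence the two cases.\<close>

lemma nearly_coincident_chain:
  assumes A: "compact A" "p \<in> A" "p' \<in> A" "p \<noteq> p'" and emb: "self_embeddable a A"
    and nc: "nearly_coincident A"
  shows "\<exists>d y. chain (9 / a) A N d y"
proof (induction N)
  case 0
  show ?case using A(2) by (intro exI[of _ 1] exI[of _ "\<lambda>_. p"]) (simp add: chain_def)
next
  case (Suc N)
  have a: "a > 0" using emb by (simp add: self_embeddable_def)
  define K where "K = 9 / a"
  obtain d y where "chain K A N d y" using Suc unfolding K_def by blast
  then have d: "d > 0" and yA: "\<And>i. i \<le> N \<Longrightarrow> y i \<in> A"
    and inc: "\<And>i. i < N \<Longrightarrow> d / K \<le> y (Suc i) - y i"  "\<And>i. i < N \<Longrightarrow> y (Suc i) - y i \<le> d"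
    by (auto simp: chain_def)
  \<comment> \<open>The first increment must be at most \<open>d\<close> times the ratio of the map
    applied, and \<open>fst \<phi>\<close> may be twice \<open>fst \<psi>\<close>; hence
    \<open>d / 2\<close>. From below, \<open>a * d / 6\<close> and the factor 3/2 between the ratios
    give the 9 in \<open>9 / a\<close>.\<close>
  have "d / 2 > 0" using d by simp
  obtain \<phi> \<psi> where *: "\<phi> \<in> embeddings A" "\<psi> \<in> embeddings A"
      "fst \<psi> \<le> 3/2 * fst \<phi>" "fst \<phi> \<le> 2 * fst \<psi>"
      "a / 3 * (d / 2) * fst \<phi> \<le> \<bar>homothety \<psi> (y 0) - homothety \<phi> (y 0)\<bar>"
      "\<bar>homothety \<psi> (y 0) - homothety \<phi> (y 0)\<bar> \<le> d / 2 * fst \<phi>"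
    by (rule nearly_coincident_displacement[OF A emb nc \<open>d / 2 > 0\<close> yA[OF le0]]) (rule that)
  have prepend: "\<exists>z. chain K A (Suc N) (fst \<beta> * d) z"
    if e: "\<alpha> \<in> embeddings A" "\<beta> \<in> embeddings A"
      and first: "fst \<beta> * d / K \<le> homothety \<beta> (y 0) - homothety \<alpha> (y 0)"
        "homothety \<beta> (y 0) - homothety \<alpha> (y 0) \<le> fst \<beta> * d" for \<alpha> \<beta>
  proof -
    define z where "z = case_nat (homothety \<alpha> (y 0)) (\<lambda>i. homothety \<beta> (y i))"
    have z: "z 0 = homothety \<alpha> (y 0)" "z (Suc i) = homothety \<beta> (y i)" for i by (simp_all add: z_def)
    have \<beta>: "fst \<beta> > 0" using e(2) by (rule embeddingsD)
    have "z i \<in> A" if "i \<le> Suc N" for i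
    proof (cases i)
      case 0
      then show ?thesis using embeddingsD(3)[OF e(1) yA[OF le0]] z by simp
    next
      case (Suc j)
      then show ?thesis using embeddingsD(3)[OF e(2) yA[of j]] z that by simp
    qed
    moreover have "fst \<beta> * d / K \<le> z (Suc i) - z i \<and> z (Suc i) - z i \<le> fst \<beta> * d" if "i < Suc N" for i
    proof (cases i)
      case 0
      then show ?thesis using first z by simp
    next
      case (Suc j)
      then have j: "j < N" using that by simp
      have "z (Suc i) - z i = fst \<beta> * (y (Suc j) - y j)"
        by (simp add: Suc z homothety_def algebra_simps)
      then show ?thesis
        using mult_left_mono[OF inc(1)[OF j], of "fst \<beta>"] mult_left_mono[OF inc(2)[OF j], of "fst \<beta>"] \<beta>
        by simp
    qed
    ultimately show ?thesis using \<beta> d unfolding chain_def by (intro exI[of _ z]) auto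
  qed
  have ad: "a * d > 0" using a d by simp
  have b1: "fst \<psi> * (a * d) \<le> 3/2 * fst \<phi> * (a * d)" using *(3) ad by (intro mult_right_mono) auto
  have b2: "fst \<phi> * d \<le> 2 * fst \<psi> * d" using *(4) d by (intro mult_right_mono) auto
  have k: "fst \<phi> > 0" using *(1) by (rule embeddingsD)
  have b3: "fst \<phi> * (a * d) > 0" "fst \<phi> * d > 0" using k ad d by simp_all
  have h5: "fst \<phi> * (a * d) / 6 \<le> \<bar>homothety \<psi> (y 0) - homothety \<phi> (y 0)\<bar>"
    using *(5) by (simp add: mult_ac)
  have h6: "\<bar>homothety \<psi> (y 0) - homothety \<phi> (y 0)\<bar> \<le> fst \<phi> * d / 2"
    using *(6) by (simp add: mult_ac)
  have eq: "fst \<beta> * d / K = fst \<beta> * (a * d) / 9" for \<beta> :: "real \<times> real" by (simp add: K_def)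
  have "\<exists>d z. chain K A (Suc N) d z"
  proof (cases "homothety \<phi> (y 0) \<le> homothety \<psi> (y 0)")
    case True
    have "fst \<psi> * d / K \<le> homothety \<psi> (y 0) - homothety \<phi> (y 0)"
      unfolding eq using True b1 b3 h5 by linarith
    moreover have "homothety \<psi> (y 0) - homothety \<phi> (y 0) \<le> fst \<psi> * d"
      using True b2 h6 by linarith
    ultimately show ?thesis using prepend[OF *(1) *(2)] by blast
  next
    case False
    have "fst \<phi> * d / K \<le> homothety \<phi> (y 0) - homothety \<psi> (y 0)"
      unfolding eq using False b3 h5 by linarith
    moreover have "homothety \<phi> (y 0) - homothety \<psi> (y 0) \<le> fst \<phi> * d"
      using False b3 h6 by linarith
    ultimately show ?thesis using prepend[OF *(2) *(1)] by blast
  qed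
  then show ?case by (simp add: K_def)
qed

section \<open>Approximation of orthogonal matrices\<close>

lemma sum_UNION_le:
  fixes f :: "'a \<Rightarrow> real"
  assumes "finite A" "\<And>a. a \<in> A \<Longrightarrow> finite (B a)" "\<And>x. f x \<ge> 0"
  shows "sum f (\<Union>a\<in>A. B a) \<le> (\<Sum>a\<in>A. sum f (B a))"
  using assms(1,2)
proof (induction A)
  case (insert a A)
  have "sum f (B a \<union> (\<Union>a\<in>A. B a)) \<le> sum f (B a) + sum f (\<Union>a\<in>A. B a)"
    using insert assms(3) by (subst sum_Un) (auto intro: sum_nonneg)
  then show ?case using insert by simp
qed simp

text \<open>Distance at most \<tau> in operator norm. Orthogonal factors on either side preserve it,
  so approximations can be multiplied.\<close>

definition near :: "real \<Rightarrow> real^'n^'n \<Rightarrow> real^'n^'n \<Rightarrow> bool" where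
  "near \<tau> A B \<longleftrightarrow> (\<forall>x. norm (A *v x - B *v x) \<le> \<tau> * norm x)"

lemma nearI: "(\<And>x. norm (A *v x - B *v x) \<le> \<tau> * norm x) \<Longrightarrow> near \<tau> A B"
  by (simp add: near_def)

lemma nearD: "near \<tau> A B \<Longrightarrow> norm (A *v x - B *v x) \<le> \<tau> * norm x"
  by (simp add: near_def)

lemma near_commute: "near \<tau> A B \<Longrightarrow> near \<tau> B A"
  by (simp add: near_def norm_minus_commute)

lemma norm_orthogonal_matrix_mult:
  fixes M :: "real^'n^'n"
  assumes "orthogonal_matrix M"
  shows "norm (M *v x) = norm x"
proof -
  have "orthogonal_transformation ((*v) M)"
    using assms by (simp add: orthogonal_transformation_matrix)
  then show ?thesis by (rule orthogonal_transformation_norm)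
qed

lemma near_mult_left:
  fixes M :: "real^'n^'n"
  assumes "orthogonal_matrix M" "near \<tau> A B"
  shows "near \<tau> (M ** A) (M ** B)"
proof (rule nearI)
  fix x
  have "norm ((M ** A) *v x - (M ** B) *v x) = norm (M *v (A *v x - B *v x))"
    by (simp add: matrix_vector_mul_assoc matrix_vector_mult_diff_distrib)
  also have "\<dots> \<le> \<tau> * norm x"
    using assms by (simp add: norm_orthogonal_matrix_mult nearD)
  finally show "norm ((M ** A) *v x - (M ** B) *v x) \<le> \<tau> * norm x" .
qed

lemma near_mult_right:
  fixes M :: "real^'n^'n"
  assumes "orthogonal_matrix M" "near \<tau> A B"
  shows "near \<tau> (A ** M) (B ** M)"
proof (rule nearI)
  fix x
  show "norm ((A ** M) *v x - (B ** M) *v x) \<le> \<tau> * norm x"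
    using nearD[OF assms(2), of "M *v x"] assms(1)
    by (simp add: norm_orthogonal_matrix_mult matrix_vector_mul_assoc)
qed

lemma near_trans:
  assumes "near \<tau> A B" "near \<tau>' B C"
  shows "near (\<tau> + \<tau>') A C"
proof (rule nearI)
  fix x
  have "norm (A *v x - C *v x) \<le> norm (A *v x - B *v x) + norm (B *v x - C *v x)"
    using norm_triangle_ineq[of "A *v x - B *v x" "B *v x - C *v x"] by simp
  also have "\<dots> \<le> \<tau> * norm x + \<tau>' * norm x" using assms by (intro add_mono nearD)
  finally show "norm (A *v x - C *v x) \<le> (\<tau> + \<tau>') * norm x" by (simp add: distrib_right)
qed

lemma norm_matrix_vector_mult_le:
  fixes A :: "real^'n^'m"
  shows "norm (A *v x) \<le> norm A * norm x"
proof -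
  have "norm (A *v x) = L2_set (\<lambda>i. norm ((A *v x) $ i)) UNIV" by (simp add: norm_vec_def)
  also have "\<dots> \<le> L2_set (\<lambda>i. norm (A $ i) * norm x) UNIV"
    by (intro L2_set_mono) (auto simp: matrix_vector_mul_component Cauchy_Schwarz_ineq2)
  also have "\<dots> = norm A * norm x"
    by (simp add: norm_vec_def L2_set_left_distrib[symmetric])
  finally show ?thesis .
qed

lemma near_if_dist:
  fixes A B :: "real^'n^'n"
  assumes "dist A B \<le> \<tau>"
  shows "near \<tau> A B"
proof (rule nearI)
  fix x
  have "norm (A *v x - B *v x) = norm ((A - B) *v x)" by (simp add: matrix_vector_mult_diff_rdistrib)
  also have "\<dots> \<le> norm (A - B) * norm x" by (rule norm_matrix_vector_mult_le)
  also have "\<dots> \<le> \<tau> * norm x" using assms by (intro mult_right_mono) (auto simp: dist_norm)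
  finally show "norm (A *v x - B *v x) \<le> \<tau> * norm x" .
qed

lemma norm_le_sum_entries:
  fixes A :: "real^'n^'m"
  shows "norm A \<le> (\<Sum>i\<in>UNIV. \<Sum>j\<in>UNIV. \<bar>A $ i $ j\<bar>)"
proof -
  have "norm A = L2_set (\<lambda>i. norm (A $ i)) UNIV" by (simp add: norm_vec_def)
  also have "\<dots> \<le> (\<Sum>i\<in>UNIV. norm (A $ i))" by (rule L2_set_le_sum) simp
  also have "\<dots> \<le> (\<Sum>i\<in>UNIV. \<Sum>j\<in>UNIV. \<bar>A $ i $ j\<bar>)" by (intro sum_mono norm_le_l1_cart)
  finally show ?thesis .
qed

text \<open>Entries are read off from the action on basis vectors, and the sum of their absolute
  values dominates the norm; the factor lost is the number of entries.\<close>

lemma dist_le_if_near: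
  fixes A B :: "real^'n^'n"
  assumes "near \<tau> A B"
  shows "dist A B \<le> real (CARD('n) * CARD('n)) * \<tau>"
proof -
  have "\<bar>(A - B) $ i $ j\<bar> \<le> \<tau>" for i j
  proof -
    have "(A - B) $ i $ j = ((A - B) *v axis j 1) $ i"
      by (simp add: matrix_vector_mul_component inner_axis)
    also have "\<bar>\<dots>\<bar> \<le> norm ((A - B) *v axis j 1)" by (rule component_le_norm_cart)
    also have "\<dots> \<le> \<tau>"
      using nearD[OF assms, of "axis j 1"] by (simp add: matrix_vector_mult_diff_rdistrib norm_axis_1)
    finally show ?thesis .
  qed
  then have "(\<Sum>i\<in>UNIV. \<Sum>j\<in>UNIV. \<bar>(A - B) $ i $ j\<bar>) \<le> (\<Sum>i\<in>(UNIV::'n set). \<Sum>j\<in>(UNIV::'n set). \<tau>)"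
    by (intro sum_mono)
  then show ?thesis using norm_le_sum_entries[of "A - B"] by (simp add: dist_norm)
qed

lemma norm_orthogonal_matrix_le:
  fixes M :: "real^'n^'n"
  assumes "orthogonal_matrix M"
  shows "norm M \<le> real (CARD('n) * CARD('n))"
proof -
  have "near 1 M 0" by (rule nearI) (simp add: norm_orthogonal_matrix_mult[OF assms])
  then show ?thesis using dist_le_if_near by fastforce
qed

lemma bounded_sequence_near_pair:
  fixes f :: "nat \<Rightarrow> 'a::heine_borel"
  assumes "bounded (range f)" "\<tau> > 0"
  obtains m n where "m < n" "dist (f m) (f n) < \<tau>"
proof -
  obtain l and r :: "nat \<Rightarrow> nat" where r: "strict_mono r" "(f \<circ> r) \<longlonglongrightarrow> l"
    using bounded_imp_convergent_subsequence[OF assms(1)] by blast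
  then have "Cauchy (f \<circ> r)" by (intro LIMSEQ_imp_Cauchy)
  then obtain N where "\<And>m n. m \<ge> N \<Longrightarrow> n \<ge> N \<Longrightarrow> dist ((f \<circ> r) m) ((f \<circ> r) n) < \<tau>"
    using assms(2) unfolding Cauchy_def by blast
  then have "dist (f (r N)) (f (r (Suc N))) < \<tau>" by (metis comp_apply le_refl le_SucI)
  moreover have "r N < r (Suc N)" using r(1) by (simp add: strict_mono_Suc_iff)
  ultimately show thesis using that by blast
qed

text \<open>Compactness of the orthogonal group in the form needed below: powers of one matrix
  almost repeat, and infinitely many elements of the group cannot be uniformly separated.\<close>

lemma orthogonal_matrices_near_pair:
  fixes f :: "nat \<Rightarrow> real^'n^'n"
  assumes "\<And>n. orthogonal_matrix (f n)" "\<tau> > 0"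
  obtains m n where "m < n" "near \<tau> (f m) (f n)"
proof -
  have "bounded (range f)"
    using norm_orthogonal_matrix_le[OF assms(1)] by (auto simp: bounded_iff)
  then obtain m n where mn: "m < n" "dist (f m) (f n) < \<tau>"
    by (rule bounded_sequence_near_pair[OF _ assms(2)])
  show thesis by (rule that[OF mn(1) near_if_dist]) (use mn(2) in simp)
qed

section \<open>Words of the iterated function system\<close>

text \<open>A word is represented by the data of its similarity: ratio, orthogonal part,
  translation. Words with the same data are identified.\<close>

type_synonym word_map = "real \<times> (real^2^2) \<times> (real^2)"

definition ratio :: "word_map \<Rightarrow> real" where "ratio w = fst w"
definition rot :: "word_map \<Rightarrow> real^2^2" where "rot w = fst (snd w)"
definition shift :: "word_map \<Rightarrow> real^2" where "shift w = snd (snd w)"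

definition act :: "word_map \<Rightarrow> real^2 \<Rightarrow> real^2" where
  "act w x = ratio w *\<^sub>R (rot w *v x) + shift w"

definition wcomp :: "word_map \<Rightarrow> word_map \<Rightarrow> word_map" where
  "wcomp w w' = (ratio w * ratio w', rot w ** rot w', act w (shift w'))"

lemma wcomp_simps [simp]:
  "ratio (wcomp w w') = ratio w * ratio w'" "rot (wcomp w w') = rot w ** rot w'"
  "shift (wcomp w w') = act w (shift w')"
  by (simp_all add: wcomp_def ratio_def rot_def shift_def)

lemma act_wcomp: "act (wcomp w w') x = act w (act w' x)"
  by (simp add: act_def matrix_vector_mul_assoc[symmetric] matrix_vector_right_distrib
      matrix_vector_mult_scaleR algebra_simps)

lemma wcomp_assoc: "wcomp (wcomp w w') w'' = wcomp w (wcomp w' w'')"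
proof -
  have "act (wcomp w w') (shift w'') = act w (act w' (shift w''))" by (rule act_wcomp)
  then show ?thesis by (simp add: wcomp_def[of "wcomp w w'"] wcomp_def[of w "wcomp w' w''"] matrix_mul_assoc)
qed

lemma inner_act: "act w x \<bullet> e = ratio w * (x \<bullet> (transpose (rot w) *v e)) + shift w \<bullet> e"
proof -
  have "(rot w *v x) \<bullet> e = x \<bullet> (transpose (rot w) *v e)"
    by (metis dot_lmul_matrix inner_commute transpose_matrix_vector)
  then show ?thesis by (simp add: act_def inner_add_left)
qed

locale planar_ifs =
  fixes I :: "'i set"
    and S :: "'i \<Rightarrow> real^2 \<Rightarrow> real^2"
    and c :: "'i \<Rightarrow> real"
    and Q :: "'i \<Rightarrow> real^2^2"
    and t :: "'i \<Rightarrow> real^2"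
    and F :: "(real^2) set"
  assumes ifs: "similarity_ifs I S c Q t"
    and attractor: "is_attractor I S F"
begin

definition gen :: "'i \<Rightarrow> word_map" where "gen i = (c i, Q i, t i)"

text \<open>A new letter is appended on the right and acts first, so the cylinder of
  \<open>wcomp w (gen i)\<close> is a piece of the cylinder of \<open>w\<close>.\<close>

inductive_set W :: "word_map set" where
  id: "(1, mat 1, 0) \<in> W"
| step: "w \<in> W \<Longrightarrow> i \<in> I \<Longrightarrow> wcomp w (gen i) \<in> W"

lemma I: "finite I" "I \<noteq> {}"
  using ifs attractor by (auto simp: similarity_ifs_def is_attractor_def)

lemma F: "compact F" "F \<noteq> {}" "F = (\<Union>i\<in>I. S i ` F)"
  using attractor by (auto simp: is_attractor_def)

lemma c: "i \<in> I \<Longrightarrow> 0 < c i" "i \<in> I \<Longrightarrow> c i < 1"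
  and Q: "i \<in> I \<Longrightarrow> orthogonal_matrix (Q i)"
  using ifs by (auto simp: similarity_ifs_def)

lemma gen_simps [simp]: "ratio (gen i) = c i" "rot (gen i) = Q i" "shift (gen i) = t i"
  by (simp_all add: gen_def ratio_def rot_def shift_def)

lemma act_gen: "i \<in> I \<Longrightarrow> act (gen i) x = S i x"
  using ifs by (simp add: similarity_ifs_def act_def)

lemma ident_simps [simp]: "ratio (1, mat 1, 0) = 1" "rot (1, mat 1, 0) = mat 1"
  "shift (1, mat 1, 0) = 0" "act (1, mat 1, 0) x = x"
  by (simp_all add: ratio_def rot_def shift_def act_def)

lemma wcomp_ident: "wcomp w (1, mat 1, 0) = w"
  by (simp add: wcomp_def act_def) (simp add: ratio_def rot_def shift_def)

lemma W_ratio: "w \<in> W \<Longrightarrow> 0 < ratio w \<and> ratio w \<le> 1"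
proof (induction rule: W.induct)
  case (step w i)
  then show ?case using c[of i] by (auto simp: mult_le_one less_imp_le)
qed simp

lemma W_rot: "w \<in> W \<Longrightarrow> orthogonal_matrix (rot w)"
  by (induction rule: W.induct) (auto simp: orthogonal_matrix_id orthogonal_matrix_mul Q)

lemma act_gen_F: "i \<in> I \<Longrightarrow> x \<in> F \<Longrightarrow> act (gen i) x \<in> F"
  by (subst F(3)) (auto simp: act_gen)

lemma F_decomposition:
  assumes "x \<in> F"
  obtains i z where "i \<in> I" "z \<in> F" "x = act (gen i) z"
proof -
  have "x \<in> (\<Union>i\<in>I. S i ` F)" using assms by (subst (asm) F(3))
  then obtain i z where iz: "i \<in> I" "z \<in> F" "x = S i z" by blast
  show thesis by (rule that[OF iz(1,2)]) (simp add: iz act_gen)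
qed

lemma W_act: "w \<in> W \<Longrightarrow> x \<in> F \<Longrightarrow> act w x \<in> F"
  by (induction arbitrary: x rule: W.induct) (auto simp: act_wcomp act_gen_F)

lemma W_comp: "w' \<in> W \<Longrightarrow> w \<in> W \<Longrightarrow> wcomp w w' \<in> W"
  by (induction rule: W.induct) (auto simp: wcomp_ident wcomp_assoc[symmetric] intro: W.step)

lemma dist_act: "w \<in> W \<Longrightarrow> dist (act w x) (act w y) = ratio w * dist x y"
proof -
  assume w: "w \<in> W"
  have "act w x - act w y = ratio w *\<^sub>R (rot w *v (x - y))"
    by (simp add: act_def matrix_vector_mult_diff_distrib scaleR_diff_right)
  then show ?thesis
    using W_ratio[OF w] W_rot[OF w] by (simp add: dist_norm norm_orthogonal_matrix_mult)
qed

text \<open>Follow letters describing the point until the ratio first drops to \<rho> or below. The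
  last letter multiplies it by at least the smallest ratio of the system, which is \<kappa>.\<close>

lemma cylinder_exists:
  "\<exists>\<kappa>>0. \<forall>x\<in>F. \<forall>\<rho>. 0 < \<rho> \<longrightarrow> \<rho> \<le> 1 \<longrightarrow>
     (\<exists>w\<in>W. \<kappa> * \<rho> \<le> ratio w \<and> ratio w \<le> \<rho> \<and> x \<in> act w ` F)"
proof -
  define \<kappa> where "\<kappa> = Min (c ` I)"
  define C where "C = Max (c ` I)"
  have \<kappa>: "\<kappa> > 0" "\<And>i. i \<in> I \<Longrightarrow> \<kappa> \<le> c i" using I c by (auto simp: \<kappa>_def)
  have C: "C < 1" "\<And>i. i \<in> I \<Longrightarrow> c i \<le> C" using I c by (auto simp: C_def)
  obtain i0 where "i0 \<in> I" using I by blast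
  then have C0: "C > 0" and \<kappa>1: "\<kappa> < 1" using c[of i0] C(2)[of i0] \<kappa>(2)[of i0] by auto
  have "\<exists>w\<in>W. \<kappa> * \<rho> \<le> ratio w \<and> ratio w \<le> \<rho> \<and> x \<in> act w ` F"
    if x: "x \<in> F" and \<rho>: "0 < \<rho>" "\<rho> \<le> 1" for x \<rho>
  proof -
    let ?goal = "\<exists>w\<in>W. \<kappa> * \<rho> \<le> ratio w \<and> ratio w \<le> \<rho> \<and> x \<in> act w ` F"
    \<comment> \<open>Until a suitable word is found, the current ratio lies between \<rho> and
      \<open>C ^ n\<close>; this is impossible once \<open>C ^ n < \<rho>\<close>.\<close>
    have alt: "?goal \<or> (\<exists>w\<in>W. \<rho> \<le> ratio w \<and> ratio w \<le> C ^ n \<and> x \<in> act w ` F)" for n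
    proof (induction n)
      case 0
      show ?case using x \<rho> by (intro disjI2 bexI[OF _ W.id]) auto
    next
      case (Suc n)
      show ?case
      proof (cases ?goal)
        case False
        then obtain w y where w: "w \<in> W" "\<rho> \<le> ratio w" "ratio w \<le> C ^ n" "y \<in> F" "x = act w y"
          using Suc by blast
        obtain i z where i: "i \<in> I" "z \<in> F" "y = act (gen i) z"
          using F_decomposition[OF w(4)] by metis
        let ?v = "wcomp w (gen i)"
        have v: "?v \<in> W" "x \<in> act ?v ` F"
          using w i by (auto simp: act_wcomp intro: W.step)
        have "\<kappa> * \<rho> \<le> ratio ?v"
        proof -
          have "\<rho> * \<kappa> \<le> ratio w * c i"
            using \<kappa> \<rho> w(2) \<kappa>(2)[OF i(1)] by (intro mult_mono) auto
          then show ?thesis by (simp add: mult.commute)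
        qed
        then have "\<not> ratio ?v \<le> \<rho>" using False v by blast
        moreover have "ratio w * c i \<le> C ^ n * C"
          using w(3) C(2)[OF i(1)] c(1)[OF i(1)] C0 by (intro mult_mono) auto
        ultimately show ?thesis using v by (intro disjI2 bexI[of _ ?v]) (auto simp: mult.commute)
      qed simp
    qed
    obtain n where n: "C ^ n < \<rho>" using real_arch_pow_inv[OF \<rho>(1) C(1)] by blast
    have "\<not> (\<exists>w\<in>W. \<rho> \<le> ratio w \<and> ratio w \<le> C ^ n \<and> x \<in> act w ` F)"
      using n by (meson leD le_less_trans)
    then show ?thesis using alt[of n] by blast
  qed
  then show ?thesis using \<kappa>(1) by blast
qed

section \<open>The group generated by the orthogonal parts\<close>

definition G :: "(real^2^2) set" where
  "G = generate orthogonal_group (Q ` I)"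

lemma Q_carrier: "Q ` I \<subseteq> carrier orthogonal_group"
  using Q by (auto simp: orthogonal_group_def)

lemma G_orthogonal: "g \<in> G \<Longrightarrow> orthogonal_matrix g"
  using group.generate_in_carrier[OF group_orthogonal_group Q_carrier]
  unfolding G_def by (simp add: orthogonal_group_def)

lemma inv_orthogonal_group:
  fixes A :: "real^'n^'n"
  assumes "orthogonal_matrix A"
  shows "inv\<^bsub>orthogonal_group\<^esub> A = transpose A"
  using assms by (intro group.inv_equality[OF group_orthogonal_group])
    (auto simp: orthogonal_group_def orthogonal_matrix_def)

lemma G_transpose: "g \<in> G \<Longrightarrow> transpose g \<in> G"
  using group.generate_m_inv_closed[OF group_orthogonal_group Q_carrier, of g]
    inv_orthogonal_group[OF G_orthogonal, of g] by (simp add: G_def)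

lemma G_mult: "g \<in> G \<Longrightarrow> h \<in> G \<Longrightarrow> g ** h \<in> G"
  using generate.eng[of g orthogonal_group "Q ` I" h] by (simp add: G_def orthogonal_group_def)

lemma W_rot_G: "w \<in> W \<Longrightarrow> rot w \<in> G"
proof (induction rule: W.induct)
  case id
  have "\<one>\<^bsub>orthogonal_group\<^esub> \<in> G" unfolding G_def by (rule generate.one)
  then show ?case by (simp add: orthogonal_group_def)
next
  case (step w i)
  then have "Q i \<in> G" unfolding G_def by (intro generate.incl) auto
  then show ?case using step G_mult by simp
qed

text \<open>Words provide products but no inverses. Two powers of \<open>Q i\<close> nearly agree by
  compactness, so some positive power is close to the identity, and the power with one factor fewer
  is close to the inverse.\<close>

lemma W_near_inverse_generator:
  assumes i: "i \<in> I" and \<tau>: "\<tau> > 0"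
  shows "\<exists>w\<in>W. near \<tau> (rot w) (transpose (Q i))"
proof -
  define p where "p n = ((\<lambda>w. wcomp w (gen i)) ^^ n) (1, mat 1, 0)" for n
  have pW: "p n \<in> W" for n by (induction n) (auto simp: p_def i intro: W.intros)
  have p0: "rot (p 0) = mat 1" and pS: "rot (p (Suc n)) = rot (p n) ** Q i" for n
    by (simp_all add: p_def)
  have add: "rot (p (m + n)) = rot (p m) ** rot (p n)" for m n
    by (induction n) (simp_all add: p0 pS matrix_mul_assoc)
  have orth: "orthogonal_matrix (rot (p n))" for n using W_rot[OF pW] .
  obtain m n where mn: "m < n" "near \<tau> (rot (p m)) (rot (p n))"
    using orthogonal_matrices_near_pair[of "\<lambda>n. rot (p n)" \<tau>] orth \<tau> by blast
  then obtain l where l: "n = m + Suc l" using less_imp_Suc_add by force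
  have "near \<tau> (transpose (rot (p m)) ** rot (p m)) (transpose (rot (p m)) ** rot (p n))"
    using near_mult_left[OF _ mn(2), of "transpose (rot (p m))"] orth by simp
  moreover have tm: "transpose (rot (p m)) ** rot (p m) = mat 1"
    using orth by (simp add: orthogonal_matrix)
  moreover have "transpose (rot (p m)) ** rot (p n) = rot (p l) ** Q i"
    using tm by (simp only: l add matrix_mul_assoc matrix_mul_lid pS)
  ultimately have "near \<tau> (mat 1) (rot (p l) ** Q i)" by simp
  from near_mult_right[OF _ this, of "transpose (Q i)"]
  have "near \<tau> (transpose (Q i)) (rot (p l) ** (Q i ** transpose (Q i)))"
    using Q[OF i] by (simp add: matrix_mul_assoc)
  moreover have "Q i ** transpose (Q i) = mat 1" using Q[OF i] by (simp add: orthogonal_matrix_def)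
  ultimately have "near \<tau> (rot (p l)) (transpose (Q i))" using near_commute by auto
  then show ?thesis using pW by blast
qed

text \<open>Induction over the generated group: inverses of generators were just treated, and in a
  product each factor receives half of \<tau>, since orthogonal factors do not enlarge
  errors.\<close>

lemma W_near_G:
  assumes "g \<in> G" "\<tau> > 0"
  shows "\<exists>w\<in>W. near \<tau> (rot w) g"
proof -
  have "g \<in> generate orthogonal_group (Q ` I)" using assms(1) by (simp add: G_def)
  then show ?thesis using assms(2)
  proof (induction arbitrary: \<tau> rule: generate.induct)
    case one
    then show ?case
      by (intro bexI[OF _ W.id]) (auto simp: orthogonal_group_def near_def)
  next
    case (incl h)
    then obtain i where "i \<in> I" "h = Q i" by blast
    then show ?case
      using incl.prems W.step[OF W.id, of i]
      by (intro bexI[of _ "wcomp (1, mat 1, 0) (gen i)"]) (auto simp: near_def)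
  next
    case (inv h)
    then obtain i where i: "i \<in> I" "h = Q i" by blast
    then show ?case
      using W_near_inverse_generator[OF i(1) inv.prems] inv_orthogonal_group[OF Q[OF i(1)]] by simp
  next
    case (eng h1 h2)
    have "\<tau> / 2 > 0" using eng.prems by simp
    then obtain w1 w2 where w: "w1 \<in> W" "near (\<tau>/2) (rot w1) h1" "w2 \<in> W" "near (\<tau>/2) (rot w2) h2"
      using eng.IH by blast
    have h2: "orthogonal_matrix h2"
      using eng.hyps G_orthogonal by (simp add: G_def)
    have "near (\<tau>/2) (rot w1 ** rot w2) (rot w1 ** h2)"
      using near_mult_left[OF W_rot] w by blast
    moreover have "near (\<tau>/2) (rot w1 ** h2) (h1 ** h2)"
      using near_mult_right[OF h2] w by blast
    ultimately have "near (\<tau>/2 + \<tau>/2) (rot w1 ** rot w2) (h1 ** h2)"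
      by (rule near_trans)
    then show ?case
      using W_comp[OF w(3,1)] by (intro bexI[of _ "wcomp w1 w2"]) (auto simp: orthogonal_group_def)
  qed
qed

text \<open>Isolation of the identity is transported to every pair by left multiplication with
  \<open>transpose g\<close>, so one \<tau> serves the whole group.\<close>

lemma discrete_G_near_imp_eq:
  assumes "discrete G"
  obtains \<tau> where "\<tau> > 0" "\<And>g h. g \<in> G \<Longrightarrow> h \<in> G \<Longrightarrow> near \<tau> g h \<Longrightarrow> g = h"
proof -
  have one: "mat 1 \<in> G" using W_rot_G[OF W.id] by simp
  then obtain e where e: "e > 0" "\<And>y. y \<in> G \<Longrightarrow> dist (mat 1) y < e \<Longrightarrow> y = mat 1"
    using discreteD[OF assms one] unfolding isolated_in_dist_Ex_iff by blast
  \<comment> \<open>Passing from \<open>near\<close> to \<open>dist\<close> costs a factor 4, the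
    number of entries, which leaves \<open>e / 2 < e\<close>.\<close>
  show thesis
  proof (rule that[of "e/8"])
    fix g h assume *: "g \<in> G" "h \<in> G" "near (e/8) g h"
    have orth: "orthogonal_matrix g" "orthogonal_matrix (transpose g)"
      using * G_orthogonal G_transpose by auto
    have g1: "transpose g ** g = mat 1" "g ** transpose g = mat 1"
      using orth by (auto simp: orthogonal_matrix_def)
    have "near (e/8) (transpose g ** g) (transpose g ** h)"
      by (rule near_mult_left[OF orth(2) *(3)])
    from dist_le_if_near[OF this] have "dist (mat 1) (transpose g ** h) < e" using e g1 by simp
    then have "transpose g ** h = mat 1" using e * G_mult G_transpose by blast
    then have "g ** (transpose g ** h) = g" by simp
    then show "g = h" using g1 by (simp add: matrix_mul_assoc)
  qed (use e in simp)
qed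

lemma discrete_G_finite:
  assumes "discrete G"
  shows "finite G"
proof (rule ccontr)
  assume "infinite G"
  then obtain f :: "nat \<Rightarrow> real^2^2" where f: "inj f" "range f \<subseteq> G"
    using infinite_countable_subset by blast
  obtain \<tau> where \<tau>: "\<tau> > 0" "\<And>g h. g \<in> G \<Longrightarrow> h \<in> G \<Longrightarrow> near \<tau> g h \<Longrightarrow> g = h"
    using discrete_G_near_imp_eq[OF assms] by blast
  obtain m n where "m < n" "near \<tau> (f m) (f n)"
    using orthogonal_matrices_near_pair[of f \<tau>] f G_orthogonal \<tau>(1) by blast
  then have "f m = f n" using \<tau>(2) f by blast
  then show False using f(1) \<open>m < n\<close> by (auto simp: inj_def)
qed

text \<open>An approximation finer than the separation of the group is exact.\<close>

lemma discrete_G_word: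
  assumes "discrete G" "g \<in> G"
  shows "\<exists>w\<in>W. rot w = g"
  using discrete_G_near_imp_eq[OF assms(1)] W_near_G[OF assms(2)] W_rot_G assms(2) by metis

text \<open>Applied to the inverse of an orthogonal part, this undoes a rotation at bounded cost;
  finiteness of the group makes the bounds uniform.\<close>

lemma discrete_G_return_words:
  assumes "discrete G"
  obtains \<kappa> T where "\<kappa> > 0" "\<kappa> \<le> 1" "T \<ge> 0"
    "\<And>g. g \<in> G \<Longrightarrow> \<exists>w\<in>W. rot w = g \<and> \<kappa> \<le> ratio w \<and> norm (shift w) \<le> T"
proof -
  obtain v where v: "\<And>g. g \<in> G \<Longrightarrow> v g \<in> W \<and> rot (v g) = g"
    using discrete_G_word[OF assms] by metis
  have fin: "finite G" by (rule discrete_G_finite[OF assms])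
  define \<kappa> where "\<kappa> = Min (insert 1 ((\<lambda>g. ratio (v g)) ` G))"
  define T where "T = Max (insert 0 ((\<lambda>g. norm (shift (v g))) ` G))"
  show thesis
  proof (rule that[of \<kappa> T])
    show "\<kappa> > 0" "\<kappa> \<le> 1" "T \<ge> 0" using fin v W_ratio by (auto simp: \<kappa>_def T_def)
    fix g assume g: "g \<in> G"
    have "\<kappa> \<le> ratio (v g)" unfolding \<kappa>_def using fin g by (intro Min_le) auto
    moreover have "norm (shift (v g)) \<le> T" unfolding T_def using fin g by (intro Max_ge) auto
    ultimately show "\<exists>w\<in>W. rot w = g \<and> \<kappa> \<le> ratio w \<and> norm (shift w) \<le> T" using v[OF g] by blast
  qed
qed

section \<open>Discrete orthogonal parts\<close>

definition Pr :: "real^2 \<Rightarrow> real set" where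
  "Pr e = (\<lambda>x. x \<bullet> e) ` F"

lemma compact_Pr: "compact (Pr e)" and Pr_nonempty: "Pr e \<noteq> {}"
  using F(1,2) unfolding Pr_def by (auto intro!: compact_continuous_image continuous_intros)

text \<open>The direction seen by the cylinder \<open>act w F\<close> under the projection to \<open>e\<close>.\<close>

definition dir :: "word_map \<Rightarrow> real^2 \<Rightarrow> real^2" where
  "dir w e = transpose (rot w) *v e"

lemma inner_act_dir: "act w x \<bullet> e = ratio w * (x \<bullet> dir w e) + shift w \<bullet> e"
  by (simp only: inner_act dir_def)

lemma dir_wcomp: "dir (wcomp w w') e = dir w' (dir w e)"
  unfolding dir_def wcomp_simps matrix_transpose_mul by (rule matrix_vector_mul_assoc[symmetric])

lemma norm_dir: "w \<in> W \<Longrightarrow> norm (dir w e) = norm e"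
  unfolding dir_def using W_rot[of w] by (intro norm_orthogonal_matrix_mult) simp

lemma dir_ident: "rot w = mat 1 \<Longrightarrow> dir w e = e"
  by (simp add: dir_def)

lemma word_embedding:
  assumes "w \<in> W" "rot w = mat 1"
  shows "(ratio w, shift w \<bullet> e) \<in> embeddings (Pr e)"
    and "homothety (ratio w, shift w \<bullet> e) (x \<bullet> e) = act w x \<bullet> e"
proof -
  show eq: "homothety (ratio w, shift w \<bullet> e) (x \<bullet> e) = act w x \<bullet> e" for x
    by (simp add: homothety_def inner_act_dir dir_ident assms(2))
  show "(ratio w, shift w \<bullet> e) \<in> embeddings (Pr e)"
    using W_ratio[OF assms(1)] W_act[OF assms(1)] unfolding embeddings_def Pr_def by (auto simp: eq)
qed

lemma F_bound: obtains L where "L > 0" "\<And>x. x \<in> F \<Longrightarrow> norm x \<le> L"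
  using compact_imp_bounded[OF F(1)] unfolding bounded_pos by blast

text \<open>A cylinder of size about \<rho> through the point need not project to a homothetic copy.
  Appending a return word makes its rotation trivial, and appending only shrinks the cylinder, so
  the copy stays in the ball.\<close>

lemma discrete_G_self_embeddable:
  assumes G: "discrete G" and e: "norm e = 1"
  shows "\<exists>a. self_embeddable a (Pr e)"
proof -
  obtain L where L: "L > 0" "\<And>x. x \<in> F \<Longrightarrow> norm x \<le> L" using F_bound by blast
  obtain \<kappa> where \<kappa>: "\<kappa> > 0" "\<And>x \<rho>. x \<in> F \<Longrightarrow> 0 < \<rho> \<Longrightarrow> \<rho> \<le> 1 \<Longrightarrow>
      \<exists>w\<in>W. \<kappa> * \<rho> \<le> ratio w \<and> ratio w \<le> \<rho> \<and> x \<in> act w ` F"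
    using cylinder_exists by blast
  obtain \<kappa>' T where \<kappa>': "\<kappa>' > 0" "\<kappa>' \<le> 1" "\<And>g. g \<in> G \<Longrightarrow> \<exists>w\<in>W. rot w = g \<and> \<kappa>' \<le> ratio w \<and> norm (shift w) \<le> T"
    using discrete_G_return_words[OF G] by metis
  \<comment> \<open>\<open>2 * L\<close> bounds the diameter of \<open>F\<close>; the extra 1 puts
    the copy inside the open ball.\<close>
  define D where "D = 2 * L + 1"
  have D: "D > 1" using L(1) by (simp add: D_def)
  have "self_embeddable (\<kappa> * \<kappa>' / D) (Pr e)"
    unfolding self_embeddable_def
  proof (intro conjI ballI allI impI)
    show "\<kappa> * \<kappa>' / D > 0" using \<kappa> \<kappa>' D by simp
    fix p \<rho> assume p: "p \<in> Pr e" and \<rho>: "0 < \<rho>" "\<rho> \<le> (1::real)"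
    then obtain x where x: "x \<in> F" "p = x \<bullet> e" by (auto simp: Pr_def)
    have "0 < \<rho> / D" "\<rho> / D \<le> 1" using \<rho> D by (auto simp: field_simps)
    from \<kappa>(2)[OF x(1) this] obtain w where w: "w \<in> W" "\<kappa> * (\<rho> / D) \<le> ratio w" "ratio w \<le> \<rho> / D" "x \<in> act w ` F"
      by blast
    obtain v where v: "v \<in> W" "rot v = transpose (rot w)" "\<kappa>' \<le> ratio v"
      using \<kappa>'(3)[OF G_transpose[OF W_rot_G[OF w(1)]]] by blast
    let ?u = "wcomp w v"
    have u: "?u \<in> W" "rot ?u = mat 1"
      using W_comp[OF v(1) w(1)] v(2) W_rot[OF w(1)] by (auto simp: orthogonal_matrix_def)
    let ?\<phi> = "(ratio ?u, shift ?u \<bullet> e)"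
    have rv: "ratio v \<le> 1" "0 < ratio v" "0 < ratio w" using W_ratio v(1) w(1) by auto
    show "\<exists>\<phi>\<in>embeddings (Pr e). \<kappa> * \<kappa>' / D * \<rho> \<le> fst \<phi> \<and> fst \<phi> \<le> \<rho> \<and> homothety \<phi> ` Pr e \<subseteq> ball p \<rho>"
    proof (intro bexI[of _ ?\<phi>] conjI)
      show "?\<phi> \<in> embeddings (Pr e)" by (rule word_embedding[OF u])
      have "\<kappa> * (\<rho> / D) * \<kappa>' \<le> ratio w * ratio v"
        using w(2) v(3) rv \<kappa>' by (intro mult_mono) auto
      then show "\<kappa> * \<kappa>' / D * \<rho> \<le> fst ?\<phi>" by (simp add: mult_ac)
      have "ratio w * ratio v \<le> \<rho> / D * 1" using w(3) rv \<rho> D by (intro mult_mono) auto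
      also have "\<dots> \<le> \<rho>" using \<rho> D by (simp add: field_simps)
      finally show "fst ?\<phi> \<le> \<rho>" by simp
      show "homothety ?\<phi> ` Pr e \<subseteq> ball p \<rho>"
      proof (rule image_subsetI)
        fix q assume "q \<in> Pr e"
        then obtain y where y: "y \<in> F" "q = y \<bullet> e" by (auto simp: Pr_def)
        obtain z where z: "z \<in> F" "x = act w z" using w(4) by blast
        have "homothety ?\<phi> q = act w (act v y) \<bullet> e"
          using word_embedding(2)[OF u] y by (simp add: act_wcomp)
        then have "dist p (homothety ?\<phi> q) = \<bar>(act w z - act w (act v y)) \<bullet> e\<bar>"
          by (simp add: dist_real_def x z inner_diff_left)
        also have "\<dots> \<le> norm (act w z - act w (act v y)) * norm e" by (rule Cauchy_Schwarz_ineq2)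
        also have "\<dots> = ratio w * dist z (act v y)"
          using dist_act[OF w(1)] e by (simp add: dist_norm)
        also have "\<dots> \<le> ratio w * (2 * L)"
        proof -
          have "dist z (act v y) \<le> norm z + norm (act v y)" by (simp add: dist_norm norm_triangle_ineq4)
          then show ?thesis
            using L(2)[OF z(1)] L(2)[OF W_act[OF v(1) y(1)]] rv by (intro mult_left_mono) auto
        qed
        also have "\<dots> < ratio w * D" using rv by (simp add: D_def)
        also have "\<dots> \<le> \<rho>" using w(3) D by (simp add: field_simps)
        finally show "homothety ?\<phi> q \<in> ball p \<rho>" by simp
      qed
    qed
  qed
  then show ?thesis by blast
qed

text \<open>Cylinders of size about \<open>r\<close> whose projections meet the ball are sorted into
  grid cells of mesh \<open>\<delta> * r\<close>. Two in one cell with the same rotation, composed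
  with \<open>w0\<close> on the left and a return word on the right, become embeddings of
  \<open>Pr e\<close> so close that they must be equal. So each cell holds at most one projected
  map, and the number of cells is independent of \<open>w0\<close>, \<open>u\<close> and
  \<open>r\<close>.\<close>

lemma ball_cylinder_cover:
  assumes G: "discrete G" and e: "norm e = 1" and nc: "\<not> nearly_coincident (Pr e)"
  shows "\<exists>N. \<forall>w0\<in>W. \<forall>u r. 0 < r \<longrightarrow> r \<le> 1 \<longrightarrow> (\<exists>H. finite H \<and> H \<subseteq> W \<and> card H \<le> N \<and>
     (\<forall>w\<in>H. ratio w \<le> r) \<and> Pr (dir w0 e) \<inter> ball u r \<subseteq> (\<Union>w\<in>H. (\<lambda>x. act w x \<bullet> dir w0 e) ` F))"
proof -
  obtain L where L: "L > 0" "\<And>x. x \<in> F \<Longrightarrow> norm x \<le> L" using F_bound by blast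
  obtain \<kappa> where \<kappa>: "\<kappa> > 0" "\<And>x \<rho>. x \<in> F \<Longrightarrow> 0 < \<rho> \<Longrightarrow> \<rho> \<le> 1 \<Longrightarrow>
      \<exists>w\<in>W. \<kappa> * \<rho> \<le> ratio w \<and> ratio w \<le> \<rho> \<and> x \<in> act w ` F"
    using cylinder_exists by blast
  obtain \<kappa>' T where \<kappa>': "\<kappa>' > 0" "\<kappa>' \<le> 1" "T \<ge> 0"
      "\<And>g. g \<in> G \<Longrightarrow> \<exists>w\<in>W. rot w = g \<and> \<kappa>' \<le> ratio w \<and> norm (shift w) \<le> T"
    using discrete_G_return_words[OF G] by metis
  obtain \<epsilon> where \<epsilon>: "\<epsilon> > 0" "\<And>\<phi> \<psi>. \<lbrakk>\<phi> \<in> embeddings (Pr e); \<psi> \<in> embeddings (Pr e);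
      \<bar>fst \<psi> - fst \<phi>\<bar> \<le> \<epsilon> * fst \<phi>; \<bar>snd \<psi> - snd \<phi>\<bar> \<le> \<epsilon> * fst \<phi>\<rbrakk> \<Longrightarrow> \<phi> = \<psi>"
    using nc unfolding nearly_coincident_def by blast
  \<comment> \<open>The mesh error \<open>\<delta> * r\<close> grows to at most
    \<open>\<delta> * r * (1 + T)\<close> through the translation of the return word; it must not
    exceed \<epsilon> times a ratio that is at least \<open>\<kappa> * r * \<kappa>'\<close>. The
    common factor \<open>ratio w0\<close> cancels.\<close>
  define \<delta> where "\<delta> = \<epsilon> * \<kappa> * \<kappa>' / (1 + T)"
  have \<delta>: "\<delta> > 0" using \<epsilon> \<kappa> \<kappa>' by (simp add: \<delta>_def)
  have finG: "finite G" by (rule discrete_G_finite[OF G])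
  \<comment> \<open>The range of cell indices: ratios are at most \<open>r\<close>, and the
    translation coordinates lie within \<open>r + r * L\<close> of \<open>u\<close>.\<close>
  define m where "m = \<lfloor>1 / \<delta>\<rfloor>"
  define n where "n = \<lfloor>(1 + L) / \<delta>\<rfloor> + 1"
  define Box where "Box = G \<times> {0..m} \<times> {-n..n}"
  have finBox: "finite Box" using finG by (simp add: Box_def)
  show ?thesis
  proof (intro exI[of _ "card Box"] ballI allI impI)
    fix w0 u r assume w0: "w0 \<in> W" and r: "0 < r" "r \<le> (1::real)"
    define v where "v = dir w0 e"
    have nv: "norm v = 1" using norm_dir[OF w0] e by (simp add: v_def)
    define H' where "H' = {w\<in>W. \<kappa> * r \<le> ratio w \<and> ratio w \<le> r \<and> (\<exists>y\<in>F. act w y \<bullet> v \<in> ball u r)}"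
    \<comment> \<open>Everything that the projection to \<open>v\<close> sees of a word: words with
      equal keys have equal projected maps.\<close>
    define key where "key w = (rot w, ratio w, shift w \<bullet> v)" for w
    define grid where "grid p = (fst p, \<lfloor>fst (snd p) / (\<delta> * r)\<rfloor>, \<lfloor>(snd (snd p) - u) / (\<delta> * r)\<rfloor>)"
      for p :: "(real^2^2) \<times> real \<times> real"
    have coincide: "key w1 = key w2"
      if w: "w1 \<in> H'" "w2 \<in> H'" and eq: "grid (key w1) = grid (key w2)" for w1 w2
    proof -
      have W12: "w1 \<in> W" "w2 \<in> W" "\<kappa> * r \<le> ratio w1" using w by (auto simp: H'_def)
      have rot: "rot w1 = rot w2" using eq by (simp add: grid_def key_def)
      have fl: "\<lfloor>ratio w1 / (\<delta> * r)\<rfloor> = \<lfloor>ratio w2 / (\<delta> * r)\<rfloor>"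
        "\<lfloor>(shift w1 \<bullet> v - u) / (\<delta> * r)\<rfloor> = \<lfloor>(shift w2 \<bullet> v - u) / (\<delta> * r)\<rfloor>"
        using eq by (simp_all add: grid_def key_def)
      have \<delta>r: "\<delta> * r > 0" using \<delta> r by simp
      have close: "\<bar>a - b\<bar> \<le> \<delta> * r" if "\<lfloor>a / (\<delta> * r)\<rfloor> = \<lfloor>b / (\<delta> * r)\<rfloor>" for a b
      proof -
        have "\<bar>a / (\<delta> * r) - b / (\<delta> * r)\<bar> < 1" using that by linarith
        then have "\<bar>a - b\<bar> / (\<delta> * r) < 1" using \<delta>r by (simp add: abs_divide flip: diff_divide_distrib)
        then show ?thesis using \<delta>r by (simp add: divide_simps)
      qed
      have d1: "\<bar>ratio w2 - ratio w1\<bar> \<le> \<delta> * r" using close[OF fl(1)[symmetric]] .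
      have d2: "\<bar>shift w2 \<bullet> v - shift w1 \<bullet> v\<bar> \<le> \<delta> * r" using close[OF fl(2)[symmetric]] by simp
      \<comment> \<open>The rotations of \<open>w1\<close> and \<open>w2\<close> agree, so one
        return word straightens both composed words.\<close>
      obtain z where z: "z \<in> W" "rot z = transpose (rot w0 ** rot w1)" "\<kappa>' \<le> ratio z" "norm (shift z) \<le> T"
        using \<kappa>'(4)[of "transpose (rot w0 ** rot w1)"] G_transpose G_mult W_rot_G w0 W12 by metis
      define p where "p w = wcomp w0 (wcomp w z)" for w
      have orth: "orthogonal_matrix (rot w0 ** rot w1)"
        using W_rot w0 W12 by (simp add: orthogonal_matrix_mul)
      have pW: "p w1 \<in> W" "p w2 \<in> W" using W_comp w0 W12 z(1) by (auto simp: p_def)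
      have prot: "rot (p w1) = mat 1" "rot (p w2) = mat 1"
        using orth z(2) rot by (simp_all add: p_def matrix_mul_assoc orthogonal_matrix_def)
      have k: "ratio w0 > 0" "ratio w1 > 0" "ratio z > 0" using W_ratio w0 W12 z by auto
      have rp: "ratio (p w) = ratio w0 * (ratio w * ratio z)" for w by (simp add: p_def)
      have sp: "shift (p w) \<bullet> e = ratio w0 * (ratio w * (shift z \<bullet> dir w v) + shift w \<bullet> v) + shift w0 \<bullet> e" for w
        by (simp add: p_def inner_act_dir v_def)
      have dirw: "dir w2 v = dir w1 v" using rot by (simp add: dir_def)
      have key1: "\<delta> * r * (1 + T) \<le> \<epsilon> * (ratio w1 * ratio z)"
      proof -
        have "\<delta> * r * (1 + T) = \<epsilon> * (\<kappa> * r * \<kappa>')" using \<kappa>'(3) by (simp add: \<delta>_def)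
        also have "\<dots> \<le> \<epsilon> * (ratio w1 * ratio z)"
          using W12(3) z(3) \<epsilon>(1) \<kappa>(1) \<kappa>'(1) r k by (intro mult_left_mono mult_mono) auto
        finally show ?thesis .
      qed
      have sz: "\<bar>shift z \<bullet> dir w1 v\<bar> \<le> T"
        using Cauchy_Schwarz_ineq2[of "shift z" "dir w1 v"] z(4) norm_dir[OF W12(1), of v] nv by simp
      have "\<bar>ratio (p w2) - ratio (p w1)\<bar> = ratio w0 * (\<bar>ratio w2 - ratio w1\<bar> * ratio z)"
        using k by (simp add: rp abs_mult flip: right_diff_distrib left_diff_distrib)
      also have "\<dots> \<le> ratio w0 * (\<delta> * r * (1 + T))"
      proof (intro mult_left_mono)
        have "\<bar>ratio w2 - ratio w1\<bar> * ratio z \<le> \<delta> * r * 1"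
          using d1 W_ratio[OF z(1)] \<delta>r by (intro mult_mono) auto
        also have "\<dots> \<le> \<delta> * r * (1 + T)" using \<delta>r \<kappa>'(3) by (intro mult_left_mono) auto
        finally show "\<bar>ratio w2 - ratio w1\<bar> * ratio z \<le> \<delta> * r * (1 + T)" .
      qed (use k in simp)
      also have "\<dots> \<le> ratio w0 * (\<epsilon> * (ratio w1 * ratio z))" using key1 k by (intro mult_left_mono) auto
      finally have e1: "\<bar>ratio (p w2) - ratio (p w1)\<bar> \<le> \<epsilon> * ratio (p w1)" by (simp add: rp mult_ac)
      have "shift (p w2) \<bullet> e - shift (p w1) \<bullet> e
          = ratio w0 * ((ratio w2 - ratio w1) * (shift z \<bullet> dir w1 v) + (shift w2 \<bullet> v - shift w1 \<bullet> v))"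
        by (simp add: sp dirw algebra_simps)
      also have "\<bar>\<dots>\<bar> \<le> ratio w0 * (\<delta> * r * (1 + T))"
      proof -
        have "\<bar>(ratio w2 - ratio w1) * (shift z \<bullet> dir w1 v)\<bar> \<le> \<delta> * r * T"
          unfolding abs_mult using d1 sz \<delta>r by (intro mult_mono) auto
        then have "\<bar>(ratio w2 - ratio w1) * (shift z \<bullet> dir w1 v) + (shift w2 \<bullet> v - shift w1 \<bullet> v)\<bar> \<le> \<delta> * r * T + \<delta> * r"
          using d2 by linarith
        also have "\<dots> = \<delta> * r * (1 + T)" by (simp add: distrib_left)
        finally show ?thesis using k by (simp add: abs_mult)
      qed
      also have "\<dots> \<le> ratio w0 * (\<epsilon> * (ratio w1 * ratio z))" using key1 k by (intro mult_left_mono) auto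
      finally have e2: "\<bar>shift (p w2) \<bullet> e - shift (p w1) \<bullet> e\<bar> \<le> \<epsilon> * ratio (p w1)" by (simp add: rp mult_ac)
      have "(ratio (p w1), shift (p w1) \<bullet> e) = (ratio (p w2), shift (p w2) \<bullet> e)"
        using e1 e2 by (intro \<epsilon>(2) word_embedding pW prot) auto
      then have "ratio w1 = ratio w2" "shift (p w1) \<bullet> e = shift (p w2) \<bullet> e" using k by (auto simp: rp)
      then have "shift w1 \<bullet> v = shift w2 \<bullet> v" using k by (simp add: sp dirw)
      then show ?thesis using rot \<open>ratio w1 = ratio w2\<close> by (simp add: key_def)
    qed
    have inj: "inj_on grid (key ` H')"
    proof (rule inj_onI)
      fix p q assume "p \<in> key ` H'" "q \<in> key ` H'" "grid p = grid q"
      then show "p = q" using coincide by blast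
    qed
    have box: "grid ` (key ` H') \<subseteq> Box"
    proof clarsimp
      fix w assume "w \<in> H'"
      then have w: "w \<in> W" "0 < ratio w" "ratio w \<le> r" and ex: "\<exists>y\<in>F. act w y \<bullet> v \<in> ball u r"
        using W_ratio by (auto simp: H'_def)
      obtain y where y: "y \<in> F" "\<bar>act w y \<bullet> v - u\<bar> < r"
        using ex by (auto simp: dist_real_def abs_minus_commute)
      have \<delta>r: "\<delta> * r > 0" using \<delta> r by simp
      have "\<bar>y \<bullet> dir w v\<bar> \<le> L"
        using Cauchy_Schwarz_ineq2[of y "dir w v"] L(2)[OF y(1)] norm_dir[OF w(1), of v] nv by simp
      then have "\<bar>ratio w * (y \<bullet> dir w v)\<bar> \<le> r * L"
        unfolding abs_mult using w r by (intro mult_mono) auto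
      then have "\<bar>shift w \<bullet> v - u\<bar> \<le> r + r * L" using y(2) unfolding inner_act_dir by linarith
      then have "\<bar>(shift w \<bullet> v - u) / (\<delta> * r)\<bar> \<le> (r + r * L) / (\<delta> * r)"
        using \<delta>r by (simp add: abs_divide divide_right_mono)
      also have "\<dots> = (1 + L) / \<delta>" using r \<delta> by (simp add: field_simps)
      finally have b: "\<bar>(shift w \<bullet> v - u) / (\<delta> * r)\<bar> \<le> (1 + L) / \<delta>" .
      have "ratio w / (\<delta> * r) \<le> r / (\<delta> * r)" using w \<delta>r by (intro divide_right_mono) auto
      also have "\<dots> = 1 / \<delta>" using r by simp
      finally have a: "ratio w / (\<delta> * r) \<le> 1 / \<delta>" "0 \<le> ratio w / (\<delta> * r)" using w \<delta>r by auto
      have "\<lfloor>ratio w / (\<delta> * r)\<rfloor> \<in> {0..m}" using a unfolding m_def by (auto intro: floor_mono)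
      moreover have "\<lfloor>(shift w \<bullet> v - u) / (\<delta> * r)\<rfloor> \<in> {-n..n}"
        using b unfolding n_def atLeastAtMost_iff by linarith
      ultimately show "grid (key w) \<in> Box" using W_rot_G[OF w(1)] by (simp add: grid_def key_def Box_def)
    qed
    have finK: "finite (key ` H')" using finite_imageD[OF finite_subset[OF box finBox] inj] .
    have cardK: "card (key ` H') \<le> card Box" using card_inj_on_le[OF inj box finBox] .
    \<comment> \<open>One representative per key, since the bound counts keys and several words of
      \<open>H'\<close> may share one.\<close>
    obtain H where H: "H \<subseteq> H'" "inj_on key H" "key ` H' = key ` H"
      using iffD1[OF subset_image_inj, OF order_refl[of "key ` H'"]] by blast
    have finH: "finite H" using finK unfolding H(3) by (rule finite_imageD[OF _ H(2)])
    show "\<exists>H. finite H \<and> H \<subseteq> W \<and> card H \<le> card Box \<and> (\<forall>w\<in>H. ratio w \<le> r) \<and>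
       Pr (dir w0 e) \<inter> ball u r \<subseteq> (\<Union>w\<in>H. (\<lambda>x. act w x \<bullet> dir w0 e) ` F)"
    proof (intro exI[of _ H] conjI)
      show "card H \<le> card Box" using cardK H card_image[OF H(2)] by simp
      show "H \<subseteq> W" "\<forall>w\<in>H. ratio w \<le> r" using H(1) by (auto simp: H'_def)
      show "Pr (dir w0 e) \<inter> ball u r \<subseteq> (\<Union>w\<in>H. (\<lambda>x. act w x \<bullet> dir w0 e) ` F)"
      proof
        fix p assume "p \<in> Pr (dir w0 e) \<inter> ball u r"
        then obtain x where x: "x \<in> F" "p = x \<bullet> v" "p \<in> ball u r" by (auto simp: Pr_def v_def)
        obtain w y where w: "w \<in> W" "\<kappa> * r \<le> ratio w" "ratio w \<le> r" "y \<in> F" "x = act w y"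
          using \<kappa>(2)[OF x(1) r] by blast
        then have "w \<in> H'" using x by (auto simp: H'_def)
        then have "key w \<in> key ` H" unfolding H(3)[symmetric] by (rule imageI)
        then obtain w' where w': "w' \<in> H" "key w' = key w" by (elim imageE) simp
        have "act w' y \<bullet> v = act w y \<bullet> v"
          using w'(2) by (simp add: key_def inner_act_dir dir_def)
        then have "p = act w' y \<bullet> v" using x w by simp
        then show "p \<in> (\<Union>w\<in>H. (\<lambda>x. act w x \<bullet> dir w0 e) ` F)" using w'(1) w(4) by (auto simp: v_def)
      qed
    qed (rule finH)
  qed
qed

text \<open>The image of \<open>F\<close> under \<open>act w\<close> is part of \<open>F\<close> and
  projects to a scaled and shifted copy of \<open>Pr (dir w e)\<close>; undoing scale and shift is
  Lipschitz.\<close>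

lemma ball_null_dir:
  assumes "ball_null s (Pr e)" "w \<in> W"
  shows "ball_null s (Pr (dir w e))"
proof -
  have k: "ratio w > 0" using W_ratio[OF assms(2)] by simp
  define f where "f p = (p - shift w \<bullet> e) / ratio w" for p
  have "ball_null s (f ` Pr e)"
  proof (rule ball_null_lipschitz[OF assms(1), of "1 / ratio w"])
    show "dist (f p) (f q) \<le> 1 / ratio w * dist p q" for p q
    proof -
      have "f p - f q = (p - q) / ratio w" by (simp add: f_def flip: diff_divide_distrib)
      then show ?thesis using k by (simp add: dist_real_def abs_divide)
    qed
  qed (use k in simp)
  moreover have "Pr (dir w e) \<subseteq> f ` Pr e"
  proof
    fix p assume "p \<in> Pr (dir w e)"
    then obtain x where x: "x \<in> F" "p = x \<bullet> dir w e" by (auto simp: Pr_def)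
    then have "p = f (act w x \<bullet> e)" using k by (simp add: f_def inner_act_dir)
    moreover have "act w x \<bullet> e \<in> Pr e" using W_act[OF assms(2) x(1)] by (simp add: Pr_def)
    ultimately show "p \<in> f ` Pr e" by blast
  qed
  ultimately show ?thesis
    unfolding ball_null_def using ball_covered_mono by blast
qed

section \<open>Covers by projected cylinders and their iteration\<close>

definition cylinder_cover :: "real \<Rightarrow> real \<Rightarrow> real^2 \<Rightarrow> word_map set \<Rightarrow> bool" where
  "cylinder_cover s \<eta> v H \<longleftrightarrow> finite H \<and> H \<subseteq> W \<and> (\<Sum>w\<in>H. ratio w powr s) \<le> \<eta> \<and>
     Pr v \<subseteq> (\<Union>w\<in>H. (\<lambda>x. act w x \<bullet> v) ` F)"

text \<open>Each ball of a cheap cover is replaced by at most \<open>N\<close> cylinders of no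
  larger ratio, so the cost grows at most by the factor \<open>N\<close>.\<close>

lemma cylinder_cover_exists:
  assumes G: "discrete G" and e: "norm e = 1" and nc: "\<not> nearly_coincident (Pr e)"
    and s: "s > 0" "ball_null s (Pr e)" and w0: "w0 \<in> W" and \<eta>: "\<eta> > 0"
  shows "\<exists>H. cylinder_cover s \<eta> (dir w0 e) H"
proof -
  from ball_cylinder_cover[OF G e nc] obtain N where
    N: "\<forall>w0\<in>W. \<forall>u r. 0 < r \<longrightarrow> r \<le> 1 \<longrightarrow> (\<exists>H. finite H \<and> H \<subseteq> W \<and> card H \<le> N \<and>
     (\<forall>w\<in>H. ratio w \<le> r) \<and> Pr (dir w0 e) \<inter> ball u r \<subseteq> (\<Union>w\<in>H. (\<lambda>x. act w x \<bullet> dir w0 e) ` F))" ..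
  \<comment> \<open>The bound 1 keeps all radii at most 1, the range in which balls can be replaced
    by cylinders.\<close>
  define \<epsilon> where "\<epsilon> = min 1 (\<eta> / (real N + 1))"
  have \<epsilon>: "\<epsilon> > 0" using \<eta> by (simp add: \<epsilon>_def)
  obtain B where B: "finite B" "\<And>b. b \<in> B \<Longrightarrow> snd b > 0"
      "Pr (dir w0 e) \<subseteq> (\<Union>b\<in>B. ball (fst b) (snd b))" "(\<Sum>b\<in>B. snd b powr s) < \<epsilon>"
    using ball_nullD[OF ball_null_dir[OF s(2) w0] \<epsilon>] by metis
  have small: "snd b \<le> 1" if "b \<in> B" for b
  proof -
    have "snd b powr s \<le> (\<Sum>b\<in>B. snd b powr s)"
      using B(1) that by (intro member_le_sum) auto
    also have "\<dots> < 1" using B(4) by (simp add: \<epsilon>_def)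
    finally show ?thesis using s(1) B(2)[OF that] by (smt (verit) ge_one_powr_ge_zero)
  qed
  have "\<exists>H. finite H \<and> H \<subseteq> W \<and> card H \<le> N \<and> (\<forall>w\<in>H. ratio w \<le> snd b) \<and>
     Pr (dir w0 e) \<inter> ball (fst b) (snd b) \<subseteq> (\<Union>w\<in>H. (\<lambda>x. act w x \<bullet> dir w0 e) ` F)" if "b \<in> B" for b
    using N[rule_format, OF w0 B(2)[OF that] small[OF that]] .
  then obtain h where h: "\<And>b. b \<in> B \<Longrightarrow> finite (h b) \<and> h b \<subseteq> W \<and> card (h b) \<le> N \<and> (\<forall>w\<in>h b. ratio w \<le> snd b) \<and>
     Pr (dir w0 e) \<inter> ball (fst b) (snd b) \<subseteq> (\<Union>w\<in>h b. (\<lambda>x. act w x \<bullet> dir w0 e) ` F)"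
    by metis
  define H where "H = (\<Union>b\<in>B. h b)"
  have finH: "finite H" unfolding H_def using B(1) h by auto
  have HW: "H \<subseteq> W" unfolding H_def by (intro UN_least) (use h in blast)
  have each: "(\<Sum>w\<in>h b. ratio w powr s) \<le> real N * snd b powr s" if "b \<in> B" for b
  proof -
    have "ratio w powr s \<le> snd b powr s" if "w \<in> h b" for w
      using h[OF \<open>b \<in> B\<close>] that s W_ratio by (intro powr_mono2) (auto simp: subset_eq less_imp_le)
    then have "(\<Sum>w\<in>h b. ratio w powr s) \<le> real (card (h b)) * snd b powr s"
      by (rule sum_bounded_above)
    also have "\<dots> \<le> real N * snd b powr s" using h[OF that] by (intro mult_right_mono) auto
    finally show ?thesis .
  qed
  have "(\<Sum>w\<in>H. ratio w powr s) \<le> (\<Sum>b\<in>B. \<Sum>w\<in>h b. ratio w powr s)"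
    unfolding H_def using B(1) h by (intro sum_UNION_le) auto
  also have "\<dots> \<le> (\<Sum>b\<in>B. real N * snd b powr s)" by (intro sum_mono each)
  also have "\<dots> = real N * (\<Sum>b\<in>B. snd b powr s)" by (simp add: sum_distrib_left)
  also have "\<dots> \<le> real N * (\<eta> / (real N + 1))" using B(4) by (intro mult_left_mono) (auto simp: \<epsilon>_def)
  also have "\<dots> \<le> \<eta>" using \<eta> by (simp add: field_simps)
  finally have sum: "(\<Sum>w\<in>H. ratio w powr s) \<le> \<eta>" .
  have "Pr (dir w0 e) \<subseteq> (\<Union>w\<in>H. (\<lambda>x. act w x \<bullet> dir w0 e) ` F)"
  proof
    fix p assume p: "p \<in> Pr (dir w0 e)"
    then obtain b where b: "b \<in> B" "p \<in> ball (fst b) (snd b)" using B(3) by blast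
    then have "p \<in> (\<Union>w\<in>h b. (\<lambda>x. act w x \<bullet> dir w0 e) ` F)" using h[OF b(1)] p by blast
    then show "p \<in> (\<Union>w\<in>H. (\<lambda>x. act w x \<bullet> dir w0 e) ` F)" using b(1) by (auto simp: H_def)
  qed
  then show ?thesis using finH HW sum by (auto simp: cylinder_cover_def)
qed

text \<open>Refining the cylinder of \<open>u\<close> requires a cover for the direction
  \<open>dir u (dir w e)\<close>, which is \<open>dir (wcomp w u) e\<close>. This is why covers are
  assumed for all words at once; weights multiply along the refinement.\<close>

lemma cylinder_cover_iterate:
  assumes cov: "\<And>w. w \<in> W \<Longrightarrow> cylinder_cover s \<eta> (dir w e) (h w)" and \<eta>: "\<eta> \<ge> 0" and w: "w \<in> W"
  shows "\<exists>H. cylinder_cover s (\<eta> ^ n) (dir w e) H"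
  using w
proof (induction n arbitrary: w)
  case 0
  show ?case
    by (intro exI[of _ "{(1, mat 1, 0)}"]) (auto simp: cylinder_cover_def Pr_def W.id)
next
  case (Suc n)
  let ?v = "dir w e"
  have h: "finite (h w)" "h w \<subseteq> W" "(\<Sum>u\<in>h w. ratio u powr s) \<le> \<eta>"
      "Pr ?v \<subseteq> (\<Union>u\<in>h w. (\<lambda>x. act u x \<bullet> ?v) ` F)"
    using cov[OF Suc.prems] by (auto simp: cylinder_cover_def)
  have "\<exists>H. cylinder_cover s (\<eta> ^ n) (dir u ?v) H" if "u \<in> h w" for u
  proof -
    have "wcomp w u \<in> W" using W_comp that h(2) Suc.prems by blast
    from Suc.IH[OF this] show ?thesis by (simp only: dir_wcomp)
  qed
  then obtain g where g: "\<And>u. u \<in> h w \<Longrightarrow> cylinder_cover s (\<eta> ^ n) (dir u ?v) (g u)" by metis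
  define H where "H = (\<Union>u\<in>h w. wcomp u ` g u)"
  have "finite H" "H \<subseteq> W"
    using h(1,2) g W_comp by (auto simp: H_def cylinder_cover_def subset_eq)
  moreover have "(\<Sum>z\<in>H. ratio z powr s) \<le> \<eta> ^ Suc n"
  proof -
    have "(\<Sum>z\<in>H. ratio z powr s) \<le> (\<Sum>u\<in>h w. \<Sum>z\<in>wcomp u ` g u. ratio z powr s)"
      unfolding H_def using h(1) g by (intro sum_UNION_le) (auto simp: cylinder_cover_def)
    also have "\<dots> \<le> (\<Sum>u\<in>h w. ratio u powr s * \<eta> ^ n)"
    proof (rule sum_mono)
      fix u assume u: "u \<in> h w"
      have "(\<Sum>z\<in>wcomp u ` g u. ratio z powr s) \<le> (\<Sum>z\<in>g u. ratio (wcomp u z) powr s)"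
        using sum_image_le[of "g u" "\<lambda>z. ratio z powr s" "wcomp u"] g[OF u]
        by (simp add: cylinder_cover_def o_def)
      also have "\<dots> = ratio u powr s * (\<Sum>z\<in>g u. ratio z powr s)"
        by (simp add: powr_mult sum_distrib_left)
      also have "\<dots> \<le> ratio u powr s * \<eta> ^ n"
        using g[OF u] by (intro mult_left_mono) (auto simp: cylinder_cover_def)
      finally show "(\<Sum>z\<in>wcomp u ` g u. ratio z powr s) \<le> ratio u powr s * \<eta> ^ n" .
    qed
    also have "\<dots> \<le> \<eta> * \<eta> ^ n"
      unfolding sum_distrib_right[symmetric] using h(3) \<eta> by (intro mult_right_mono) auto
    finally show ?thesis by simp
  qed
  moreover have "Pr ?v \<subseteq> (\<Union>z\<in>H. (\<lambda>x. act z x \<bullet> ?v) ` F)"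
  proof
    fix p assume "p \<in> Pr ?v"
    then obtain u y where u: "u \<in> h w" "y \<in> F" "p = act u y \<bullet> ?v" using h(4) by blast
    have "y \<bullet> dir u ?v \<in> Pr (dir u ?v)" using u by (simp add: Pr_def)
    then obtain z x where z: "z \<in> g u" "x \<in> F" "y \<bullet> dir u ?v = act z x \<bullet> dir u ?v"
      using g[OF u(1)] unfolding cylinder_cover_def by blast
    have "p = act (wcomp u z) x \<bullet> ?v" by (simp add: u(3) act_wcomp inner_act_dir[of u] z(3))
    then show "p \<in> (\<Union>z\<in>H. (\<lambda>x. act z x \<bullet> ?v) ` F)" using u z by (auto simp: H_def)
  qed
  ultimately show ?case by (auto simp: cylinder_cover_def)
qed

text \<open>A projected cylinder lies within \<open>L\<close> times its ratio of its translation
  coordinate; \<open>L + 1\<close> fits it into an open ball.\<close>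

lemma cylinder_cover_imp_ball_null:
  assumes s: "s > 0" and \<eta>: "0 \<le> \<eta>" "\<eta> < 1"
    and cov: "\<And>n. \<exists>H. cylinder_cover s (\<eta> ^ n) v H" and v: "norm v = 1"
  shows "ball_null s (Pr v)"
proof (rule ball_nullI)
  fix \<epsilon> :: real assume \<epsilon>: "\<epsilon> > 0"
  obtain L where L: "L > 0" "\<And>x. x \<in> F \<Longrightarrow> norm x \<le> L" using F_bound by blast
  have "\<epsilon> / (L + 1) powr s > 0" using \<epsilon> L by simp
  then obtain n where n: "\<eta> ^ n < \<epsilon> / (L + 1) powr s" using real_arch_pow_inv[OF _ \<eta>(2)] by blast
  obtain H where H: "finite H" "H \<subseteq> W" "(\<Sum>w\<in>H. ratio w powr s) \<le> \<eta> ^ n"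
      "Pr v \<subseteq> (\<Union>w\<in>H. (\<lambda>x. act w x \<bullet> v) ` F)"
    using cov[of n] by (auto simp: cylinder_cover_def)
  show "ball_covered s \<epsilon> (Pr v)"
  proof (rule ball_coveredI[OF H(1), where r = "\<lambda>w. (L + 1) * ratio w" and x = "\<lambda>w. shift w \<bullet> v"])
    show "0 < (L + 1) * ratio w" if "w \<in> H" for w using W_ratio[of w] that H(2) L by auto
    have "(\<Sum>w\<in>H. ((L + 1) * ratio w) powr s) = (L + 1) powr s * (\<Sum>w\<in>H. ratio w powr s)"
      by (simp add: powr_mult sum_distrib_left)
    also have "\<dots> \<le> (L + 1) powr s * \<eta> ^ n" using H(3) by (intro mult_left_mono) auto
    also have "\<dots> < \<epsilon>" using n L by (simp add: field_simps)
    finally show "(\<Sum>w\<in>H. ((L + 1) * ratio w) powr s) < \<epsilon>" .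
    show "Pr v \<subseteq> (\<Union>w\<in>H. ball (shift w \<bullet> v) ((L + 1) * ratio w))"
    proof
      fix p assume "p \<in> Pr v"
      then obtain w x where w: "w \<in> H" "x \<in> F" "p = act w x \<bullet> v" using H(4) by blast
      then have W: "w \<in> W" using H(2) by blast
      have "\<bar>x \<bullet> dir w v\<bar> \<le> L"
        using Cauchy_Schwarz_ineq2[of x "dir w v"] L(2)[OF w(2)] norm_dir[OF W, of v] v by simp
      then have "\<bar>x \<bullet> dir w v\<bar> < L + 1" by simp
      then have "ratio w * \<bar>x \<bullet> dir w v\<bar> < ratio w * (L + 1)"
        using W_ratio[OF W] by (intro mult_strict_left_mono) auto
      then have "p \<in> ball (shift w \<bullet> v) ((L + 1) * ratio w)"
        using W_ratio[OF W] by (simp add: w(3) inner_act_dir dist_real_def abs_mult mult.commute)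
      then show "p \<in> (\<Union>w\<in>H. ball (shift w \<bullet> v) ((L + 1) * ratio w))" using w(1) by blast
    qed
  qed
qed

text \<open>
  A null set with finitely many cylinders per ball has cylinder covers of small weight for the
  exponent \<open>s\<close>, and by continuity for some smaller exponent as well; iterating such a cover
  contradicts the minimality of \<open>s\<close>.
\<close>

lemma null_imp_nearly_coincident:
  assumes G: "discrete G" and e: "norm e = 1" and s: "s > 0" "ball_null s (Pr e)"
    and min: "\<And>s'. 0 < s' \<Longrightarrow> s' < s \<Longrightarrow> \<not> ball_null s' (Pr e)"
  shows "nearly_coincident (Pr e)"
proof (rule ccontr)
  assume nc: "\<not> nearly_coincident (Pr e)"
  \<comment> \<open>The direction \<open>dir w e\<close> depends only on the rotation of
    \<open>w\<close>, so finitely many covers, one per group element, serve all words and admit a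
    common smaller exponent. The weight 1/4 leaves room below 1/2.\<close>
  have "\<exists>H. cylinder_cover s (1/4) (transpose g *v e) H" if "g \<in> G" for g
  proof -
    obtain w where "w \<in> W" "rot w = g" using discrete_G_word[OF G \<open>g \<in> G\<close>] by blast
    then show ?thesis using cylinder_cover_exists[OF G e nc s, of w "1/4"] by (auto simp: dir_def)
  qed
  then obtain h where h: "\<And>g. g \<in> G \<Longrightarrow> cylinder_cover s (1/4) (transpose g *v e) (h g)" by metis
  have fin: "finite G" by (rule discrete_G_finite[OF G])
  have "\<forall>g\<in>G. eventually (\<lambda>s'. (\<Sum>w\<in>h g. ratio w powr s') < 1/2) (at_left s)"
  proof
    fix g assume g: "g \<in> G"
    have "((\<lambda>s'. \<Sum>w\<in>h g. ratio w powr s') \<longlongrightarrow> (\<Sum>w\<in>h g. ratio w powr s)) (at_left s)"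
    proof (intro tendsto_sum tendsto_powr[OF tendsto_const tendsto_ident_at])
      show "ratio w \<noteq> 0" if "w \<in> h g" for w
        using h[OF g] that W_ratio[of w] by (auto simp: cylinder_cover_def)
    qed
    then show "eventually (\<lambda>s'. (\<Sum>w\<in>h g. ratio w powr s') < 1/2) (at_left s)"
      using h[OF g] by (intro order_tendstoD(2)) (auto simp: cylinder_cover_def)
  qed
  then have "eventually (\<lambda>s'. \<forall>g\<in>G. (\<Sum>w\<in>h g. ratio w powr s') < 1/2) (at_left s)"
    using fin by (simp add: eventually_ball_finite)
  moreover have "eventually (\<lambda>s'. s' \<in> {0<..<s}) (at_left s)"
    by (rule eventually_at_left_real[OF s(1)])
  ultimately have "eventually (\<lambda>s'. (\<forall>g\<in>G. (\<Sum>w\<in>h g. ratio w powr s') < 1/2) \<and> s' \<in> {0<..<s}) (at_left s)"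
    by (rule eventually_conj)
  then obtain s' where s': "\<And>g. g \<in> G \<Longrightarrow> (\<Sum>w\<in>h g. ratio w powr s') < 1/2" "0 < s'" "s' < s"
    using eventually_happens'[OF trivial_limit_at_left_real] by fastforce
  have "cylinder_cover s' (1/2) (dir w e) (h (rot w))" if "w \<in> W" for w
    using h[OF W_rot_G[OF that]] s'(1)[OF W_rot_G[OF that]] by (auto simp: cylinder_cover_def dir_def)
  then have "\<exists>H. cylinder_cover s' ((1/2) ^ n) (dir (1, mat 1, 0) e) H" for n
    by (intro cylinder_cover_iterate[where h = "\<lambda>w. h (rot w)"]) (auto intro: W.id)
  moreover have "dir (1, mat 1, 0) e = e" by (simp add: dir_ident)
  ultimately have "ball_null s' (Pr e)"
    using s'(2) e by (intro cylinder_cover_imp_ball_null[of s' "1/2"]) auto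
  then show False using min s' by blast
qed

section \<open>Dense orthogonal parts\<close>

text \<open>The points stay in the plane because the direction changes during the construction.
  Strict bounds make the condition open in \<open>e\<close>.\<close>

definition planar_chain :: "nat \<Rightarrow> real^2 \<Rightarrow> real \<Rightarrow> (nat \<Rightarrow> real^2) \<Rightarrow> bool" where
  "planar_chain N e d z \<longleftrightarrow> d > 0 \<and> (\<forall>i\<le>N. z i \<in> F) \<and>
     (\<forall>i<N. d / 2 < (z (Suc i) - z i) \<bullet> e \<and> (z (Suc i) - z i) \<bullet> e < d)"

lemma planar_chain_imp_chain: "planar_chain N e d z \<Longrightarrow> chain 2 (Pr e) N d (\<lambda>i. z i \<bullet> e)"
  by (auto simp: planar_chain_def chain_def Pr_def inner_diff_left less_imp_le)

lemma planar_chain_perturb: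
  assumes "planar_chain N e d z"
  obtains \<tau> where "\<tau> > 0" "\<And>e'. norm (e' - e) < \<tau> \<Longrightarrow> planar_chain N e' d z"
proof -
  define U where "U = (\<Inter>i\<in>{..<N}. {e'. d / 2 < (z (Suc i) - z i) \<bullet> e'} \<inter> {e'. (z (Suc i) - z i) \<bullet> e' < d})"
  have "open U" unfolding U_def
    by (intro open_INT open_Int open_Collect_less continuous_intros ballI) auto
  moreover have "e \<in> U" using assms by (auto simp: U_def planar_chain_def)
  ultimately obtain \<tau> where \<tau>: "\<tau> > 0" "ball e \<tau> \<subseteq> U" using openE by blast
  show thesis
  proof (rule that[OF \<tau>(1)])
    fix e' assume "norm (e' - e) < \<tau>"
    then have "e' \<in> U" using \<tau>(2) by (auto simp: dist_norm norm_minus_commute)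
    then show "planar_chain N e' d z" using assms by (auto simp: U_def planar_chain_def)
  qed
qed

lemma inner_act_diff: "(act w x - act w y) \<bullet> e = ratio w * ((x - y) \<bullet> dir w e)"
  by (simp add: inner_diff_left inner_act_dir right_diff_distrib)

lemma planar_chain_act:
  assumes "planar_chain N (dir w e) d z" "w \<in> W"
  shows "planar_chain N e (ratio w * d) (\<lambda>i. act w (z i))"
  using assms W_ratio[OF assms(2)] W_act[OF assms(2)]
  by (auto simp: planar_chain_def inner_act_diff)

lemma planar_chain_prepend:
  assumes ch: "planar_chain N (dir w e) d z" and w: "w \<in> W" and y: "y \<in> F"
    and first: "ratio w * d / 2 < (act w (z 0) - y) \<bullet> e" "(act w (z 0) - y) \<bullet> e < ratio w * d"
  shows "planar_chain (Suc N) e (ratio w * d) (case_nat y (\<lambda>i. act w (z i)))"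
  using planar_chain_act[OF ch w] y first
  by (auto simp: planar_chain_def less_Suc_eq_0_disj split: nat.split)

lemma planar_chain_scale:
  assumes "planar_chain N e d z" "k > 0"
  shows "planar_chain N (k *\<^sub>R e) (k * d) z"
  using assms
  by (auto simp: planar_chain_def)

text \<open>Density controls \<open>rot w *v a\<close>, whereas projections see the transposed
  matrix; the isometry moves the rotation from one vector to the other.\<close>

lemma norm_dir_diff:
  assumes "w \<in> W"
  shows "norm (dir w e - a) = norm (rot w *v a - e)"
proof -
  have M: "orthogonal_matrix (transpose (rot w))" using W_rot[OF assms] by simp
  have "a = transpose (rot w) *v (rot w *v a)"
    using W_rot[OF assms] by (simp only: matrix_vector_mul_assoc) (simp add: orthogonal_matrix)
  then have "dir w e - a = transpose (rot w) *v (e - rot w *v a)"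
    unfolding dir_def by (simp only: matrix_vector_mult_diff_distrib)
  then show ?thesis
    using norm_orthogonal_matrix_mult[OF M] by (metis norm_minus_commute)
qed

text \<open>Rotations already act transitively on unit vectors, and under either assumption the
  closure of the group contains all rotations.\<close>

lemma dense_G_transitive:
  assumes G: "dense_in G {A. orthogonal_matrix A} \<or> dense_in G {A. rotation_matrix A}"
    and ab: "norm a = norm b" "norm a = 1" and \<tau>: "\<tau> > 0"
  shows "\<exists>w\<in>W. norm (rot w *v a - b) \<le> \<tau>"
proof -
  obtain f where f: "orthogonal_transformation f" "det (matrix f) = 1" "f a = b"
    using rotation_exists[of a b] ab by auto
  define R where "R = matrix f"
  have "orthogonal_matrix R" "rotation_matrix R"
    using f by (auto simp: R_def rotation_matrix_def orthogonal_transformation_matrix)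
  then have "R \<in> closure G" using G by (auto simp: dense_in_def)
  then obtain g where g: "g \<in> G" "dist g R < \<tau> / 2"
    using \<tau> closure_approachable[of R G] by (meson half_gt_zero)
  have "\<tau> / 2 > 0" using \<tau> by simp
  then obtain w where w: "w \<in> W" "near (\<tau>/2) (rot w) g" using W_near_G[OF g(1)] by blast
  have "near (\<tau>/2) g R" using g(2) by (intro near_if_dist) simp
  with w(2) have "near (\<tau>/2 + \<tau>/2) (rot w) R" by (rule near_trans)
  then have "norm (rot w *v a - R *v a) \<le> \<tau>" using nearD[of "\<tau>/2 + \<tau>/2" "rot w" R a] ab(2) by simp
  moreover have "R *v a = b"
    using f(1,3) orthogonal_transformation_matrix unfolding R_def by force
  ultimately show ?thesis using w(1) by auto
qed

lemma perpendicular_unit_exists: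
  fixes v :: "real^2"
  assumes "v \<noteq> 0"
  obtains f where "norm f = 1" "f \<bullet> v = 0"
proof -
  define p :: "real^2" where "p = vector [- (v $ 2), v $ 1]"
  have pv: "p \<bullet> v = 0" by (simp add: p_def inner_vec_def sum_2)
  have "p \<bullet> p = v \<bullet> v" by (simp add: p_def inner_vec_def sum_2)
  then have "p \<noteq> 0" using assms by auto
  then show thesis using pv by (intro that[of "p /\<^sub>R norm p"]) auto
qed

text \<open>
  For the step, let \<open>x0 \<noteq> y\<close> in \<open>F\<close> and let \<open>f\<close> be perpendicular to \<open>x0 - y\<close>.  A word \<open>u\<close> that
  contracts \<open>F\<close> strongly towards \<open>x0\<close> and turns \<open>f\<close> to \<open>e\<close> maps the given chain to a tiny chain near
  \<open>x0\<close>; a slight tilt of \<open>f\<close> puts \<open>y\<close> at the right distance from its start.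
\<close>

lemma planar_chain_extend:
  assumes G: "dense_in G {A. orthogonal_matrix A} \<or> dense_in G {A. rotation_matrix A}"
    and x0: "x0 \<in> F" and y: "y \<in> F" "x0 \<noteq> y" and e: "norm e = 1" and ch: "planar_chain N e d z"
  shows "\<exists>e' d' z'. e' \<noteq> 0 \<and> planar_chain (Suc N) e' d' z'"
proof -
  obtain \<tau> where \<tau>: "\<tau> > 0" "\<And>e'. norm (e' - e) < \<tau> \<Longrightarrow> planar_chain N e' d z"
    using planar_chain_perturb[OF ch] by metis
  have d: "d > 0" and z0: "z 0 \<in> F" using ch by (auto simp: planar_chain_def)
  obtain L where L: "L > 0" "\<And>x. x \<in> F \<Longrightarrow> norm x \<le> L" using F_bound by blast
  obtain f where f: "norm f = 1" "f \<bullet> (x0 - y) = 0"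
    using perpendicular_unit_exists[of "x0 - y"] y(2) by auto
  define D where "D = norm (x0 - y)"
  have D: "D > 0" using y(2) by (simp add: D_def)
  \<comment> \<open>Below 1/2 the tilt cannot cancel the unit vector \<open>f\<close>. Below
    \<tau>/2 it uses half of the permitted change of direction; the other half goes to the
    approximation by the word \<open>v\<close>.\<close>
  define m where "m = min (1/2) (\<tau>/2)"
  have m: "m > 0" "m \<le> 1/2" "m \<le> \<tau>/2" using \<tau>(1) by (auto simp: m_def)
  \<comment> \<open>Makes the total error \<open>(d + 2 * L) * \<rho>\<close> at most
    \<open>m * D / 4\<close>, small against the distance \<open>D\<close> of the two points.\<close>
  define \<rho> where "\<rho> = min 1 (m * D / (4 * (d + 2 * L)))"
  have \<rho>: "\<rho> > 0" "\<rho> \<le> 1" using m D d L by (auto simp: \<rho>_def)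
  have \<rho>D: "4 * ((d + 2 * L) * \<rho>) \<le> m * D"
  proof -
    have "\<rho> \<le> m * D / (4 * (d + 2 * L))" by (simp add: \<rho>_def)
    then show ?thesis using d L by (simp add: field_simps)
  qed
  have dL: "(d + 2 * L) * \<rho> = d * \<rho> + 2 * L * \<rho>" "d * \<rho> > 0" "2 * L * \<rho> > 0"
    using d L \<rho> by (auto simp: distrib_right)
  have mD: "m * D \<le> D / 2" using m D by simp
  obtain g where g: "g \<in> W" "ratio g \<le> \<rho>" "x0 \<in> act g ` F"
    using cylinder_exists x0 \<rho> by blast
  have "norm (dir g f) = 1" using norm_dir[OF g(1)] f by simp
  \<comment> \<open>The word \<open>g\<close> also turns \<open>f\<close>, to
    \<open>dir g f\<close>; the word \<open>v\<close> corrects this, so that the composed word sees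
    \<open>f\<close> as nearly \<open>e\<close>.\<close>
  then obtain v where v: "v \<in> W" "norm (rot v *v e - dir g f) \<le> \<tau>/2"
    using dense_G_transitive[OF G, of e "dir g f" "\<tau>/2"] e \<tau>(1) by auto
  define u where "u = wcomp g v"
  have u: "u \<in> W" using W_comp[OF v(1) g(1)] by (simp add: u_def)
  have ru: "0 < ratio u" "ratio u \<le> \<rho>"
  proof -
    have "ratio g * ratio v \<le> \<rho> * 1"
      using g(2) W_ratio[OF v(1)] W_ratio[OF g(1)] \<rho> by (intro mult_mono) auto
    then show "ratio u \<le> \<rho>" by (simp add: u_def)
    show "0 < ratio u" using W_ratio[OF u] by simp
  qed
  have dir_u: "norm (dir u f - e) \<le> \<tau>/2"
    using norm_dir_diff[OF v(1), of "dir g f" e] v(2) by (simp add: u_def dir_wcomp)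
  define p where "p = act u (z 0)"
  have near_x0: "norm (p - x0) \<le> 2 * L * \<rho>"
  proof -
    obtain x1 where x1: "x1 \<in> F" "x0 = act g x1" using g(3) by blast
    have "norm (p - x0) = ratio g * dist (act v (z 0)) x1"
      using dist_act[OF g(1)] by (simp add: p_def u_def act_wcomp x1 dist_norm)
    also have "\<dots> \<le> \<rho> * (2 * L)"
    proof (intro mult_mono)
      have "dist (act v (z 0)) x1 \<le> norm (act v (z 0)) + norm x1" by (simp add: dist_norm norm_triangle_ineq4)
      then show "dist (act v (z 0)) x1 \<le> 2 * L" using L(2)[OF W_act[OF v(1) z0]] L(2)[OF x1(1)] by simp
    qed (use g \<rho> in auto)
    finally show ?thesis by (simp add: mult_ac)
  qed
  define q where "q = p - y"
  have q_eq: "q = (x0 - y) + (p - x0)" by (simp add: q_def)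
  have "D \<le> norm q + norm (p - x0)"
    using norm_triangle_ineq4[of q "p - x0"] by (simp add: q_eq D_def)
  then have nq: "D / 2 \<le> norm q" using near_x0 \<rho>D dL mD by linarith
  then have q0: "norm q > 0" using D by linarith
  have fq: "\<bar>f \<bullet> q\<bar> \<le> 2 * L * \<rho>"
  proof -
    have "f \<bullet> q = f \<bullet> (x0 - y) + f \<bullet> (p - x0)" by (simp only: q_eq inner_add_right)
    then have "f \<bullet> q = f \<bullet> (p - x0)" by (simp add: f(2))
    then show ?thesis using Cauchy_Schwarz_ineq2[of f "p - x0"] f(1) near_x0 by simp
  qed
  \<comment> \<open>What the tilt must add to \<open>f \<bullet> q\<close> to reach
    \<open>3/4 * d * ratio u\<close>, the middle of the permitted range between factors 1/2 and
    1.\<close>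
  define \<beta> where "\<beta> = 3/4 * d * ratio u - f \<bullet> q"
  have \<beta>: "\<bar>\<beta>\<bar> \<le> (d + 2 * L) * \<rho>"
  proof -
    have "d * ratio u \<le> d * \<rho>" using ru d by (intro mult_left_mono) auto
    moreover have "0 \<le> d * ratio u" using ru d by simp
    ultimately show ?thesis using fq dL(1) unfolding \<beta>_def by linarith
  qed
  \<comment> \<open>The shortest vector with inner product \<beta> with \<open>q\<close>; it is
    small because \<open>norm q\<close> is at least \<open>D / 2\<close>.\<close>
  define h where "h = (\<beta> / (q \<bullet> q)) *\<^sub>R q"
  have hq: "h \<bullet> q = \<beta>" using q0 by (simp add: h_def)
  have nh: "norm h < m"
  proof -
    have "norm h = \<bar>\<beta>\<bar> / norm q"
      using q0 by (simp add: h_def dot_square_norm power2_eq_square)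
    also have "\<dots> \<le> ((d + 2 * L) * \<rho>) / (D / 2)"
      using \<beta> nq D q0 by (intro frac_le) auto
    also have "\<dots> = 2 * ((d + 2 * L) * \<rho>) / D" by simp
    also have "\<dots> < m"
    proof -
      have "2 * ((d + 2 * L) * \<rho>) < m * D" using \<rho>D dL by linarith
      then show ?thesis using D by (simp only: pos_divide_less_eq)
    qed
    finally show ?thesis .
  qed
  define e' where "e' = f + h"
  have "e' \<noteq> 0"
  proof
    assume "e' = 0"
    then have "norm f = norm h" by (metis e'_def add_eq_0_iff norm_minus_cancel)
    then show False using f(1) nh m by simp
  qed
  moreover have "planar_chain (Suc N) e' (ratio u * d) (case_nat y (\<lambda>i. act u (z i)))"
  proof (rule planar_chain_prepend[OF _ u y(1)])
    have "dir u e' - e = dir u h + (dir u f - e)"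
      by (simp add: e'_def dir_def matrix_vector_right_distrib)
    then have "norm (dir u e' - e) \<le> norm (dir u h) + norm (dir u f - e)"
      by (metis norm_triangle_ineq)
    also have "\<dots> < \<tau>" using nh m(3) dir_u norm_dir[OF u, of h] by simp
    finally show "planar_chain N (dir u e') d z" by (rule \<tau>(2))
    have val: "(act u (z 0) - y) \<bullet> e' = 3/4 * (ratio u * d)"
    proof -
      have "q \<bullet> e' = f \<bullet> q + h \<bullet> q" by (simp add: e'_def inner_add_right inner_commute)
      then have "q \<bullet> e' = 3/4 * (ratio u * d)" using hq by (simp add: \<beta>_def)
      then show ?thesis unfolding q_def p_def .
    qed
    have "ratio u * d > 0" using ru d by simp
    then show "ratio u * d / 2 < (act u (z 0) - y) \<bullet> e'" "(act u (z 0) - y) \<bullet> e' < ratio u * d"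
      unfolding val by linarith+
  qed
  ultimately show ?thesis by blast
qed

text \<open>Extending a chain changes its direction. Since a chain survives small changes of
  direction and words turn any unit vector close to any other, the image of the longer chain under a
  suitable word is a chain for \<open>e\<close> again.\<close>

lemma dense_G_planar_chain:
  assumes G: "dense_in G {A. orthogonal_matrix A} \<or> dense_in G {A. rotation_matrix A}"
    and xy: "x0 \<in> F" "y \<in> F" "x0 \<noteq> y"
  shows "norm e = 1 \<Longrightarrow> \<exists>d z. planar_chain N e d z"
proof (induction N arbitrary: e)
  case 0
  show ?case using xy(1) by (intro exI[of _ 1] exI[of _ "\<lambda>_. x0"]) (simp add: planar_chain_def)
next
  case (Suc N)
  obtain d z where "planar_chain N e d z" using Suc by blast
  then obtain e1 d1 z1 where 1: "e1 \<noteq> 0" "planar_chain (Suc N) e1 d1 z1"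
    using planar_chain_extend[OF G xy Suc.prems] by blast
  define a where "a = (1 / norm e1) *\<^sub>R e1"
  have a: "norm a = 1" using 1(1) by (simp add: a_def)
  have "planar_chain (Suc N) a (1 / norm e1 * d1) z1"
    unfolding a_def using 1 by (intro planar_chain_scale) auto
  then obtain \<tau> where \<tau>: "\<tau> > 0" "\<And>e'. norm (e' - a) < \<tau> \<Longrightarrow> planar_chain (Suc N) e' (1 / norm e1 * d1) z1"
    using planar_chain_perturb by metis
  obtain w where w: "w \<in> W" "norm (rot w *v a - e) \<le> \<tau> / 2"
    using dense_G_transitive[OF G, of a e "\<tau>/2"] a Suc.prems \<tau>(1) by auto
  have "norm (dir w e - a) < \<tau>" using norm_dir_diff[OF w(1), of e a] w(2) \<tau>(1) by simp
  from planar_chain_act[OF \<tau>(2)[OF this] w(1)] show ?case by blast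
qed

end

section \<open>Sets on a line\<close>

text \<open>An isometric copy of a set of reals on a line, so separated sets transfer directly. For
  Hausdorff measure only nullity is transferred, through balls, because covering sets may leave the
  line.\<close>

locale line_set =
  fixes A :: "real set" and u :: "'a::euclidean_space"
  assumes A: "compact A" "A \<noteq> {}" and u: "norm u = 1"
begin

definition E :: "'a set" where "E = (\<lambda>a. a *\<^sub>R u) ` A"

lemma uu: "u \<bullet> u = 1"
  using u by (simp add: dot_square_norm)

lemma dist_line: "dist (a *\<^sub>R u) (b *\<^sub>R u) = dist a b"
  using u by (simp add: dist_norm flip: scaleR_left_diff_distrib)

lemma dist_coordinate: "x \<in> E \<Longrightarrow> y \<in> E \<Longrightarrow> dist (x \<bullet> u) (y \<bullet> u) = dist x y"
  using u by (auto simp: E_def uu dist_real_def)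

lemma coordinate_image: "(\<lambda>x. x \<bullet> u) ` E = A"
  by (auto simp: E_def uu image_iff)

lemma E: "compact E" "E \<noteq> {}"
  using A unfolding E_def by (auto intro!: compact_continuous_image continuous_intros)

lemma ball_null_E: "ball_null t E \<longleftrightarrow> ball_null t A"
proof
  assume "ball_null t E"
  moreover have "dist (x \<bullet> u) (y \<bullet> u) \<le> 1 * dist x y" for x y :: 'a
    using Cauchy_Schwarz_ineq2[of "x - y" u] u by (simp add: dist_norm inner_diff_left)
  ultimately have "ball_null t ((\<lambda>x. x \<bullet> u) ` E)" by (intro ball_null_lipschitz[where L = 1]) auto
  then show "ball_null t A" by (simp add: coordinate_image)
next
  assume "ball_null t A"
  then show "ball_null t E"
    unfolding E_def by (rule ball_null_lipschitz[where L = 1]) (auto simp: u dist_real_def)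
qed

lemma hausdorff_measure_E: "s \<ge> 0 \<Longrightarrow> hausdorff_measure s E = 0 \<longleftrightarrow> s > 0 \<and> ball_null s A"
  using hausdorff_null_iff[OF E] by (simp add: ball_null_E)

lemma separated_coordinates:
  assumes "X \<subseteq> ball x R \<inter> E" "separated r X" "x \<in> E"
  shows "(\<lambda>x. x \<bullet> u) ` X \<subseteq> ball (x \<bullet> u) R \<inter> A" "separated r ((\<lambda>x. x \<bullet> u) ` X)"
    "card ((\<lambda>x. x \<bullet> u) ` X) = card X"
proof -
  have XE: "y \<in> X \<Longrightarrow> y \<in> E \<and> dist x y < R" for y using assms(1) by auto
  show "separated r ((\<lambda>x. x \<bullet> u) ` X)"
    using assms(2) XE dist_coordinate by (intro separated_isometric_image) auto
  have "inj_on (\<lambda>x. x \<bullet> u) X"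
    using XE dist_coordinate by (intro inj_onI) (metis dist_eq_0_iff)
  then show "card ((\<lambda>x. x \<bullet> u) ` X) = card X" by (rule card_image)
  show "(\<lambda>x. x \<bullet> u) ` X \<subseteq> ball (x \<bullet> u) R \<inter> A"
    using XE dist_coordinate[OF assms(3)] coordinate_image by fastforce
qed

lemma separated_line:
  assumes "X \<subseteq> ball a R \<inter> A" "separated r X"
  shows "(\<lambda>a. a *\<^sub>R u) ` X \<subseteq> ball (a *\<^sub>R u) R \<inter> E" "separated r ((\<lambda>a. a *\<^sub>R u) ` X)"
    "card ((\<lambda>a. a *\<^sub>R u) ` X) = card X"
proof -
  show "separated r ((\<lambda>a. a *\<^sub>R u) ` X)"
    using assms(2) dist_line by (intro separated_isometric_image) auto
  have "u \<noteq> 0" using u by auto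
  then have "inj_on (\<lambda>a. a *\<^sub>R u) X" by (intro inj_onI) simp
  then show "card ((\<lambda>a. a *\<^sub>R u) ` X) = card X" by (rule card_image)
  show "(\<lambda>a. a *\<^sub>R u) ` X \<subseteq> ball (a *\<^sub>R u) R \<inter> E"
    using assms(1) by (auto simp: E_def u dist_real_def)
qed

lemma assouad_dim_E_le:
  assumes "\<sigma> \<ge> 0" "C > 0"
    and X: "\<And>R r x X. \<lbrakk>0 < r; r < R; x \<in> A; finite X; X \<subseteq> ball x R \<inter> A; separated r X\<rbrakk>
        \<Longrightarrow> real (card X) \<le> C * (R / r) powr \<sigma>"
  shows "assouad_dim E \<le> \<sigma>"
proof (rule assouad_dim_le[OF E(1) assms(1,2)])
  fix R r :: real and x X
  assume *: "0 < r" "r < R" "x \<in> E" "finite X" "X \<subseteq> ball x R \<inter> E" "separated r X"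
  have "x \<bullet> u \<in> A" using *(3) coordinate_image by blast
  then have "real (card ((\<lambda>x. x \<bullet> u) ` X)) \<le> C * (R / r) powr \<sigma>"
    using separated_coordinates[OF *(5,6,3)] * by (intro X[of r R "x \<bullet> u"]) auto
  then show "real (card X) \<le> C * (R / r) powr \<sigma>"
    using separated_coordinates[OF *(5,6,3)] by simp
qed

lemma separated_card_le_A:
  "\<lbrakk>0 < r; r < R; X \<subseteq> ball x R \<inter> A; separated r X\<rbrakk> \<Longrightarrow> real (card X) \<le> 4 * (R / r) powr 1"
  using separated_card_le_real[of r X x R] by auto

lemma assouad_dim_E_le_1: "assouad_dim E \<le> 1"
  by (intro assouad_dim_E_le[of 1 4] separated_card_le_A) auto

lemma assouad_dim_E_ge:
  assumes X: "\<And>\<sigma> C. \<lbrakk>\<sigma> \<ge> 0; C > 0;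
        \<And>R r x X. \<lbrakk>0 < r; r < R; x \<in> A; X \<subseteq> ball x R \<inter> A; separated r X\<rbrakk>
        \<Longrightarrow> real (card X) \<le> C * (R / r) powr \<sigma>\<rbrakk> \<Longrightarrow> d \<le> \<sigma>"
  shows "d \<le> assouad_dim E"
proof (rule assouad_dim_ge)
  have "real (card X) \<le> 4 * (R / r) powr 1"
    if "0 < r" "r < R" "x \<in> E" "finite X" "X \<subseteq> ball x R \<inter> E" "separated r X" for R r x X
    using separated_card_le_A[of r R "(\<lambda>x. x \<bullet> u) ` X" "x \<bullet> u"] separated_coordinates[OF that(5,6,3)] that
    by simp
  then show "\<exists>\<sigma>\<ge>0. \<exists>C>0. \<forall>R>0. \<forall>r\<in>{0<..<R}. \<forall>x\<in>E.
      ereal_of_enat (covering_number r (ball x R \<inter> E)) \<le> ereal (C * (R / r) powr \<sigma>)"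
    using covering_bound_if_separated_bound[OF E(1), of 4 1] by (intro exI[of _ 1]) auto
next
  fix \<sigma> C assume \<sigma>: "\<sigma> \<ge> 0" "C > 0"
    and bd: "\<And>R r x X. \<lbrakk>0 < r; r < R; x \<in> E; X \<subseteq> ball x R \<inter> E; separated r X\<rbrakk>
        \<Longrightarrow> real (card X) \<le> C * (R / r) powr \<sigma>"
  show "d \<le> \<sigma>"
  proof (rule X[OF \<sigma>])
    fix R r x and X :: "real set" assume *: "0 < r" "r < R" "x \<in> A" "X \<subseteq> ball x R \<inter> A" "separated r X"
    have "x *\<^sub>R u \<in> E" unfolding E_def using *(3) by (rule imageI)
    from bd[OF *(1,2) this separated_line(1,2)[OF *(4,5)]]
    show "real (card X) \<le> C * (R / r) powr \<sigma>" using separated_line(3)[OF *(4,5)] by simp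
  qed
qed

lemma hausdorff_dim_E:
  shows "0 \<le> hausdorff_dim E"
    and "hausdorff_dim E < t \<Longrightarrow> ball_null t A"
    and "\<lbrakk>0 < t; t < hausdorff_dim E\<rbrakk> \<Longrightarrow> \<not> ball_null t A"
    and "\<lbrakk>0 < t; ball_null t A\<rbrakk> \<Longrightarrow> hausdorff_dim E \<le> t"
proof -
  let ?S = "{s. 0 \<le> s \<and> hausdorff_measure s E = 0}"
  have S: "?S = {s. 0 < s \<and> ball_null s A}" using hausdorff_measure_E by auto
  \<comment> \<open>Compact sets of reals are null for exponents above 1; this keeps the infimum
    defining \<open>hausdorff_dim\<close> from being taken over the empty set.\<close>
  have "ball_null 2 A"
    by (intro assouad_covered_imp_ball_null[OF A(1), of 1 2 4] separated_card_le_A) auto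
  then have ne: "?S \<noteq> {}" unfolding S by (auto intro!: exI[of _ 2])
  have bdd: "bdd_below ?S" by (auto intro!: bdd_belowI[of _ 0])
  show "0 \<le> hausdorff_dim E" unfolding hausdorff_dim_def using ne by (intro cInf_greatest) auto
  show le: "hausdorff_dim E \<le> t" if "0 < t" "ball_null t A" for t
    unfolding hausdorff_dim_def using bdd S that by (intro cInf_lower) auto
  show "ball_null t A" if t: "hausdorff_dim E < t"
  proof -
    obtain s where "s \<in> ?S" "s < t"
      using cInf_lessD[OF ne t[unfolded hausdorff_dim_def]] by blast
    then show ?thesis unfolding S by (auto intro: ball_null_mono_exponent)
  qed
  show "\<not> ball_null t A" if "0 < t" "t < hausdorff_dim E" using le that by force
qed

lemma hausdorff_dim_le_assouad_dim: "hausdorff_dim E \<le> assouad_dim E"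
proof (rule assouad_dim_E_ge)
  fix \<sigma> C assume \<sigma>: "\<sigma> \<ge> 0" "C > 0"
    and bd: "\<And>R r x X. \<lbrakk>0 < r; r < R; x \<in> A; X \<subseteq> ball x R \<inter> A; separated r X\<rbrakk>
        \<Longrightarrow> real (card X) \<le> C * (R / r) powr \<sigma>"
  have "hausdorff_dim E \<le> t" if "\<sigma> < t" for t
    using assouad_covered_imp_ball_null[OF A(1) that \<sigma> bd] \<sigma>(1) that by (intro hausdorff_dim_E(4)) auto
  then show "hausdorff_dim E \<le> \<sigma>" by (rule dense_ge)
qed

lemma long_chains_imp_assouad_dim_1:
  assumes "\<And>N. \<exists>d y. chain K A N d y" "K \<ge> 1"
  shows "assouad_dim E = 1"
proof (rule antisym[OF assouad_dim_E_le_1 assouad_dim_E_ge])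
  fix \<sigma> C assume "C > 0"
    and bd: "\<And>R r x X. \<lbrakk>0 < r; r < R; x \<in> A; X \<subseteq> ball x R \<inter> A; separated r X\<rbrakk>
        \<Longrightarrow> real (card X) \<le> C * (R / r) powr \<sigma>"
  then show "1 \<le> \<sigma>" using long_chains_exponent_ge_1[OF assms, of C \<sigma>] by blast
qed

lemma positive_measure_imp_assouad_dim_eq:
  assumes "self_embeddable a A" "hausdorff_measure (hausdorff_dim E) E > 0"
  shows "assouad_dim E = hausdorff_dim E"
proof (rule antisym[OF _ hausdorff_dim_le_assouad_dim])
  have "hausdorff_dim E = 0 \<or> \<not> ball_null (hausdorff_dim E) A"
    using assms(2) hausdorff_measure_E[OF hausdorff_dim_E(1)] hausdorff_dim_E(1) by auto
  from self_embeddable_separated_card_le[OF A hausdorff_dim_E(1,2) this assms(1)]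
  obtain C where "C > 0" "\<forall>R r x X. 0 < r \<longrightarrow> r < R \<longrightarrow> finite X \<longrightarrow> X \<subseteq> ball x R \<inter> A \<longrightarrow> separated r X
      \<longrightarrow> real (card X) \<le> C * (R / r) powr hausdorff_dim E" by blast
  then show "assouad_dim E \<le> hausdorff_dim E"
    using hausdorff_dim_E(1) by (intro assouad_dim_E_le[of _ C]) auto
qed

end

theorem theorem2p3:
  fixes I :: "'i set"
    and S :: "'i \<Rightarrow> real^2 \<Rightarrow> real^2"
    and c :: "'i \<Rightarrow> real"
    and Q :: "'i \<Rightarrow> real^2^2"
    and t :: "'i \<Rightarrow> real^2"
    and F :: "(real^2) set"
  defines "G \<equiv> generate orthogonal_group (Q ` I)"
  assumes "similarity_ifs I S c Q t"
    and "is_attractor I S F"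
    and "\<exists>x\<in>F. \<exists>y\<in>F. x \<noteq> y"
  shows "(discrete G \<longrightarrow>
           (\<forall>\<theta>\<in>{0..<pi}.
              (hausdorff_measure (hausdorff_dim (line_proj \<theta> ` F)) (line_proj \<theta> ` F) > 0 \<longrightarrow>
                 assouad_dim (line_proj \<theta> ` F) = hausdorff_dim (line_proj \<theta> ` F)) \<and>
              (hausdorff_measure (hausdorff_dim (line_proj \<theta> ` F)) (line_proj \<theta> ` F) = 0 \<longrightarrow>
                 assouad_dim (line_proj \<theta> ` F) = 1))) \<and>
         (dense_in G {A. orthogonal_matrix A} \<or> dense_in G {A. rotation_matrix A} \<longrightarrow>
           (\<forall>\<theta>\<in>{0..<pi}. assouad_dim (line_proj \<theta> ` F) = 1))"
proof -
  interpret P: planar_ifs I S c Q t F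
    using assms by unfold_locales
  have G: "P.G = G" by (simp add: P.G_def G_def)
  have u: "norm (direction \<theta>) = 1" for \<theta>
    by (simp add: direction_def norm_eq_sqrt_inner inner_vec_def sum_2 flip: power2_eq_square)
  have line: "line_set (P.Pr (direction \<theta>)) (direction \<theta>)" for \<theta>
    using P.compact_Pr P.Pr_nonempty u by unfold_locales
  have E: "line_proj \<theta> ` F = line_set.E (P.Pr (direction \<theta>)) (direction \<theta>)" for \<theta>
    unfolding line_set.E_def[OF line] by (simp add: P.Pr_def line_proj_def image_image)
  show ?thesis
  proof (intro conjI impI ballI)
    fix \<theta> assume "discrete G"
      and pos: "hausdorff_measure (hausdorff_dim (line_proj \<theta> ` F)) (line_proj \<theta> ` F) > 0"
    then obtain a where "self_embeddable a (P.Pr (direction \<theta>))"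
      using P.discrete_G_self_embeddable u G by blast
    then show "assouad_dim (line_proj \<theta> ` F) = hausdorff_dim (line_proj \<theta> ` F)"
      using pos unfolding E by (rule line_set.positive_measure_imp_assouad_dim_eq[OF line])
  next
    fix \<theta> assume disc: "discrete G"
      and zero: "hausdorff_measure (hausdorff_dim (line_proj \<theta> ` F)) (line_proj \<theta> ` F) = 0"
    define A where "A = P.Pr (direction \<theta>)"
    interpret L: line_set A "direction \<theta>"
      unfolding A_def by (rule line)
    define s where "s = hausdorff_dim L.E"
    have LE: "line_proj \<theta> ` F = L.E" unfolding E A_def ..
    have s: "s > 0" "ball_null s A"
      using zero L.hausdorff_measure_E[OF L.hausdorff_dim_E(1)] by (auto simp: LE s_def)
    obtain a where a: "self_embeddable a A"
      using P.discrete_G_self_embeddable u disc G unfolding A_def by blast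
    have nc: "nearly_coincident A"
      unfolding A_def
    proof (rule P.null_imp_nearly_coincident)
      show "\<not> ball_null s' (P.Pr (direction \<theta>))" if "0 < s'" "s' < s" for s'
        using L.hausdorff_dim_E(3)[of s'] that by (simp add: s_def A_def)
    qed (use disc G u s in \<open>auto simp: A_def\<close>)
    \<comment> \<open>Different points of \<open>F\<close> may have the same projection. A one-point
      projection would be null for every positive exponent, contradicting
      \<open>s > 0\<close>.\<close>
    have "\<exists>p\<in>A. \<exists>p'\<in>A. p \<noteq> p'"
    proof (rule ccontr)
      assume neg: "\<not> ?thesis"
      obtain p where "p \<in> A" using L.A(2) by blast
      then have "A = {p}" using neg by blast
      then have "ball_null (s/2) A" using s(1) by (simp add: ball_null_singleton)
      then show False using L.hausdorff_dim_E(3)[of "s/2"] s(1) by (simp add: s_def)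
    qed
    then obtain p p' where p: "p \<in> A" "p' \<in> A" "p \<noteq> p'" by blast
    \<comment> \<open>Self-embeddability at radius 1 gives a ratio between \<open>a\<close> and 1,
      so that \<open>9 / a\<close> is an admissible chain constant.\<close>
    have a1: "0 < a" "a \<le> 1"
    proof -
      show "0 < a" using a by (simp add: self_embeddable_def)
      show "a \<le> 1" by (rule self_embeddableE[OF a p(1), of 1]) auto
    qed
    show "assouad_dim (line_proj \<theta> ` F) = 1"
      unfolding LE
    proof (rule L.long_chains_imp_assouad_dim_1)
      show "\<exists>d y. chain (9 / a) A N d y" for N
        by (rule nearly_coincident_chain[OF L.A(1) p a nc])
      show "1 \<le> 9 / a" using a1 by simp
    qed
  next
    fix \<theta> assume dense: "dense_in G {A. orthogonal_matrix A} \<or> dense_in G {A. rotation_matrix A}"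
    obtain x y where xy: "x \<in> F" "y \<in> F" "x \<noteq> y" using assms(4) by blast
    have "\<exists>d z. chain 2 (P.Pr (direction \<theta>)) N d z" for N
      using P.dense_G_planar_chain[OF dense[folded G] xy u, of N \<theta>] P.planar_chain_imp_chain by blast
    then show "assouad_dim (line_proj \<theta> ` F) = 1"
      unfolding E by (intro line_set.long_chains_imp_assouad_dim_1[OF line, of 2]) auto
  qed
qed

end
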